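(* Let $k=\mathbb{Q}$ and let $a<b$ be positive integers. There is an isomorphism of (virtual) $\mathfrak{S}_a\times\mathfrak{S}_b^{\mathrm{op}}$-representations $$\mathrm{Hom}_{\mathcal{F}(\overline{\mathbf{Fin}};k)}\big(\overline{k[-]}^{\otimes a},\overline{k[-]}^{\otimes b}\big)\cong(-1)^{b-a+1}\big[\mathrm{sgn}_{\mathfrak{S}_a}\otimes\mathrm{sgn}_{\mathfrak{S}_b}\big]+\sum_{t=0}^{b-a}(-1)^t\Big[\big(k\,\mathrm{Hom}_{\mathbf{\Omega}}(\mathbf{b-t},\mathbf{a})\otimes\mathrm{sgn}_{\mathfrak{S}_t}\big)\big\uparrow_{\mathfrak{S}_{b-t}^{\mathrm{op}}\times\mathfrak{S}_t^{\mathrm{op}}}^{\mathfrak{S}_b^{\mathrm{op}}}\Big].$$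
   Context: $\overline{\mathbf{Fin}}$ is the category of finite non-empty sets and all maps; $\mathcal{F}(\overline{\mathbf{Fin}};k)$ is the category of functors from $\overline{\mathbf{Fin}}$ to $k$-modules with pointwise tensor product; $\overline{k[-]}$ sends $X$ to the kernel of the augmentation $k[X]\to k$, $[x]\mapsto 1$. For $n\in\mathbb{N}$, $\mathbf{n}=\{1,\dots,n\}$ ($\mathbf{0}=\emptyset$), $\mathbf{b-t}=\{1,\dots,b-t\}$, $\mathfrak{S}_n$ is the symmetric group and $\mathrm{sgn}_{\mathfrak{S}_n}$ its sign representation (on $k$). $\mathbf{\Omega}$ is the category of finite sets and surjections; $k\,\mathrm{Hom}_{\mathbf{\Omega}}(\mathbf{n},\mathbf{a})$ is the free $k$-module on the set of surjections $\mathbf{n}\to\mathbf{a}$, with $\mathfrak{S}_a$ acting by postcomposition and $\mathfrak{S}_n^{\mathrm{op}}$ by precomposition. The symbol $\uparrow$ denotes induction from $\mathfrak{S}_{b-t}\times\mathfrak{S}_t\subset\mathfrak{S}_b$ (right actions); the $\mathfrak{S}_a$-action is carried along. The action of $\mathfrak{S}_a\times\mathfrak{S}_b^{\mathrm{op}}$ on $\mathrm{Hom}(\overline{k[-]}^{\otimes a},\overline{k[-]}^{\otimes b})$ is induced by the place permutation actions on tensor powers: $V^{\otimes b}$ is regarded as contravariant in bijections of $\mathbf{b}$, a bijection $f:\mathbf{b}\to\mathbf{b}$ acting by $\bigotimes_i v_i\mapsto\bigotimes_i v_{f(i)}$, and similarly for $V^{\otimes a}$, acting by precomposition. Brackets denote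 classes in the Grothendieck group of finite-dimensional $\mathfrak{S}_a\times\mathfrak{S}_b^{\mathrm{op}}$-representations over $\mathbb{Q}$, and the isomorphism is understood as an equality there. *)

theory Defs
  imports
    "HOL-Library.Function_Algebras"
    Complex_Main
    "HOL-Library.FuncSet"
    "HOL-Algebra.Sym_Groups"
    "HOL-Algebra.Free_Abelian_Groups"
begin

section \<open>Rational vector spaces\<close>

class rat_vector = ab_group_add +
  fixes scaleQ :: "rat \<Rightarrow> 'a \<Rightarrow> 'a" (infixr \<open>*Q\<close> 75)
  assumes scaleQ_add_right: "c *Q (x + y) = c *Q x + c *Q y"
    and scaleQ_add_left: "(c + d) *Q x = c *Q x + d *Q x"
    and scaleQ_scaleQ: "c *Q d *Q x = (c * d) *Q x"
    and scaleQ_one: "1 *Q x = x"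

instantiation rat :: rat_vector
begin
definition scaleQ_rat :: "rat \<Rightarrow> rat \<Rightarrow> rat" where [simp]: "scaleQ_rat c x = c * x"
instance by standard (auto simp: algebra_simps)
end

instantiation "fun" :: (type, rat_vector) rat_vector
begin
definition scaleQ_fun :: "rat \<Rightarrow> ('a \<Rightarrow> 'b) \<Rightarrow> 'a \<Rightarrow> 'b" where "scaleQ_fun c f = (\<lambda>x. c *Q f x)"
instance
  by standard (auto simp: scaleQ_fun_def fun_eq_iff scaleQ_add_right scaleQ_add_left
      scaleQ_scaleQ scaleQ_one)
end

lemma scaleQ_fun_apply [simp]: "(c *Q f) x = c *Q f x"
  by (simp add: scaleQ_fun_def)

global_interpretation Q: vector_space "scaleQ :: rat \<Rightarrow> 'a \<Rightarrow> 'a::rat_vector"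
  by standard (auto simp: scaleQ_add_right scaleQ_add_left scaleQ_scaleQ scaleQ_one)

global_interpretation QQ: vector_space_pair
  "scaleQ :: rat \<Rightarrow> 'a \<Rightarrow> 'a::rat_vector" "scaleQ :: rat \<Rightarrow> 'b \<Rightarrow> 'b::rat_vector"
  ..

definition linear_on ::
    "'v::rat_vector set \<Rightarrow> 'w::rat_vector set \<Rightarrow> ('v \<Rightarrow> 'w) \<Rightarrow> bool" where
  "linear_on V W f \<longleftrightarrow> f \<in> V \<rightarrow> W
     \<and> (\<forall>x\<in>V. \<forall>y\<in>V. f (x + y) = f x + f y)
     \<and> (\<forall>c. \<forall>x\<in>V. f (c *Q x) = c *Q f x)"

text \<open>The free module on a finite set \<open>S\<close> consists of the rational functions supported on \<open>S\<close>;
  \<open>linearize S \<phi>\<close> is the linear extension of a map of sets \<open>\<phi>\<close> defined on \<open>S\<close>.\<close>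

definition free_module :: "'x set \<Rightarrow> ('x \<Rightarrow> rat) set" where
  "free_module S = {c. \<forall>x. x \<notin> S \<longrightarrow> c x = 0}"

definition linearize :: "'x set \<Rightarrow> ('x \<Rightarrow> 'y) \<Rightarrow> ('x \<Rightarrow> rat) \<Rightarrow> 'y \<Rightarrow> rat" where
  "linearize S \<phi> c = (\<lambda>y. \<Sum>x | x \<in> S \<and> \<phi> x = y. c x)"


section \<open>Tensor powers\<close>

text \<open>For a space \<open>V\<close> of rational functions on \<open>X\<close>, the canonical map from the \<open>n\<close>-th tensor power
  of \<open>V\<close> to the functions on \<open>X\<^sup>n\<close> is injective, so the tensor power is taken to be its image.
  The universal property is \<open>tensor_power_universal\<close> below.\<close>

definition pure_tensor :: "nat \<Rightarrow> (nat \<Rightarrow> 'x \<Rightarrow> rat) \<Rightarrow> (nat \<Rightarrow> 'x) \<Rightarrow> rat" where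
  "pure_tensor n v = (\<lambda>x. if x \<in> extensional {1..n} then \<Prod>i=1..n. v i (x i) else 0)"

definition tensor_power :: "nat \<Rightarrow> ('x \<Rightarrow> rat) set \<Rightarrow> ((nat \<Rightarrow> 'x) \<Rightarrow> rat) set" where
  "tensor_power n V = Q.span (pure_tensor n ` ({1..n} \<rightarrow>\<^sub>E V))"

definition multilinear_on ::
    "nat \<Rightarrow> 'v::rat_vector set \<Rightarrow> ((nat \<Rightarrow> 'v) \<Rightarrow> 'w::rat_vector) \<Rightarrow> bool" where
  "multilinear_on n V m \<longleftrightarrow>
     (\<forall>i\<in>{1..n}. \<forall>v\<in>{1..n} \<rightarrow>\<^sub>E V. linear_on V UNIV (\<lambda>u. m (v(i := u))))"

definition tensor_map :: "nat \<Rightarrow> ('x \<Rightarrow> rat) set \<Rightarrow> (('x \<Rightarrow> rat) \<Rightarrow> 'y \<Rightarrow> rat)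
    \<Rightarrow> ((nat \<Rightarrow> 'x) \<Rightarrow> rat) \<Rightarrow> (nat \<Rightarrow> 'y) \<Rightarrow> rat" where
  "tensor_map n V \<phi> = (SOME T. linear_on (tensor_power n V) UNIV T \<and>
     (\<forall>v \<in> {1..n} \<rightarrow>\<^sub>E V. T (pure_tensor n v) = pure_tensor n (\<lambda>i. \<phi> (v i))))"

text \<open>The right action of permutations of the places; on pure tensors it is
  \<open>v\<^sub>1 \<otimes> \<dots> \<otimes> v\<^sub>n \<mapsto> v\<^bsub>f(1)\<^esub> \<otimes> \<dots> \<otimes> v\<^bsub>f(n)\<^esub>\<close>, see \<open>place_perm_pure\<close>.\<close>

definition place_perm :: "(nat \<Rightarrow> nat) \<Rightarrow> ((nat \<Rightarrow> 'x) \<Rightarrow> rat) \<Rightarrow> (nat \<Rightarrow> 'x) \<Rightarrow> rat" where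
  "place_perm f t = (\<lambda>x. t (x \<circ> inv' f))"

lemma linear_on_subset: "linear_on V W f \<Longrightarrow> U \<subseteq> V \<Longrightarrow> linear_on U W f"
  unfolding linear_on_def by blast

lemma linear_on_span_ext:
  assumes f: "linear_on (Q.span S) W f" and g: "linear_on (Q.span S) W' g"
    and eq: "\<And>x. x \<in> S \<Longrightarrow> f x = g x" and v: "v \<in> Q.span S"
  shows "f v = g v"
proof -
  have z: "f 0 = 0" "g 0 = 0"
  proof -
    have "0 \<in> Q.span S" by (rule Q.span_zero)
    then have "f (0 *Q 0) = 0 *Q f 0" "g (0 *Q 0) = 0 *Q g 0"
      using f g unfolding linear_on_def by blast+
    then show "f 0 = 0" "g 0 = 0" by simp_all
  qed
  from v have "v \<in> Q.span S \<and> f v = g v"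
  proof (induction rule: Q.span_induct_alt)
    case base then show ?case using z by (auto simp: Q.span_zero)
  next
    case (step c x y)
    then have x: "x \<in> Q.span S" and cx: "c *Q x \<in> Q.span S"
      by (auto intro: Q.span_base Q.span_scale)
    have "f (c *Q x + y) = c *Q f x + f y" "g (c *Q x + y) = c *Q g x + g y"
      using f g x cx step unfolding linear_on_def by auto
    with step eq cx show ?case by (auto intro: Q.span_add)
  qed
  then show ?thesis ..
qed

lemma linear_imp_linear_on: "Vector_Spaces.linear scaleQ scaleQ f \<Longrightarrow> linear_on V UNIV f"
  by (simp add: linear_on_def QQ.linear_add QQ.linear_scale)

lemma PiE_upd: "v \<in> I \<rightarrow>\<^sub>E V \<Longrightarrow> i \<in> I \<Longrightarrow> u \<in> V \<Longrightarrow> v(i := u) \<in> I \<rightarrow>\<^sub>E V"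
  by (auto simp: PiE_iff extensional_def)

lemma multilinear_ext:
  assumes m: "multilinear_on n (Q.span B) m" and m': "multilinear_on n (Q.span B) m'"
    and eq: "\<And>v. v \<in> {1..n} \<rightarrow>\<^sub>E B \<Longrightarrow> m v = m' v"
    and v: "v \<in> {1..n} \<rightarrow>\<^sub>E Q.span B"
  shows "m v = m' v"
proof -
  have "\<forall>v \<in> {1..n} \<rightarrow>\<^sub>E Q.span B. (\<forall>i. k < i \<and> i \<le> n \<longrightarrow> v i \<in> B) \<longrightarrow> m v = m' v"
    if "k \<le> n" for k
    using that
  proof (induction k)
    case 0
    then show ?case using eq by (auto simp: PiE_iff)
  next
    case (Suc k)
    show ?case
    proof (intro ballI impI)
      fix v assume v: "v \<in> {1..n} \<rightarrow>\<^sub>E Q.span B" and vB: "\<forall>i. Suc k < i \<and> i \<le> n \<longrightarrow> v i \<in> B"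
      let ?i = "Suc k"
      have i: "?i \<in> {1..n}" using Suc.prems by auto
      have "m (v(?i := v ?i)) = m' (v(?i := v ?i))"
      proof (rule linear_on_span_ext[where f = "\<lambda>u. m (v(?i := u))" and g = "\<lambda>u. m' (v(?i := u))"])
        show "linear_on (Q.span B) UNIV (\<lambda>u. m (v(?i := u)))"
          using m i v unfolding multilinear_on_def by blast
        show "linear_on (Q.span B) UNIV (\<lambda>u. m' (v(?i := u)))"
          using m' i v unfolding multilinear_on_def by blast
        show "v ?i \<in> Q.span B" using v i by auto
        fix u assume u: "u \<in> B"
        have "v(?i := u) \<in> {1..n} \<rightarrow>\<^sub>E Q.span B"
          using v i u by (intro PiE_upd) (auto intro: Q.span_base)
        moreover have "\<forall>j. k < j \<and> j \<le> n \<longrightarrow> (v(?i := u)) j \<in> B" using vB u by auto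
        ultimately show "m (v(?i := u)) = m' (v(?i := u))" using Suc by auto
      qed
      then show "m v = m' v" by simp
    qed
  qed
  from this[of n] v show ?thesis by auto
qed

lemma pure_tensor_multilinear: "multilinear_on n V (pure_tensor n)"
proof -
  have prod: "(\<Prod>j=1..n. (v(i := u)) j (x j)) = u (x i) * (\<Prod>j\<in>{1..n}-{i}. v j (x j))"
    if "i \<in> {1..n}" for i u x and v :: "nat \<Rightarrow> 'a \<Rightarrow> rat"
  proof -
    have "(\<Prod>j\<in>{1..n}-{i}. (v(i := u)) j (x j)) = (\<Prod>j\<in>{1..n}-{i}. v j (x j))"
      by (rule prod.cong) auto
    then show ?thesis using that by (subst prod.remove[of _ i]) auto
  qed
  show ?thesis
    unfolding multilinear_on_def linear_on_def
    by (auto simp: pure_tensor_def fun_eq_iff prod algebra_simps simp del: fun_upd_apply One_nat_def)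
qed

lemma pure_tensors_independent:
  fixes B :: "('x \<Rightarrow> rat) set" and n :: nat
  assumes B: "Q.independent B" and S: "finite S" "S \<subseteq> {1..n} \<rightarrow>\<^sub>E B"
    and zero: "\<forall>x. (\<Sum>b\<in>S. c b * (\<Prod>i=1..n. b i (x i))) = 0"
  shows "\<forall>b\<in>S. c b = 0"
  using S zero
proof (induction n arbitrary: S c)
  case 0
  show ?case
  proof
    fix b assume b: "b \<in> S"
    with 0 have "S = {b}" by auto
    with 0(3) show "c b = 0" by simp
  qed
next
  case (Suc n)
  have main: "(\<Sum>b\<in>{b\<in>S. b (Suc n) = \<beta>}. c b * (\<Prod>i=1..n. b i (x i))) = 0" if "\<beta> \<in> B" for \<beta> x
  proof -
    let ?B = "(\<lambda>b. b (Suc n)) ` S"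
    define d where "d = (\<lambda>\<beta>. \<Sum>b\<in>{b\<in>S. b (Suc n) = \<beta>}. c b * (\<Prod>i=1..n. b i (x i)))"
    have fin: "finite ?B" using Suc.prems(1) by auto
    have sub: "?B \<subseteq> B"
    proof
      fix \<beta> assume "\<beta> \<in> ?B"
      then obtain b where "b \<in> S" "\<beta> = b (Suc n)" by auto
      then show "\<beta> \<in> B" using Suc.prems(2) by (auto dest!: subsetD PiE_mem[where x = "Suc n"])
    qed
    have "(\<Sum>\<beta>\<in>?B. d \<beta> *Q \<beta>) y = 0" for y
    proof -
      let ?x = "x(Suc n := y)"
      have "0 = (\<Sum>b\<in>S. c b * (\<Prod>i=1..Suc n. b i (?x i)))"
        using Suc.prems(3)[THEN spec, of ?x] by (rule sym)
      also have "\<dots> = (\<Sum>b\<in>S. c b * (\<Prod>i=1..n. b i (x i)) * b (Suc n) y)"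
        by (intro sum.cong refl) (simp add: mult.assoc)
      also have "\<dots> = (\<Sum>\<beta>\<in>?B. \<Sum>b\<in>{b\<in>S. b (Suc n) = \<beta>}. c b * (\<Prod>i=1..n. b i (x i)) * b (Suc n) y)"
        by (rule sum.image_gen) (rule Suc.prems)
      also have "\<dots> = (\<Sum>\<beta>\<in>?B. d \<beta> * \<beta> y)"
        unfolding d_def sum_distrib_right by (intro sum.cong refl) auto
      also have "\<dots> = (\<Sum>\<beta>\<in>?B. d \<beta> *Q \<beta>) y"
        using fin by (induction rule: finite_induct) auto
      finally show ?thesis by simp
    qed
    then have "(\<Sum>\<beta>\<in>?B. d \<beta> *Q \<beta>) = 0" by (simp add: fun_eq_iff)
    then have "d \<beta> = 0" if "\<beta> \<in> ?B" for \<beta>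
      using Q.independentD[OF B fin sub] that by blast
    moreover have "d \<beta> = 0" if "\<beta> \<notin> ?B" for \<beta>
    proof -
      have "{b\<in>S. b (Suc n) = \<beta>} = {}" using that by auto
      then show ?thesis unfolding d_def by (simp only: sum.empty)
    qed
    ultimately show ?thesis unfolding d_def by blast
  qed
  show ?case
  proof
    fix b assume b: "b \<in> S"
    define \<beta> where "\<beta> = b (Suc n)"
    let ?r = "\<lambda>b::nat \<Rightarrow> 'x \<Rightarrow> rat. restrict b {1..n}"
    let ?S = "{b\<in>S. b (Suc n) = \<beta>}"
    have \<beta>: "\<beta> \<in> B" using b Suc.prems(2) PiE_mem[of b "{1..Suc n}" "\<lambda>_. B" "Suc n"]
      unfolding \<beta>_def by auto
    have inj: "inj_on ?r ?S"
    proof (rule inj_onI)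
      fix p q assume p: "p \<in> ?S" and q: "q \<in> ?S" and r: "?r p = ?r q"
      show "p = q"
      proof
        fix i
        have pe: "p \<in> extensional {1..Suc n}" "q \<in> extensional {1..Suc n}"
          using p q Suc.prems(2) unfolding PiE_def by blast+
        consider "i \<in> {1..n}" | "i = Suc n" | "i \<notin> {1..Suc n}" by fastforce
        then show "p i = q i"
        proof cases
          case 1 then show ?thesis using fun_cong[OF r, of i] by simp
        next
          case 2 then show ?thesis using p q by simp
        next
          case 3
          then show ?thesis using pe(1)[THEN extensional_arb, of i] pe(2)[THEN extensional_arb, of i]
            by simp
        qed
      qed
    qed
    define c' where "c' = (\<lambda>r. c (the_inv_into ?S ?r r))"
    have c': "c' (?r b) = c b" if "b \<in> ?S" for b
      unfolding c'_def using the_inv_into_f_f[OF inj that] by simp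
    have "\<forall>r\<in>?r ` ?S. c' r = 0"
    proof (rule Suc.IH)
      show "finite (?r ` ?S)" using Suc.prems by auto
      show "?r ` ?S \<subseteq> {1..n} \<rightarrow>\<^sub>E B" using Suc.prems(2) by (auto simp: PiE_iff)
      show "\<forall>x. (\<Sum>r\<in>?r ` ?S. c' r * (\<Prod>i=1..n. r i (x i))) = 0"
      proof
      fix x
      have "(\<Sum>r\<in>?r ` ?S. c' r * (\<Prod>i=1..n. r i (x i)))
          = (\<Sum>b\<in>?S. c' (?r b) * (\<Prod>i=1..n. ?r b i (x i)))"
        by (subst sum.reindex[OF inj]) simp
      also have "\<dots> = (\<Sum>b\<in>?S. c b * (\<Prod>i=1..n. b i (x i)))"
        by (intro sum.cong refl) (simp add: c' del: One_nat_def)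
      also have "\<dots> = 0" by (rule main[OF \<beta>])
      finally show "(\<Sum>r\<in>?r ` ?S. c' r * (\<Prod>i=1..n. r i (x i))) = 0" .
      qed
    qed
    then show "c b = 0" using b c'[of b] unfolding \<beta>_def by auto
  qed
qed

lemma pure_tensor_restrict: "pure_tensor n (restrict v {1..n}) = pure_tensor n v"
  unfolding pure_tensor_def by (intro ext) (auto intro: prod.cong)

theorem tensor_power_universal:
  fixes m :: "(nat \<Rightarrow> 'x \<Rightarrow> rat) \<Rightarrow> 'w::rat_vector"
  assumes V: "Q.subspace V" and m: "multilinear_on n V m"
  shows "\<exists>T. linear_on (tensor_power n V) UNIV T \<and>
    (\<forall>v \<in> {1..n} \<rightarrow>\<^sub>E V. T (pure_tensor n v) = m v)"
proof -
  obtain B where B: "B \<subseteq> V" "Q.independent B" "V \<subseteq> Q.span B"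
    using Q.basis_exists by metis
  have VB: "V = Q.span B" using B V by (metis Q.span_minimal subset_antisym)
  let ?E = "{1..n} \<rightarrow>\<^sub>E B"
  have ind: "\<forall>b\<in>S. c b = 0"
    if S: "finite S" "S \<subseteq> ?E" and 0: "(\<Sum>b\<in>S. c b *Q pure_tensor n b) = 0" for S c
  proof (rule pure_tensors_independent[OF B(2) S], rule allI)
    fix x
    have s: "(\<Sum>b\<in>S. c b *Q pure_tensor n b) y = (\<Sum>b\<in>S. c b * pure_tensor n b y)" for y
      using S(1) by (induction rule: finite_induct) auto
    have "0 = (\<Sum>b\<in>S. c b * pure_tensor n b (restrict x {1..n}))"
      unfolding s[symmetric] 0 by simp
    also have "\<dots> = (\<Sum>b\<in>S. c b * (\<Prod>i=1..n. b i (x i)))"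
      by (intro sum.cong refl) (simp add: pure_tensor_def)
    finally show "(\<Sum>b\<in>S. c b * (\<Prod>i=1..n. b i (x i))) = 0" by simp
  qed
  have inj: "inj_on (pure_tensor n) ?E"
  proof (rule inj_onI, rule ccontr)
    fix p q assume p: "p \<in> ?E" and q: "q \<in> ?E" and e: "pure_tensor n p = pure_tensor n q"
      and ne: "p \<noteq> q"
    have "(\<Sum>b\<in>{p, q}. (if b = p then 1 else - 1) *Q pure_tensor n b) = 0"
      using ne by (subst sum.insert) (simp_all add: e scaleQ_one)
    then have "\<forall>b\<in>{p, q}. (if b = p then 1 else - 1 :: rat) = 0"
      using p q by (intro ind) simp_all
    then show False by simp
  qed
  have indep: "Q.independent (pure_tensor n ` ?E)"
    unfolding Q.independent_explicit_module
  proof (intro allI impI)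
    fix R u v
    assume R: "finite R" "R \<subseteq> pure_tensor n ` ?E" and 0: "(\<Sum>v\<in>R. u v *Q v) = 0" and v: "v \<in> R"
    obtain S where S: "S \<subseteq> ?E" "R = pure_tensor n ` S" using R(2) by (meson subset_imageE)
    have injS: "inj_on (pure_tensor n) S" using inj S(1) by (rule inj_on_subset)
    have fS: "finite S" using R(1) injS unfolding S(2) by (simp add: finite_image_iff)
    have "(\<Sum>b\<in>S. u (pure_tensor n b) *Q pure_tensor n b) = 0"
      using 0 unfolding S(2) by (subst (asm) sum.reindex[OF injS]) simp
    from ind[OF fS S(1) this] show "u v = 0" using v S(2) by auto
  qed
  have "\<exists>T. Vector_Spaces.linear scaleQ scaleQ T \<and>
      (\<forall>x\<in>pure_tensor n ` ?E. T x = m (the_inv_into ?E (pure_tensor n) x))"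
    by (rule QQ.linear_independent_extend[OF indep])
  then obtain T where T: "Vector_Spaces.linear scaleQ scaleQ T"
    "\<forall>x\<in>pure_tensor n ` ?E. T x = m (the_inv_into ?E (pure_tensor n) x)"
    by blast
  have TB: "T (pure_tensor n b) = m b" if "b \<in> ?E" for b
    using T(2) that the_inv_into_f_f[OF inj that] by simp
  show ?thesis
  proof (intro exI conjI ballI)
    show "linear_on (tensor_power n V) UNIV T" using T(1) by (rule linear_imp_linear_on)
    fix v assume v: "v \<in> {1..n} \<rightarrow>\<^sub>E V"
    show "T (pure_tensor n v) = m v"
    proof (rule multilinear_ext[where m = "\<lambda>v. T (pure_tensor n v)" and B = B and n = n])
      have "linear_on UNIV UNIV T" using T(1) by (rule linear_imp_linear_on)
      then show "multilinear_on n (Q.span B) (\<lambda>v. T (pure_tensor n v))"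
        using pure_tensor_multilinear[of n "Q.span B"]
        unfolding multilinear_on_def linear_on_def by auto
      show "multilinear_on n (Q.span B) m" using m VB by simp
      show "v \<in> {1..n} \<rightarrow>\<^sub>E Q.span B" using v VB by simp
    qed (rule TB)
  qed
qed

lemma tensor_map_props:
  assumes V: "Q.subspace V" and \<phi>: "linear_on V UNIV \<phi>"
  shows "linear_on (tensor_power n V) UNIV (tensor_map n V \<phi>)"
    and "v \<in> {1..n} \<rightarrow>\<^sub>E V \<Longrightarrow> tensor_map n V \<phi> (pure_tensor n v) = pure_tensor n (\<lambda>i. \<phi> (v i))"
proof -
  have m: "multilinear_on n V (\<lambda>v. pure_tensor n (\<lambda>i. \<phi> (v i)))"
    unfolding multilinear_on_def
  proof (intro ballI)
    fix i and v :: "nat \<Rightarrow> 'a \<Rightarrow> rat" assume i: "i \<in> {1..n}" and v: "v \<in> {1..n} \<rightarrow>\<^sub>E V"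
    let ?w = "restrict (\<lambda>j. \<phi> (v j)) {1..n}"
    have eq: "pure_tensor n (\<lambda>j. \<phi> ((v(i := u)) j)) = pure_tensor n (?w(i := \<phi> u))" for u
    proof -
      have "pure_tensor n (\<lambda>j. \<phi> ((v(i := u)) j))
          = pure_tensor n (restrict (\<lambda>j. \<phi> ((v(i := u)) j)) {1..n})"
        by (simp only: pure_tensor_restrict)
      also have "restrict (\<lambda>j. \<phi> ((v(i := u)) j)) {1..n} = ?w(i := \<phi> u)" using i by auto
      finally show ?thesis .
    qed
    have "?w \<in> {1..n} \<rightarrow>\<^sub>E UNIV" by (simp add: restrict_PiE_iff)
    then have "linear_on UNIV UNIV (\<lambda>u. pure_tensor n (?w(i := u)))"
      using pure_tensor_multilinear[of n UNIV] i unfolding multilinear_on_def by blast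
    then show "linear_on V UNIV (\<lambda>u. pure_tensor n (\<lambda>j. \<phi> ((v(i := u)) j)))"
      using \<phi> unfolding eq linear_on_def by auto
  qed
  have *: "linear_on (tensor_power n V) UNIV (tensor_map n V \<phi>) \<and>
     (\<forall>v \<in> {1..n} \<rightarrow>\<^sub>E V. tensor_map n V \<phi> (pure_tensor n v) = pure_tensor n (\<lambda>i. \<phi> (v i)))"
    unfolding tensor_map_def by (rule someI_ex[OF tensor_power_universal[OF V m]])
  show "linear_on (tensor_power n V) UNIV (tensor_map n V \<phi>)" using * by blast
  show "v \<in> {1..n} \<rightarrow>\<^sub>E V \<Longrightarrow> tensor_map n V \<phi> (pure_tensor n v) = pure_tensor n (\<lambda>i. \<phi> (v i))"
    using * by blast
qed

lemma place_perm_pure: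
  assumes f: "f permutes {1..n}"
  shows "place_perm f (pure_tensor n v) = pure_tensor n (v \<circ> f)"
proof
  fix x :: "nat \<Rightarrow> 'a"
  have i: "inv' f permutes {1..n}" using f by (rule permutes_inv)
  have ext: "x \<circ> inv' f \<in> extensional {1..n} \<longleftrightarrow> x \<in> extensional {1..n}"
    using permutes_not_in[OF i] permutes_in_image[OF i] by (auto simp: extensional_def)
  have "(\<Prod>i=1..n. v i (x (inv' f i))) = (\<Prod>i=1..n. v (f i) (x i))"
    by (subst prod.permute[OF f]) (auto simp: permutes_inverses[OF f] intro!: prod.cong)
  then show "place_perm f (pure_tensor n v) x = pure_tensor n (v \<circ> f) x"
    by (simp add: place_perm_def pure_tensor_def ext del: One_nat_def)
qed


section \<open>Functors on finite non-empty sets\<close>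

text \<open>The objects of the source category are the finite non-empty subsets of \<open>nat\<close>, the morphisms
  \<open>X \<rightarrow> Y\<close> are all maps; values of a map outside \<open>X\<close> are ignored.\<close>

definition fin_ne :: "nat set set" where
  "fin_ne = {X. finite X \<and> X \<noteq> {}}"

record 'v fin_functor =
  obj :: "nat set \<Rightarrow> 'v set"
  mor :: "nat set \<Rightarrow> nat set \<Rightarrow> (nat \<Rightarrow> nat) \<Rightarrow> 'v \<Rightarrow> 'v"

definition is_functor :: "'v::rat_vector fin_functor \<Rightarrow> bool" where
  "is_functor F \<longleftrightarrow>
     (\<forall>X\<in>fin_ne. Q.subspace (obj F X)) \<and>
     (\<forall>X\<in>fin_ne. \<forall>Y\<in>fin_ne. \<forall>f\<in>X \<rightarrow> Y. linear_on (obj F X) (obj F Y) (mor F X Y f)) \<and>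
     (\<forall>X\<in>fin_ne. \<forall>Y\<in>fin_ne. \<forall>f\<in>X \<rightarrow> Y. \<forall>g. (\<forall>x\<in>X. f x = g x) \<longrightarrow>
        (\<forall>v\<in>obj F X. mor F X Y f v = mor F X Y g v)) \<and>
     (\<forall>X\<in>fin_ne. \<forall>v\<in>obj F X. mor F X X id v = v) \<and>
     (\<forall>X\<in>fin_ne. \<forall>Y\<in>fin_ne. \<forall>Z\<in>fin_ne. \<forall>f\<in>X \<rightarrow> Y. \<forall>g\<in>Y \<rightarrow> Z. \<forall>v\<in>obj F X.
        mor F X Z (g \<circ> f) v = mor F Y Z g (mor F X Y f v))"

text \<open>A natural transformation is made to vanish outside its domain, so that equality of natural
  transformations is equality of functions and they form a vector space pointwise.\<close>

definition nat_trans ::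
    "'v::rat_vector fin_functor \<Rightarrow> 'w::rat_vector fin_functor \<Rightarrow> (nat set \<Rightarrow> 'v \<Rightarrow> 'w) set" where
  "nat_trans F G = {\<eta>.
     (\<forall>X\<in>fin_ne. linear_on (obj F X) (obj G X) (\<eta> X)) \<and>
     (\<forall>X\<in>fin_ne. \<forall>Y\<in>fin_ne. \<forall>f\<in>X \<rightarrow> Y. \<forall>v\<in>obj F X.
        \<eta> Y (mor F X Y f v) = mor G X Y f (\<eta> X v)) \<and>
     (\<forall>X v. X \<notin> fin_ne \<or> v \<notin> obj F X \<longrightarrow> \<eta> X v = 0)}"

definition reduced_functor :: "(nat \<Rightarrow> rat) fin_functor" where
  "reduced_functor =
     \<lparr>obj = \<lambda>X. {v \<in> free_module X. (\<Sum>x\<in>X. v x) = 0},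
      mor = \<lambda>X Y f. linearize X f\<rparr>"

definition tensor_functor ::
    "nat \<Rightarrow> ('x \<Rightarrow> rat) fin_functor \<Rightarrow> ((nat \<Rightarrow> 'x) \<Rightarrow> rat) fin_functor" where
  "tensor_functor n F =
     \<lparr>obj = \<lambda>X. tensor_power n (obj F X),
      mor = \<lambda>X Y f. tensor_map n (obj F X) (mor F X Y f)\<rparr>"


section \<open>Representations\<close>

record ('g, 'v) rep =
  rspace :: "'v set"
  ract :: "'g \<Rightarrow> 'v \<Rightarrow> 'v"

definition fd_rep :: "('g, 'm) monoid_scheme \<Rightarrow> ('g, 'v::rat_vector) rep \<Rightarrow> bool" where
  "fd_rep G V \<longleftrightarrow>
     (\<exists>B. finite B \<and> rspace V = Q.span B) \<and>
     (\<forall>g\<in>carrier G. linear_on (rspace V) (rspace V) (ract V g)) \<and>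
     (\<forall>v\<in>rspace V. ract V \<one>\<^bsub>G\<^esub> v = v) \<and>
     (\<forall>g\<in>carrier G. \<forall>h\<in>carrier G. \<forall>v\<in>rspace V. ract V (g \<otimes>\<^bsub>G\<^esub> h) v = ract V g (ract V h v))"

definition rep_hom :: "('g, 'm) monoid_scheme \<Rightarrow> ('g, 'v::rat_vector) rep
    \<Rightarrow> ('g, 'w::rat_vector) rep \<Rightarrow> ('v \<Rightarrow> 'w) set" where
  "rep_hom G V W = {f. linear_on (rspace V) (rspace W) f \<and>
     (\<forall>g\<in>carrier G. \<forall>v\<in>rspace V. f (ract V g v) = ract W g (f v))}"

definition rep_iso :: "('g, 'm) monoid_scheme \<Rightarrow> ('g, 'v::rat_vector) rep
    \<Rightarrow> ('g, 'w::rat_vector) rep \<Rightarrow> bool" where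
  "rep_iso G V W \<longleftrightarrow> (\<exists>f\<in>rep_hom G V W. bij_betw f (rspace V) (rspace W))"

definition short_exact :: "('g, 'm) monoid_scheme \<Rightarrow> ('g, 'u::rat_vector) rep
    \<Rightarrow> ('g, 'v::rat_vector) rep \<Rightarrow> ('g, 'w::rat_vector) rep \<Rightarrow> bool" where
  "short_exact G U V W \<longleftrightarrow> (\<exists>i\<in>rep_hom G U V. \<exists>p\<in>rep_hom G V W.
     inj_on i (rspace U) \<and> p ` rspace V = rspace W \<and> i ` rspace U = {v \<in> rspace V. p v = 0})"


subsection \<open>The Grothendieck group\<close>

text \<open>Every finite-dimensional representation is isomorphic to one on a subspace of
  \<open>nat \<Rightarrow> rat\<close> (\<open>fd_rep_model\<close> below). The Grothendieck group is the free abelian group on the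
  latter modulo short exact sequences; as usual for \<open>free_Abelian_group\<close>, its operation is
  written multiplicatively.\<close>

definition fd_reps :: "('g, 'm) monoid_scheme \<Rightarrow> ('g, nat \<Rightarrow> rat) rep set" where
  "fd_reps G = {V. fd_rep G V}"

definition exact_relations ::
    "('g, 'm) monoid_scheme \<Rightarrow> (('g, nat \<Rightarrow> rat) rep \<Rightarrow>\<^sub>0 int) set" where
  "exact_relations G = generate (free_Abelian_group (fd_reps G))
     {frag_of V - frag_of U - frag_of W | U V W.
        U \<in> fd_reps G \<and> V \<in> fd_reps G \<and> W \<in> fd_reps G \<and> short_exact G U V W}"

definition grothendieck_group ::
    "('g, 'm) monoid_scheme \<Rightarrow> (('g, nat \<Rightarrow> rat) rep \<Rightarrow>\<^sub>0 int) set monoid" where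
  "grothendieck_group G = free_Abelian_group (fd_reps G) Mod exact_relations G"

definition rep_class :: "('g, 'm) monoid_scheme \<Rightarrow> ('g, 'v::rat_vector) rep
    \<Rightarrow> (('g, nat \<Rightarrow> rat) rep \<Rightarrow>\<^sub>0 int) set" where
  "rep_class G V = exact_relations G #>\<^bsub>free_Abelian_group (fd_reps G)\<^esub>
     frag_of (SOME W. W \<in> fd_reps G \<and> rep_iso G V W)"


subsection \<open>Induction\<close>

text \<open>Given a homomorphism \<open>j\<close> from \<open>H\<close> to a finite group \<open>K\<close> that identifies \<open>H\<close> with a subgroup,
  a representation of \<open>A \<times> H\<close> is induced along \<open>j\<close> to one of \<open>A \<times> K\<close>, the action of \<open>A\<close> being
  carried along. The induced module is realised by the \<open>H\<close>-equivariant functions on \<open>K\<close>,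
  with \<open>K\<close> acting by right translation.\<close>

definition induced_rep :: "('a, 'm) monoid_scheme \<Rightarrow> ('h, 'n) monoid_scheme
    \<Rightarrow> ('k, 'p) monoid_scheme \<Rightarrow> ('h \<Rightarrow> 'k) \<Rightarrow> ('a \<times> 'h, 'v::rat_vector) rep
    \<Rightarrow> ('a \<times> 'k, 'k \<Rightarrow> 'v) rep" where
  "induced_rep A H K j V =
     \<lparr>rspace = {F. (\<forall>x. x \<notin> carrier K \<longrightarrow> F x = 0) \<and> (\<forall>x\<in>carrier K. F x \<in> rspace V) \<and>
        (\<forall>h\<in>carrier H. \<forall>x\<in>carrier K. F (j h \<otimes>\<^bsub>K\<^esub> x) = ract V (\<one>\<^bsub>A\<^esub>, h) (F x))},
      ract = \<lambda>(g, y) F x.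
        if x \<in> carrier K then ract V (g, \<one>\<^bsub>H\<^esub>) (F (x \<otimes>\<^bsub>K\<^esub> y)) else 0\<rparr>"


section \<open>The representations of \<open>S\<^sub>a \<times> S\<^sub>b\<^sup>o\<^sup>p\<close>\<close>

definition op_group :: "('g, 'm) monoid_scheme \<Rightarrow> 'g monoid" where
  "op_group G = \<lparr>carrier = carrier G, mult = \<lambda>x y. y \<otimes>\<^bsub>G\<^esub> x, one = \<one>\<^bsub>G\<^esub>\<rparr>"

abbreviation sym_bigroup :: "nat \<Rightarrow> nat \<Rightarrow> ((nat \<Rightarrow> nat) \<times> (nat \<Rightarrow> nat)) monoid" where
  "sym_bigroup a b \<equiv> sym_group a \<times>\<times> op_group (sym_group b)"

definition hom_rep :: "nat \<Rightarrow> nat \<Rightarrow> ((nat \<Rightarrow> nat) \<times> (nat \<Rightarrow> nat),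
    nat set \<Rightarrow> ((nat \<Rightarrow> nat) \<Rightarrow> rat) \<Rightarrow> (nat \<Rightarrow> nat) \<Rightarrow> rat) rep" where
  "hom_rep a b =
     \<lparr>rspace = nat_trans (tensor_functor a reduced_functor) (tensor_functor b reduced_functor),
      ract = \<lambda>(\<sigma>, \<tau>) \<eta> X t. place_perm \<tau> (\<eta> X (place_perm \<sigma> t))\<rparr>"

definition sgn_rep :: "((nat \<Rightarrow> nat) \<times> (nat \<Rightarrow> nat), rat) rep" where
  "sgn_rep = \<lparr>rspace = UNIV, ract = \<lambda>(\<sigma>, \<tau>) c. of_int (sign \<sigma>) * of_int (sign \<tau>) * c\<rparr>"

definition surjections :: "nat \<Rightarrow> nat \<Rightarrow> (nat \<Rightarrow> nat) set" where
  "surjections n a = {f \<in> {1..n} \<rightarrow>\<^sub>E {1..a}. f ` {1..n} = {1..a}}"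

text \<open>As \<open>sgn\<close> is one-dimensional, tensoring with it keeps the space and twists the action.\<close>

definition surj_sgn_rep :: "nat \<Rightarrow> nat
    \<Rightarrow> ((nat \<Rightarrow> nat) \<times> (nat \<Rightarrow> nat) \<times> (nat \<Rightarrow> nat), (nat \<Rightarrow> nat) \<Rightarrow> rat) rep" where
  "surj_sgn_rep n a =
     \<lparr>rspace = free_module (surjections n a),
      ract = \<lambda>(\<sigma>, \<tau>, \<rho>) c. of_int (sign \<rho>) *Q
        linearize (surjections n a) (\<lambda>f. compose {1..n} \<sigma> (compose {1..n} f \<tau>)) c\<rparr>"

definition block_sum :: "nat \<Rightarrow> (nat \<Rightarrow> nat) \<times> (nat \<Rightarrow> nat) \<Rightarrow> nat \<Rightarrow> nat" where
  "block_sum n = (\<lambda>(\<tau>, \<rho>) i. if i \<le> n then \<tau> i else \<rho> (i - n) + n)"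

definition induced_surj_rep :: "nat \<Rightarrow> nat \<Rightarrow> nat
    \<Rightarrow> ((nat \<Rightarrow> nat) \<times> (nat \<Rightarrow> nat), (nat \<Rightarrow> nat) \<Rightarrow> (nat \<Rightarrow> nat) \<Rightarrow> rat) rep" where
  "induced_surj_rep a b t = induced_rep (sym_group a)
     (op_group (sym_group (b - t)) \<times>\<times> op_group (sym_group t)) (op_group (sym_group b))
     (block_sum (b - t)) (surj_sgn_rep (b - t) a)"


section \<open>Well-definedness\<close>

lemma linearize_linear: "linear_on UNIV UNIV (linearize S \<phi>)"
  by (auto simp: linear_on_def linearize_def fun_eq_iff sum.distrib sum_distrib_left)

lemma linearize_free: "\<phi> \<in> S \<rightarrow> T \<Longrightarrow> linearize S \<phi> c \<in> free_module T"
  unfolding linearize_def free_module_def by (auto intro!: sum.neutral)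

lemma linearize_cong: "(\<And>x. x \<in> S \<Longrightarrow> \<phi> x = \<psi> x) \<Longrightarrow> linearize S \<phi> c = linearize S \<psi> c"
  unfolding linearize_def by (intro ext sum.cong) auto

lemma linearize_id:
  assumes "c \<in> free_module S" "\<And>x. x \<in> S \<Longrightarrow> \<phi> x = x" shows "linearize S \<phi> c = c"
proof
  fix y
  have "{x. x \<in> S \<and> \<phi> x = y} = (if y \<in> S then {y} else {})" using assms(2) by auto
  then show "linearize S \<phi> c y = c y"
    using assms(1) by (auto simp: linearize_def free_module_def)
qed

lemma linearize_comp:
  assumes "finite S" "finite T" "\<phi> \<in> S \<rightarrow> T"
  shows "linearize T \<psi> (linearize S \<phi> c) = linearize S (\<lambda>x. \<psi> (\<phi> x)) c"
proof
  fix z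
  let ?S = "{x. x \<in> S \<and> \<psi> (\<phi> x) = z}" and ?T = "{y. y \<in> T \<and> \<psi> y = z}"
  have "linearize T \<psi> (linearize S \<phi> c) z = (\<Sum>y\<in>?T. \<Sum>x | x \<in> ?S \<and> \<phi> x = y. c x)"
    unfolding linearize_def by (intro sum.cong) auto
  also have "\<dots> = sum c ?S"
    by (rule sum.group) (use assms in auto)
  finally show "linearize T \<psi> (linearize S \<phi> c) z = linearize S (\<lambda>x. \<psi> (\<phi> x)) c z"
    unfolding linearize_def .
qed

lemma linearize_sum:
  assumes "finite S" "finite T" "\<phi> \<in> S \<rightarrow> T"
  shows "(\<Sum>y\<in>T. linearize S \<phi> c y) = sum c S"
  unfolding linearize_def by (rule sum.group) (use assms in auto)

lemma is_functor_reduced: "is_functor reduced_functor"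
  unfolding is_functor_def
proof (intro conjI ballI allI impI)
  fix X assume X: "X \<in> fin_ne"
  show "Q.subspace (obj reduced_functor X)"
    unfolding Q.subspace_def reduced_functor_def free_module_def
    by (auto simp: sum.distrib sum_distrib_left[symmetric])
  show "mor reduced_functor X X id v = v" if "v \<in> obj reduced_functor X" for v
    using that by (auto simp: reduced_functor_def intro: linearize_id)
  fix Y f assume Y: "Y \<in> fin_ne" and f: "f \<in> X \<rightarrow> Y"
  have fin: "finite X" "finite Y" using X Y by (auto simp: fin_ne_def)
  show "linear_on (obj reduced_functor X) (obj reduced_functor Y) (mor reduced_functor X Y f)"
    using linearize_linear[of X f] linearize_free[OF f] linearize_sum[OF fin f]
    unfolding linear_on_def reduced_functor_def by auto
  show "mor reduced_functor X Y f v = mor reduced_functor X Y g v"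
    if "\<forall>x\<in>X. f x = g x" for g v
    using that by (auto simp: reduced_functor_def intro: linearize_cong)
  fix Z g v assume Z: "Z \<in> fin_ne"
  show "mor reduced_functor X Z (g \<circ> f) v = mor reduced_functor Y Z g (mor reduced_functor X Y f v)"
    using linearize_comp[OF fin f, of g v] by (simp add: reduced_functor_def comp_def)
qed

lemma is_functorD:
  assumes "is_functor F" "X \<in> fin_ne"
  shows "Q.subspace (obj F X)"
    and "Y \<in> fin_ne \<Longrightarrow> f \<in> X \<rightarrow> Y \<Longrightarrow> linear_on (obj F X) (obj F Y) (mor F X Y f)"
    and "Y \<in> fin_ne \<Longrightarrow> f \<in> X \<rightarrow> Y \<Longrightarrow> \<forall>x\<in>X. f x = g x \<Longrightarrow> v \<in> obj F X \<Longrightarrow>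
      mor F X Y f v = mor F X Y g v"
    and "v \<in> obj F X \<Longrightarrow> mor F X X id v = v"
    and "Y \<in> fin_ne \<Longrightarrow> Z \<in> fin_ne \<Longrightarrow> f \<in> X \<rightarrow> Y \<Longrightarrow> h \<in> Y \<rightarrow> Z \<Longrightarrow> v \<in> obj F X \<Longrightarrow>
      mor F X Z (h \<circ> f) v = mor F Y Z h (mor F X Y f v)"
  using assms unfolding is_functor_def by simp_all

lemma linear_on_UNIV: "linear_on V W f \<Longrightarrow> linear_on V UNIV f"
  unfolding linear_on_def by simp

lemma tensor_functor_pure:
  assumes F: "is_functor F" and XY: "X \<in> fin_ne" "Y \<in> fin_ne" "f \<in> X \<rightarrow> Y"
    and v: "v \<in> {1..n} \<rightarrow>\<^sub>E obj F X"
  shows "mor (tensor_functor n F) X Y f (pure_tensor n v) = pure_tensor n (\<lambda>i\<in>{1..n}. mor F X Y f (v i))"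
    and "(\<lambda>i\<in>{1..n}. mor F X Y f (v i)) \<in> {1..n} \<rightarrow>\<^sub>E obj F Y"
proof -
  note sub = is_functorD(1)[OF F XY(1)] and lin = is_functorD(2)[OF F XY]
  note lin' = linear_on_UNIV[OF lin]
  show "mor (tensor_functor n F) X Y f (pure_tensor n v) = pure_tensor n (\<lambda>i\<in>{1..n}. mor F X Y f (v i))"
    using tensor_map_props(2)[OF sub lin' v] by (simp add: tensor_functor_def pure_tensor_restrict del: One_nat_def)
  show "(\<lambda>i\<in>{1..n}. mor F X Y f (v i)) \<in> {1..n} \<rightarrow>\<^sub>E obj F Y"
    using lin v unfolding linear_on_def by auto
qed

lemma linear_on_comp: "linear_on U V f \<Longrightarrow> linear_on V W g \<Longrightarrow> linear_on U W (\<lambda>x. g (f x))"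
  unfolding linear_on_def by (simp add: Pi_iff)

lemma linear_on_span_into:
  assumes f: "linear_on (Q.span S) UNIV f" and S: "\<And>x. x \<in> S \<Longrightarrow> f x \<in> Q.span T"
  shows "linear_on (Q.span S) (Q.span T) f"
proof -
  have "v \<in> Q.span S \<and> f v \<in> Q.span T" if "v \<in> Q.span S" for v
    using that
  proof (induction rule: Q.span_induct_alt)
    case base
    have "f (0 *Q 0) = 0 *Q f 0"
      using f Q.span_zero[of S] unfolding linear_on_def by blast
    then show ?case by (simp add: Q.span_zero)
  next
    case (step c x y)
    have x: "x \<in> Q.span S" "c *Q x \<in> Q.span S"
      using step by (auto intro: Q.span_base Q.span_scale)
    have "f (c *Q x + y) = c *Q f x + f y" using f x step unfolding linear_on_def by auto
    then show ?case using step x S by (auto intro: Q.span_add Q.span_scale)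
  qed
  then show ?thesis using f unfolding linear_on_def by auto
qed

lemma is_functor_tensor:
  assumes F: "is_functor F"
  shows "is_functor (tensor_functor n F)"
  unfolding is_functor_def
proof (intro conjI ballI allI impI)
  let ?T = "tensor_functor n F"
  let ?P = "\<lambda>X. pure_tensor n ` ({1..n} \<rightarrow>\<^sub>E obj F X)"
  have objT: "obj ?T X = Q.span (?P X)" for X
    by (simp add: tensor_functor_def tensor_power_def)
  have lin: "linear_on (Q.span (?P X)) (Q.span (?P Y)) (mor ?T X Y f)"
    if "X \<in> fin_ne" "Y \<in> fin_ne" "f \<in> X \<rightarrow> Y" for X Y f
  proof (rule linear_on_span_into)
    show "linear_on (Q.span (?P X)) UNIV (mor ?T X Y f)"
      using tensor_map_props(1)[OF is_functorD(1)[OF F that(1)] linear_on_UNIV[OF is_functorD(2)[OF F that]], of n]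
      by (simp add: tensor_functor_def tensor_power_def)
    fix x assume "x \<in> ?P X"
    then obtain v where v: "v \<in> {1..n} \<rightarrow>\<^sub>E obj F X" "x = pure_tensor n v" by auto
    show "mor ?T X Y f x \<in> Q.span (?P Y)"
      unfolding v(2) tensor_functor_pure(1)[OF F that v(1)]
      using tensor_functor_pure(2)[OF F that v(1)] by (intro Q.span_base imageI)
  qed
  fix X assume X: "X \<in> fin_ne"
  have idX: "id \<in> X \<rightarrow> X" by simp
  show "Q.subspace (obj ?T X)" unfolding objT by (rule Q.subspace_span)
  show "mor ?T X X id v = v" if "v \<in> obj ?T X" for v
  proof (rule linear_on_span_ext[OF lin[OF X X idX]])
    show "linear_on (Q.span (?P X)) UNIV (\<lambda>x. x)" by (auto simp: linear_on_def)
    show "v \<in> Q.span (?P X)" using that objT by simp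
    fix x assume "x \<in> ?P X"
    then obtain w where w: "w \<in> {1..n} \<rightarrow>\<^sub>E obj F X" "x = pure_tensor n w" by auto
    have "(\<lambda>i\<in>{1..n}. mor F X X id (w i)) = w"
    proof
      fix i show "(\<lambda>i\<in>{1..n}. mor F X X id (w i)) i = w i"
        using is_functorD(4)[OF F X PiE_mem[OF w(1), of i]] PiE_arb[OF w(1), of i]
        by (cases "i \<in> {1..n}") (simp_all del: One_nat_def)
    qed
    then show "mor ?T X X id x = x" using tensor_functor_pure(1)[OF F X X idX w(1)] w(2) by simp
  qed
  fix Y f assume Y: "Y \<in> fin_ne" and f: "f \<in> X \<rightarrow> Y"
  show "linear_on (obj ?T X) (obj ?T Y) (mor ?T X Y f)"
    unfolding objT by (rule lin[OF X Y f])
  show "mor ?T X Y f v = mor ?T X Y g v"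
    if fg: "\<forall>x\<in>X. f x = g x" and v: "v \<in> obj ?T X" for g v
  proof -
    have g: "g \<in> X \<rightarrow> Y"
    proof
      fix x assume "x \<in> X"
      then show "g x \<in> Y" using f fg[rule_format, of x] by (auto dest: funcset_mem)
    qed
    show ?thesis
    proof (rule linear_on_span_ext[OF lin[OF X Y f] lin[OF X Y g]])
      show "v \<in> Q.span (?P X)" using v objT by simp
      fix x assume "x \<in> ?P X"
      then obtain w where w: "w \<in> {1..n} \<rightarrow>\<^sub>E obj F X" "x = pure_tensor n w" by auto
      have "mor F X Y f (w i) = mor F X Y g (w i)" if "i \<in> {1..n}" for i
        by (rule is_functorD(3)[OF F X Y f fg PiE_mem[OF w(1) that]])
      then have "(\<lambda>i\<in>{1..n}. mor F X Y f (w i)) = (\<lambda>i\<in>{1..n}. mor F X Y g (w i))" by auto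
      then show "mor ?T X Y f x = mor ?T X Y g x"
        using tensor_functor_pure(1)[OF F X Y f w(1)] tensor_functor_pure(1)[OF F X Y g w(1)] w(2)
        by simp
    qed
  qed
  fix Z g v assume Z: "Z \<in> fin_ne" and g: "g \<in> Y \<rightarrow> Z" and v: "v \<in> obj ?T X"
  have gf: "g \<circ> f \<in> X \<rightarrow> Z" using f g by auto
  show "mor ?T X Z (g \<circ> f) v = mor ?T Y Z g (mor ?T X Y f v)"
  proof (rule linear_on_span_ext[OF lin[OF X Z gf] linear_on_comp[OF lin[OF X Y f] lin[OF Y Z g]]])
    show "v \<in> Q.span (?P X)" using v objT by simp
    fix x assume "x \<in> ?P X"
    then obtain w where w: "w \<in> {1..n} \<rightarrow>\<^sub>E obj F X" "x = pure_tensor n w" by auto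
    let ?w = "\<lambda>i\<in>{1..n}. mor F X Y f (w i)"
    have "mor F X Z (g \<circ> f) (w i) = mor F Y Z g (mor F X Y f (w i))" if "i \<in> {1..n}" for i
      by (rule is_functorD(5)[OF F X Y Z f g PiE_mem[OF w(1) that]])
    then have "(\<lambda>i\<in>{1..n}. mor F X Z (g \<circ> f) (w i)) = (\<lambda>i\<in>{1..n}. mor F Y Z g (?w i))" by auto
    then show "mor ?T X Z (g \<circ> f) x = mor ?T Y Z g (mor ?T X Y f x)"
      using tensor_functor_pure[OF F X Y f w(1)] tensor_functor_pure(1)[OF F X Z gf w(1)]
        tensor_functor_pure(1)[OF F Y Z g, of ?w n] w(2)
      by simp
  qed
qed

lemma subspace_fd:
  assumes "Q.subspace U" "U \<subseteq> Q.span B" "finite B"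
  shows "\<exists>C. finite C \<and> U = Q.span C"
proof -
  obtain C where C: "C \<subseteq> U" "Q.independent C" "U \<subseteq> Q.span C"
    using Q.basis_exists by metis
  have "finite C" using Q.independent_span_bound[of B C] C assms by blast
  moreover have "U = Q.span C" using C assms(1) by (simp add: Q.span_minimal subset_antisym)
  ultimately show ?thesis by blast
qed

lemma fd_rep_sgn: "fd_rep (sym_bigroup a b) sgn_rep"
proof -
  have "UNIV \<subseteq> Q.span {1::rat}"
  proof
    fix x :: rat
    have "x *Q 1 \<in> Q.span {1::rat}" by (intro Q.span_scale Q.span_base) simp
    then show "x \<in> Q.span {1::rat}" by simp
  qed
  then have "\<exists>B. finite B \<and> (UNIV::rat set) = Q.span B"
    by (intro exI[of _ "{1}"]) auto
  moreover have "permutation p" if "p permutes {1..n}" for p and n :: nat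
    using that permutation_permutes by blast
  ultimately show ?thesis
    by (auto simp: fd_rep_def sgn_rep_def linear_on_def sym_group_def op_group_def sign_compose
        algebra_simps simp del: One_nat_def)
qed

lemma finite_surjections: "finite (surjections n a)"
  unfolding surjections_def by (rule finite_subset[OF _ finite_PiE[of "{1..n}" "\<lambda>_. {1..a}"]]) auto

lemma surjections_comp:
  assumes "\<sigma> permutes {1..a}" "\<tau> permutes {1..n}" "f \<in> surjections n a"
  shows "compose {1..n} \<sigma> (compose {1..n} f \<tau>) \<in> surjections n a"
proof -
  have f: "f \<in> {1..n} \<rightarrow>\<^sub>E {1..a}" "f ` {1..n} = {1..a}"
    using assms(3) unfolding surjections_def by auto
  have "compose {1..n} \<sigma> (compose {1..n} f \<tau>) ` {1..n} = \<sigma> ` f ` \<tau> ` {1..n}"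
    by (simp add: compose_def image_image cong: image_cong_simp)
  also have "\<dots> = {1..a}" using f(2) permutes_image assms(1,2) by metis
  finally have im: "compose {1..n} \<sigma> (compose {1..n} f \<tau>) ` {1..n} = {1..a}" .
  then have "compose {1..n} \<sigma> (compose {1..n} f \<tau>) \<in> {1..n} \<rightarrow>\<^sub>E {1..a}"
    by (auto simp: PiE_iff compose_def simp del: One_nat_def)
  with im show ?thesis unfolding surjections_def by simp
qed

lemma subspace_free_module: "Q.subspace (free_module S)"
  unfolding Q.subspace_def free_module_def by auto

lemma free_module_fd:
  assumes "finite S" shows "\<exists>B. finite B \<and> free_module S = Q.span B"
proof (rule subspace_fd[OF subspace_free_module])
  let ?e = "\<lambda>x y. if y = x then 1 else 0 :: rat"
  show "finite (?e ` S)" using assms by simp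
  show "free_module S \<subseteq> Q.span (?e ` S)"
  proof
    fix c assume c: "c \<in> free_module S"
    have "(\<Sum>x\<in>S. c x *Q ?e x) y = c y" for y
    proof -
      have "(\<Sum>x\<in>T. c x *Q ?e x) y = (\<Sum>x\<in>T. c x * ?e x y)" if "finite T" for T
        using that by (induction rule: finite_induct) auto
      then have "(\<Sum>x\<in>S. c x *Q ?e x) y = (\<Sum>x\<in>S. c x * ?e x y)" using assms by blast
      also have "\<dots> = (\<Sum>x\<in>S. if y = x then c x else 0)" by (intro sum.cong) auto
      also have "\<dots> = c y" using assms c by (simp add: free_module_def)
      finally show ?thesis .
    qed
    then have "c = (\<Sum>x\<in>S. c x *Q ?e x)" by (auto simp: fun_eq_iff)
    moreover have "(\<Sum>x\<in>S. c x *Q ?e x) \<in> Q.span (?e ` S)"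
      by (intro Q.span_sum Q.span_scale Q.span_base imageI)
    ultimately show "c \<in> Q.span (?e ` S)" by simp
  qed
qed

lemma fd_rep_surj_sgn:
  "fd_rep (sym_group a \<times>\<times> (op_group (sym_group n) \<times>\<times> op_group (sym_group t))) (surj_sgn_rep n a)"
  (is "fd_rep ?G _")
  unfolding fd_rep_def
proof (intro conjI ballI)
  let ?S = "surjections n a"
  let ?L = "\<lambda>\<sigma> \<tau> f. compose {1..n} \<sigma> (compose {1..n} f \<tau>)"
  show "\<exists>B. finite B \<and> rspace (surj_sgn_rep n a) = Q.span B"
    using free_module_fd[OF finite_surjections] by (simp add: surj_sgn_rep_def)
  have L: "?L \<sigma> \<tau> \<in> ?S \<rightarrow> ?S" if "\<sigma> permutes {1..a}" "\<tau> permutes {1..n}" for \<sigma> \<tau>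
    using surjections_comp[OF that] by auto
  fix g assume g: "g \<in> carrier ?G"
  then obtain \<sigma> \<tau> \<rho> where gd: "g = (\<sigma>, \<tau>, \<rho>)" "\<sigma> permutes {1..a}" "\<tau> permutes {1..n}" "\<rho> permutes {1..t}"
    by (cases g) (auto simp: sym_group_def op_group_def)
  show "linear_on (rspace (surj_sgn_rep n a)) (rspace (surj_sgn_rep n a)) (ract (surj_sgn_rep n a) g)"
    using linearize_linear[of ?S "?L \<sigma> \<tau>"] linearize_free[OF L[OF gd(2,3)]]
      Q.subspace_scale[OF subspace_free_module]
    unfolding gd linear_on_def surj_sgn_rep_def
    by (auto simp: Q.scale_right_distrib Q.scale_left_commute)
  fix h c assume h: "h \<in> carrier ?G" and c: "c \<in> rspace (surj_sgn_rep n a)"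
  obtain \<sigma>' \<tau>' \<rho>' where hd: "h = (\<sigma>', \<tau>', \<rho>')" "\<sigma>' permutes {1..a}" "\<tau>' permutes {1..n}" "\<rho>' permutes {1..t}"
    using h by (cases h) (auto simp: sym_group_def op_group_def)
  have gh: "g \<otimes>\<^bsub>?G\<^esub> h = (\<sigma> \<circ> \<sigma>', \<tau>' \<circ> \<tau>, \<rho>' \<circ> \<rho>)"
    unfolding gd hd by (simp add: sym_group_def op_group_def)
  have s: "sign (\<rho>' \<circ> \<rho>) = sign \<rho> * sign \<rho>'"
    using gd(4) hd(4) permutation_permutes by (subst sign_compose) (auto simp del: One_nat_def)
  have comp: "?L (\<sigma> \<circ> \<sigma>') (\<tau>' \<circ> \<tau>) f = ?L \<sigma> \<tau> (?L \<sigma>' \<tau>' f)" for f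
    using permutes_in_image[OF gd(3)]
    by (auto simp: compose_def fun_eq_iff simp del: One_nat_def atLeastAtMost_iff)
  have "linearize ?S (?L (\<sigma> \<circ> \<sigma>') (\<tau>' \<circ> \<tau>)) c = linearize ?S (?L \<sigma> \<tau>) (linearize ?S (?L \<sigma>' \<tau>') c)"
    unfolding comp
    by (rule linearize_comp[OF finite_surjections finite_surjections L[OF hd(2,3)], symmetric])
  moreover have "linearize ?S \<phi> (x *Q d) = x *Q linearize ?S \<phi> d"
    for \<phi> :: "(nat \<Rightarrow> nat) \<Rightarrow> nat \<Rightarrow> nat" and x d
    using linearize_linear unfolding linear_on_def by blast
  ultimately show "ract (surj_sgn_rep n a) (g \<otimes>\<^bsub>?G\<^esub> h) c
      = ract (surj_sgn_rep n a) g (ract (surj_sgn_rep n a) h c)"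
    unfolding gh unfolding gd hd by (simp add: surj_sgn_rep_def s del: One_nat_def)
next
  fix c assume c: "c \<in> rspace (surj_sgn_rep n a)"
  have "linearize (surjections n a) (\<lambda>f. compose {1..n} id (compose {1..n} f id)) c = c"
  proof (rule linearize_id)
    show "c \<in> free_module (surjections n a)" using c by (simp add: surj_sgn_rep_def)
    fix f assume "f \<in> surjections n a"
    then have "f \<in> extensional {1..n}" unfolding surjections_def PiE_def by blast
    then show "compose {1..n} id (compose {1..n} f id) = f"
      by (auto simp: compose_def fun_eq_iff extensional_def simp del: One_nat_def)
  qed
  then show "ract (surj_sgn_rep n a) \<one>\<^bsub>?G\<^esub> c = c"
    by (simp add: surj_sgn_rep_def sym_group_def op_group_def del: One_nat_def)
qed

lemma group_op_group:
  assumes "group G" shows "group (op_group G)"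
proof -
  interpret group G by fact
  show ?thesis
  proof (rule groupI)
    fix x assume "x \<in> carrier (op_group G)"
    then show "\<exists>y\<in>carrier (op_group G). y \<otimes>\<^bsub>op_group G\<^esub> x = \<one>\<^bsub>op_group G\<^esub>"
      by (intro bexI[of _ "inv\<^bsub>G\<^esub> x"]) (auto simp: op_group_def)
  qed (auto simp: op_group_def m_assoc)
qed

lemma block_sum_permutes:
  assumes "\<tau> permutes {1..m}" "\<rho> permutes {1..n}"
  shows "block_sum m (\<tau>, \<rho>) permutes {1..m + n}"
proof -
  have \<tau>: "\<tau> i \<le> m" if "i \<le> m" for i
    using that permutes_in_image[OF assms(1), of i] permutes_not_in[OF assms(1), of i]
    by (cases "i \<in> {1..m}") auto
  have \<rho>: "0 < \<rho> i \<longleftrightarrow> 0 < i" "\<rho> i \<le> n \<longleftrightarrow> i \<le> n" for i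
    using permutes_in_image[OF assms(2), of i] permutes_not_in[OF assms(2), of i]
    by (cases "i \<in> {1..n}"; force)+
  have \<rho>i: "0 < inv' \<rho> i \<longleftrightarrow> 0 < i" for i
    using permutes_in_image[OF permutes_inv[OF assms(2)], of i]
      permutes_not_in[OF permutes_inv[OF assms(2)], of i]
    by (cases "i \<in> {1..n}"; force)+
  have \<tau>i: "inv' \<tau> i \<le> m" if "i \<le> m" for i
    using that permutes_in_image[OF permutes_inv[OF assms(1)], of i]
      permutes_not_in[OF permutes_inv[OF assms(1)], of i]
    by (cases "i \<in> {1..m}") auto
  have bij: "bij (block_sum m (\<tau>, \<rho>))"
  proof (rule bijI')
    fix x y
    have inj: "\<tau> u = \<tau> v \<longleftrightarrow> u = v" "\<rho> u = \<rho> v \<longleftrightarrow> u = v" for u v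
      using permutes_inj[OF assms(1)] permutes_inj[OF assms(2)] by (auto simp: inj_eq)
    have cross: "\<tau> u \<noteq> \<rho> (v - m) + m" if "u \<le> m" "\<not> v \<le> m" for u v
      using \<tau>[OF that(1)] \<rho>(1)[of "v - m"] that by auto
    show "block_sum m (\<tau>, \<rho>) x = block_sum m (\<tau>, \<rho>) y \<longleftrightarrow> x = y"
      using cross[of x y] cross[of y x] by (auto simp: block_sum_def inj)
  next
    fix y
    show "\<exists>x. y = block_sum m (\<tau>, \<rho>) x"
    proof (cases "y \<le> m")
      case True
      then show ?thesis
        using \<tau>i by (intro exI[of _ "inv' \<tau> y"]) (simp add: block_sum_def permutes_inverses[OF assms(1)])
    next
      case False
      then show ?thesis
        using \<rho>i[of "y - m"] by (intro exI[of _ "inv' \<rho> (y - m) + m"])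
          (simp add: block_sum_def permutes_inverses[OF assms(2)])
    qed
  qed
  have "block_sum m (\<tau>, \<rho>) i = i" if "i \<notin> {1..m + n}" for i
  proof -
  from that consider "i = 0" | "i > m + n" by fastforce
  then show "block_sum m (\<tau>, \<rho>) i = i"
  proof cases
    case 1 then show ?thesis using permutes_not_in[OF assms(1), of 0] by (simp add: block_sum_def)
  next
    case 2
    then have "i - m \<notin> {1..n}" by auto
    then have "\<rho> (i - m) = i - m" by (rule permutes_not_in[OF assms(2)])
    with 2 show ?thesis by (simp add: block_sum_def)
  qed
  qed
  then show ?thesis unfolding permutes_def using bij by (metis bij_pointE)
qed

lemma fd_rep_induced:
  fixes V :: "('a \<times> 'h, 'v::rat_vector) rep" and K :: "('k, 'p) monoid_scheme"
  assumes A: "group A" and H: "group H" and K: "group K" "finite (carrier K)"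
    and j: "j \<in> carrier H \<rightarrow> carrier K" and V: "fd_rep (A \<times>\<times> H) V"
  shows "fd_rep (A \<times>\<times> K) (induced_rep A H K j V)"
proof -
  interpret A: group A by fact
  interpret H: group H by fact
  interpret K: group K by fact
  let ?I = "induced_rep A H K j V"
  obtain B where B: "finite B" "rspace V = Q.span B" using V unfolding fd_rep_def by blast
  have sub: "Q.subspace (rspace V)" unfolding B(2) by (rule Q.subspace_span)
  note sub0 = Q.subspace_0[OF sub] and subadd = Q.subspace_add[OF sub] and subsc = Q.subspace_scale[OF sub]
  have lin: "ract V (g, h) v \<in> rspace V"
      "ract V (g, h) (v + w) = ract V (g, h) v + ract V (g, h) w"
      "ract V (g, h) (c *Q v) = c *Q ract V (g, h) v"
    if "g \<in> carrier A" "h \<in> carrier H" "v \<in> rspace V" "w \<in> rspace V" for g h v w c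
  proof -
    have "(g, h) \<in> carrier (A \<times>\<times> H)" using that by simp
    then have "linear_on (rspace V) (rspace V) (ract V (g, h))"
      using V unfolding fd_rep_def by blast
    then show "ract V (g, h) v \<in> rspace V"
      "ract V (g, h) (v + w) = ract V (g, h) v + ract V (g, h) w"
      "ract V (g, h) (c *Q v) = c *Q ract V (g, h) v"
      using that unfolding linear_on_def by auto
  qed
  have zero: "ract V (g, h) 0 = 0" if "g \<in> carrier A" "h \<in> carrier H" for g h
    using lin(3)[OF that sub0 sub0, of 0] by simp
  have one: "ract V (\<one>\<^bsub>A\<^esub>, \<one>\<^bsub>H\<^esub>) v = v" if "v \<in> rspace V" for v
    using V that unfolding fd_rep_def by simp
  have mult: "ract V (g, h) (ract V (g', h') v) = ract V (g \<otimes>\<^bsub>A\<^esub> g', h \<otimes>\<^bsub>H\<^esub> h') v"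
    if "g \<in> carrier A" "h \<in> carrier H" "g' \<in> carrier A" "h' \<in> carrier H" "v \<in> rspace V" for g h g' h' v
  proof -
    have "(g, h) \<in> carrier (A \<times>\<times> H)" "(g', h') \<in> carrier (A \<times>\<times> H)" using that by simp_all
    then have "ract V ((g, h) \<otimes>\<^bsub>A \<times>\<times> H\<^esub> (g', h')) v = ract V (g, h) (ract V (g', h') v)"
      using V that(5) unfolding fd_rep_def by blast
    then show ?thesis by simp
  qed
  have jK: "j h \<in> carrier K" if "h \<in> carrier H" for h using j that by auto
  have mem: "F \<in> rspace ?I \<longleftrightarrow> (\<forall>x. x \<notin> carrier K \<longrightarrow> F x = 0) \<and> (\<forall>x\<in>carrier K. F x \<in> rspace V) \<and>
        (\<forall>h\<in>carrier H. \<forall>x\<in>carrier K. F (j h \<otimes>\<^bsub>K\<^esub> x) = ract V (\<one>\<^bsub>A\<^esub>, h) (F x))" for F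
    by (simp add: induced_rep_def)
  have act: "ract ?I (g, y) F x = (if x \<in> carrier K then ract V (g, \<one>\<^bsub>H\<^esub>) (F (x \<otimes>\<^bsub>K\<^esub> y)) else 0)" for g y F x
    by (simp add: induced_rep_def)
  have subI: "Q.subspace (rspace ?I)"
    unfolding Q.subspace_def using zero lin sub0 subadd subsc by (auto simp: mem)
  let ?D = "(\<lambda>(k, b) x. if x = k then b else 0) :: 'k \<times> 'v \<Rightarrow> 'k \<Rightarrow> 'v"
  have "rspace ?I \<subseteq> Q.span (?D ` (carrier K \<times> B))"
  proof
    fix F assume F: "F \<in> rspace ?I"
    have "F = (\<Sum>k\<in>carrier K. ?D (k, F k))"
    proof
      fix x
      have "(\<Sum>k\<in>T. ?D (k, F k)) x = (\<Sum>k\<in>T. if x = k then F k else 0)" if "finite T" for T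
        using that by (induction rule: finite_induct) auto
      then show "F x = (\<Sum>k\<in>carrier K. ?D (k, F k)) x" using K(2) F unfolding mem by auto
    qed
    moreover have D: "?D (k, v) \<in> Q.span (?D ` (carrier K \<times> B))" if k: "k \<in> carrier K" and v: "v \<in> rspace V" for k v
      using v unfolding B(2)
    proof (induction rule: Q.span_induct_alt)
      case base
      have "?D (k, 0 :: 'v) = 0" by auto
      then show ?case by (simp only: Q.span_zero)
    next
      case (step c b w)
      have "?D (k, c *Q b + w) = c *Q ?D (k, b) + ?D (k, w)" by (auto simp: fun_eq_iff)
      moreover have "?D (k, b) \<in> Q.span (?D ` (carrier K \<times> B))"
        using k step by (intro Q.span_base imageI) simp
      ultimately show ?case using step by (simp only: Q.span_add Q.span_scale)
    qed
    moreover have "(\<Sum>k\<in>carrier K. ?D (k, F k)) \<in> Q.span (?D ` (carrier K \<times> B))"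
      by (rule Q.span_sum, rule D) (use F in \<open>auto simp: mem\<close>)
    ultimately show "F \<in> Q.span (?D ` (carrier K \<times> B))" by simp
  qed
  then have fd: "\<exists>C. finite C \<and> rspace ?I = Q.span C"
    by (rule subspace_fd[OF subI]) (use B(1) K(2) in simp)
  have closed: "ract ?I (g, y) F \<in> rspace ?I"
    if g: "g \<in> carrier A" and y: "y \<in> carrier K" and F: "F \<in> rspace ?I" for g y F
    unfolding mem act
  proof (intro conjI ballI allI impI)
    fix h x assume h: "h \<in> carrier H" and x: "x \<in> carrier K"
    have Fxy: "F (x \<otimes>\<^bsub>K\<^esub> y) \<in> rspace V" using F x y unfolding mem by simp
    have "F (j h \<otimes>\<^bsub>K\<^esub> x \<otimes>\<^bsub>K\<^esub> y) = ract V (\<one>\<^bsub>A\<^esub>, h) (F (x \<otimes>\<^bsub>K\<^esub> y))"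
      using F x y h jK[OF h] unfolding mem by (simp add: K.m_assoc)
    then have "ract V (g, \<one>\<^bsub>H\<^esub>) (F (j h \<otimes>\<^bsub>K\<^esub> x \<otimes>\<^bsub>K\<^esub> y))
        = ract V (\<one>\<^bsub>A\<^esub>, h) (ract V (g, \<one>\<^bsub>H\<^esub>) (F (x \<otimes>\<^bsub>K\<^esub> y)))"
      using g h Fxy by (simp add: mult)
    then show "(if j h \<otimes>\<^bsub>K\<^esub> x \<in> carrier K then ract V (g, \<one>\<^bsub>H\<^esub>) (F (j h \<otimes>\<^bsub>K\<^esub> x \<otimes>\<^bsub>K\<^esub> y)) else 0)
        = ract V (\<one>\<^bsub>A\<^esub>, h) (if x \<in> carrier K then ract V (g, \<one>\<^bsub>H\<^esub>) (F (x \<otimes>\<^bsub>K\<^esub> y)) else 0)"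
      using x jK[OF h] by simp
  qed (use F g y lin(1)[OF _ _ _ sub0] in \<open>auto simp: mem\<close>)
  show ?thesis
    unfolding fd_rep_def
  proof (intro conjI ballI)
    show "\<exists>C. finite C \<and> rspace ?I = Q.span C" by (rule fd)
    fix p assume p: "p \<in> carrier (A \<times>\<times> K)"
    obtain g y where gy: "p = (g, y)" "g \<in> carrier A" "y \<in> carrier K" using p by (cases p) auto
    show "linear_on (rspace ?I) (rspace ?I) (ract ?I p)"
      unfolding linear_on_def gy(1)
    proof (intro conjI ballI allI)
      show "ract ?I (g, y) \<in> rspace ?I \<rightarrow> rspace ?I" using closed gy by auto
      fix F assume F: "F \<in> rspace ?I"
      show "ract ?I (g, y) (c *Q F) = c *Q ract ?I (g, y) F" for c
      proof
        fix x show "ract ?I (g, y) (c *Q F) x = (c *Q ract ?I (g, y) F) x"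
          using F gy lin(3)[OF _ _ _ sub0] unfolding mem by (simp add: act)
      qed
      fix F' assume F': "F' \<in> rspace ?I"
      show "ract ?I (g, y) (F + F') = ract ?I (g, y) F + ract ?I (g, y) F'"
      proof
        fix x show "ract ?I (g, y) (F + F') x = (ract ?I (g, y) F + ract ?I (g, y) F') x"
          using F F' gy lin(2) unfolding mem by (simp add: act)
      qed
    qed
    fix q F assume q: "q \<in> carrier (A \<times>\<times> K)" and F: "F \<in> rspace ?I"
    obtain g' y' where gy': "q = (g', y')" "g' \<in> carrier A" "y' \<in> carrier K" using q by (cases q) auto
    show "ract ?I (p \<otimes>\<^bsub>A \<times>\<times> K\<^esub> q) F = ract ?I p (ract ?I q F)"
    proof
      fix x show "ract ?I (p \<otimes>\<^bsub>A \<times>\<times> K\<^esub> q) F x = ract ?I p (ract ?I q F) x"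
        using F gy gy' unfolding mem by (simp add: act mult K.m_assoc)
    qed
  next
    fix F assume F: "F \<in> rspace ?I"
    show "ract ?I \<one>\<^bsub>A \<times>\<times> K\<^esub> F = F"
    proof
      fix x show "ract ?I \<one>\<^bsub>A \<times>\<times> K\<^esub> F x = F x"
        using F unfolding mem by (simp add: act one)
    qed
  qed
qed

lemma fd_rep_induced_surj:
  assumes "t \<le> b" shows "fd_rep (sym_bigroup a b) (induced_surj_rep a b t)"
  unfolding induced_surj_rep_def
proof (rule fd_rep_induced)
  have *: "block_sum (b - t) (\<tau>, \<rho>) permutes {1..b}"
    if "\<tau> permutes {1..b - t}" "\<rho> permutes {1..t}" for \<tau> \<rho>
    using block_sum_permutes[OF that] assms by simp
  show "block_sum (b - t) \<in> carrier (op_group (sym_group (b - t)) \<times>\<times> op_group (sym_group t))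
      \<rightarrow> carrier (op_group (sym_group b))"
    using * by (auto simp: sym_group_def op_group_def simp del: One_nat_def)
  show "finite (carrier (op_group (sym_group b)))"
    by (simp add: op_group_def sym_group_def finite_permutations)
qed (intro DirProd_group group_op_group sym_group_is_group fd_rep_surj_sgn)+

lemma fd_rep_model:
  assumes V: "fd_rep G V"
  shows "\<exists>W :: ('g, nat \<Rightarrow> rat) rep. W \<in> fd_reps G \<and> rep_iso G V W"
proof -
  let ?V = "rspace V"
  obtain B0 where B0: "finite B0" "?V = Q.span B0" using V unfolding fd_rep_def by blast
  obtain B where B: "B \<subseteq> ?V" "Q.independent B" "?V \<subseteq> Q.span B"
    using Q.basis_exists by metis
  have fB: "finite B" using Q.independent_span_bound[of B0 B] B B0 by blast
  have VB: "?V = Q.span B" using B B0(2) by (simp add: Q.span_minimal Q.subspace_span subset_antisym)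
  obtain h :: "_ \<Rightarrow> nat" where h: "inj_on h B" using finite_imp_inj_to_nat_seg[OF fB] by blast
  let ?e = "\<lambda>x i. if i = h x then 1 else 0 :: rat"
  obtain \<phi> where \<phi>: "Vector_Spaces.linear scaleQ scaleQ \<phi>" "\<forall>x\<in>B. \<phi> x = ?e x"
    using QQ.linear_independent_extend[OF B(2), of ?e] by blast
  have lin: "linear_on UNIV UNIV \<phi>" using \<phi>(1) by (rule linear_imp_linear_on)
  have injB: "inj_on \<phi> B"
  proof (rule inj_onI)
    fix x y assume "x \<in> B" "y \<in> B" "\<phi> x = \<phi> y"
    then have "?e x (h x) = ?e y (h x)" using \<phi>(2) by metis
    then show "x = y" using h \<open>x \<in> B\<close> \<open>y \<in> B\<close> by (auto simp: inj_on_eq_iff split: if_splits)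
  qed
  have ind: "Q.independent (\<phi> ` B)"
    unfolding Q.independent_explicit_module
  proof (intro allI impI)
    fix R u w assume R: "finite R" "R \<subseteq> \<phi> ` B" "(\<Sum>v\<in>R. u v *Q v) = 0" and w: "w \<in> R"
    obtain x where x: "x \<in> B" "w = \<phi> x" using R(2) w by auto
    have vw: "v (h x) = (if v = w then 1 else 0)" if "v \<in> R" for v
    proof -
      obtain y where y: "y \<in> B" "v = \<phi> y" using R(2) \<open>v \<in> R\<close> by blast
      have "v (h x) = ?e y (h x)" using y \<phi>(2) by simp
      moreover have "v = w \<longleftrightarrow> y = x" using x y injB by (simp add: inj_on_eq_iff)
      moreover have "h x = h y \<longleftrightarrow> y = x" using x y h by (auto simp: inj_on_eq_iff)
      ultimately show ?thesis by simp
    qed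
    have "(\<Sum>v\<in>R. u v * v (h x)) = (\<Sum>v\<in>R. if v = w then u v else 0)"
      by (intro sum.cong refl) (simp add: vw)
    also have "\<dots> = u w" using R(1) w by simp
    also have "(\<Sum>v\<in>R. u v * v (h x)) = (\<Sum>v\<in>R. u v *Q v) (h x)"
      using R(1) by (induction rule: finite_induct) auto
    finally show "u w = 0" using R(3) by simp
  qed
  have inj: "inj_on \<phi> ?V"
    unfolding VB using QQ.linear_inj_on_span_independent_image[OF \<phi>(1) ind injB] .
  let ?i = "the_inv_into ?V \<phi>"
  have i: "?i (\<phi> v) = v" if "v \<in> ?V" for v using the_inv_into_f_f[OF inj that] .
  define W where "W = \<lparr>rspace = \<phi> ` ?V, ract = \<lambda>g w. \<phi> (ract V g (?i w))\<rparr>"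
  have sub: "Q.subspace ?V" unfolding VB by (rule Q.subspace_span)
  have act: "ract V g v \<in> ?V" "ract V g (v + w) = ract V g v + ract V g w"
    "ract V g (c *Q v) = c *Q ract V g v"
    if "g \<in> carrier G" "v \<in> ?V" "w \<in> ?V" for g v w c
    using V that unfolding fd_rep_def linear_on_def by blast+
  have \<phi>add: "\<phi> v + \<phi> w = \<phi> (v + w)" and \<phi>sc: "c *Q \<phi> v = \<phi> (c *Q v)" for v w c
    using lin unfolding linear_on_def by auto
  have Wact: "ract W g (\<phi> v) = \<phi> (ract V g v)" if "v \<in> ?V" for g v
    using i[OF that] by (simp add: W_def)
  have "fd_rep G W"
    unfolding fd_rep_def
  proof (intro conjI ballI)
    have "\<phi> ` ?V = Q.span (\<phi> ` B)" unfolding VB using QQ.linear_span_image[OF \<phi>(1), of B] by simp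
    then show "\<exists>C. finite C \<and> rspace W = Q.span C"
      using fB by (intro exI[of _ "\<phi> ` B"]) (simp add: W_def)
    fix g assume g: "g \<in> carrier G"
    show "linear_on (rspace W) (rspace W) (ract W g)"
      unfolding linear_on_def
    proof (intro conjI ballI allI)
      show "ract W g \<in> rspace W \<rightarrow> rspace W"
        using g act(1) Wact by (auto simp: W_def i)
      fix x assume "x \<in> rspace W"
      then obtain v where v: "x = \<phi> v" "v \<in> ?V" by (auto simp: W_def)
      show "ract W g (c *Q x) = c *Q ract W g x" for c
        using v g act(3)[OF g v(2) v(2)] Q.subspace_scale[OF sub v(2)] by (simp add: \<phi>sc Wact)
      fix y assume "y \<in> rspace W"
      then obtain w where w: "y = \<phi> w" "w \<in> ?V" by (auto simp: W_def)
      show "ract W g (x + y) = ract W g x + ract W g y"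
        using v w g act(2)[OF g v(2) w(2)] Q.subspace_add[OF sub v(2) w(2)] by (simp add: \<phi>add Wact)
    qed
    fix g' x assume g': "g' \<in> carrier G" and "x \<in> rspace W"
    then obtain v where v: "x = \<phi> v" "v \<in> ?V" by (auto simp: W_def)
    have "ract V (g \<otimes>\<^bsub>G\<^esub> g') v = ract V g (ract V g' v)"
      using V g g' v unfolding fd_rep_def by blast
    then show "ract W (g \<otimes>\<^bsub>G\<^esub> g') x = ract W g (ract W g' x)"
      using v act(1)[OF g' v(2) v(2)] by (simp add: Wact)
  next
    fix x assume "x \<in> rspace W"
    then obtain v where v: "x = \<phi> v" "v \<in> ?V" by (auto simp: W_def)
    then show "ract W \<one>\<^bsub>G\<^esub> x = x" using V unfolding fd_rep_def by (simp add: Wact)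
  qed
  moreover have "\<phi> \<in> rep_hom G V W"
    using lin Wact unfolding rep_hom_def linear_on_def by (auto simp: W_def)
  moreover have "bij_betw \<phi> ?V (rspace W)"
    using inj by (simp add: bij_betw_def W_def)
  ultimately show ?thesis unfolding rep_iso_def fd_reps_def by blast
qed

lemma subgroup_exact_relations: "subgroup (exact_relations G) (free_Abelian_group (fd_reps G))"
  unfolding exact_relations_def
proof (rule group.generate_is_subgroup[OF group_free_Abelian_group])
  show "{frag_of V - frag_of U - frag_of W | U V W.
      U \<in> fd_reps G \<and> V \<in> fd_reps G \<and> W \<in> fd_reps G \<and> short_exact G U V W}
    \<subseteq> carrier (free_Abelian_group (fd_reps G))"
  proof safe
    fix U V W assume *: "U \<in> fd_reps G" "V \<in> fd_reps G" "W \<in> fd_reps G"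
    have "Poly_Mapping.keys (frag_of V - frag_of U - frag_of W) \<subseteq> {U, V, W}"
      using keys_diff[of "frag_of V - frag_of U" "frag_of W"] keys_diff[of "frag_of V" "frag_of U"]
      by (auto simp: keys_frag_of)
    then show "frag_of V - frag_of U - frag_of W \<in> carrier (free_Abelian_group (fd_reps G))"
      using * by auto
  qed
qed

lemma comm_group_grothendieck: "comm_group (grothendieck_group G)"
  unfolding grothendieck_group_def
  by (rule comm_group.abelian_FactGroup[OF abelian_free_Abelian_group subgroup_exact_relations])

lemma rep_class_closed:
  fixes V :: "('g, 'v::rat_vector) rep"
  assumes "fd_rep G V" shows "rep_class G V \<in> carrier (grothendieck_group G)"
proof -
  have "(SOME W. W \<in> fd_reps G \<and> rep_iso G V W) \<in> fd_reps G"
    using someI_ex[OF fd_rep_model[OF assms]] by blast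
  then show ?thesis
    unfolding rep_class_def grothendieck_group_def FactGroup_def RCOSETS_def by auto
qed

end

theory Submission
  imports Defs
begin

text \<open>
  Write \<open>P\<close> for the functor \<open>X \<mapsto> k[X]\<close> and \<open>R\<close> for its reduced part. Tensoring the augmentation
  \<open>P \<rightarrow> k\<close> with itself gives an exact sequence that starts with the \<open>b\<close>-th tensor power of \<open>R\<close> and
  continues with the sums of the tensor powers of \<open>P\<close> over the sets obtained from \<open>{1..b}\<close> by deleting
  \<open>t\<close> elements, for \<open>t = 0, 1, \<dots>\<close>, with signs from orienting the deleted elements. Natural transformations
  from the \<open>a\<close>-th tensor power of \<open>R\<close> to the \<open>n\<close>-th tensor power of \<open>P\<close> have the surjections from
  \<open>{1..n}\<close> to \<open>{1..a}\<close> as a basis. So \<open>Hom\<close> should be the degree zero cohomology of a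
  complex whose term in degree \<open>t\<close> has as basis the surjections onto \<open>{1..a}\<close> that are defined on
  \<open>{1..b}\<close> without \<open>t\<close> elements. This term is the induced representation for \<open>t\<close>
  (\<open>cell_rep_iso_induced\<close>), and it is zero for \<open>t > b - a\<close>. The theorem is the Euler characteristic of this
  complex (\<open>rep_class_long_exact\<close>), once two things are known.

  The first is that the cohomology in positive degree is one copy of \<open>sgn \<otimes> sgn\<close>, in degree \<open>b - a\<close>
  (\<open>exact_positive_degree\<close>, \<open>top_sign_coboundary\<close>, \<open>top_sign_surj\<close>). If one value need not be attained, the complex
  of partially defined maps is acyclic in positive degrees, since assigning this value to an undefined
  position is a contraction (\<open>acyclic_covering\<close>). The kernel of the projection from that complex onto the
  one for \<open>a\<close> is the complex for \<open>a - 1\<close>. So passing from \<open>a\<close> to \<open>a - 1\<close> raises the degree of the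
  cohomology by one, and for \<open>a = 0\<close> only the empty map remains, in degree \<open>b\<close>.

  The second is that natural transformations are the cocycles of degree zero (\<open>coefficients_bij\<close>); this is
  proved directly. The \<open>a\<close>-th tensor power of \<open>R\<close> is generated by the tensor product of the elements
  \<open>[i] - [0]\<close> over the set \<open>{0..a}\<close>, so a natural transformation is determined by its value on this
  generator, a function on maps from \<open>{1..b}\<close> to \<open>{0..a}\<close>. As the base point \<open>0\<close> can be
  moved, this function vanishes at maps that attain all of \<open>{0..a}\<close> (\<open>generator_image_vanishes\<close>), and
  as collapsing any \<open>i\<close> to \<open>0\<close> kills the generator, it is determined by its values at
  surjections onto \<open>{1..a}\<close>. That the value lies in the tensor power of \<open>R\<close> says that these values form a
  cocycle, and conversely a cocycle defines a natural transformation by copying coordinates along surjections.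
\<close>

section \<open>Signs of injections and orientations of subsets\<close>

text \<open>The sign is computed from inversions, and on an arbitrary set of positions: for a permutation \<open>y\<close>
  it compares the orientation of \<open>T\<close> given by its increasing enumeration with that of \<open>y ` T\<close>. Ties
  do not count, so that the same formula serves for maps that take one value repeatedly.\<close>

definition ord_pairs :: "nat set \<Rightarrow> (nat \<times> nat) set" where
  "ord_pairs T = {(i, j). i \<in> T \<and> j \<in> T \<and> i < j}"

definition ord_sign :: "nat set \<Rightarrow> (nat \<Rightarrow> nat) \<Rightarrow> rat" where
  "ord_sign T p = (\<Prod>(i, j)\<in>ord_pairs T. if p j < p i then -1 else 1)"

text \<open>The sign of moving \<open>i\<close> in front of all other elements of \<open>T\<close>, listed in increasing order.\<close>

definition insertion_sign :: "nat \<Rightarrow> nat set \<Rightarrow> rat" where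
  "insertion_sign i T = (\<Prod>j\<in>T. if j < i then -1 else 1)"

lemma prod_ord_pairs_image:
  fixes F :: "nat \<Rightarrow> nat \<Rightarrow> rat"
  assumes y: "inj_on y T" and F: "\<And>i j. F i j = F j i"
  shows "(\<Prod>(i, j)\<in>ord_pairs (y ` T). F i j) = (\<Prod>(i, j)\<in>ord_pairs T. F (y i) (y j))"
proof -
  let ?m = "\<lambda>(i, j). if y i < y j then (y i, y j) else (y j, y i)"
  have bij: "bij_betw ?m (ord_pairs T) (ord_pairs (y ` T))"
    unfolding bij_betw_def
  proof
    show "inj_on ?m (ord_pairs T)"
    proof (rule inj_onI, clarify)
      fix i j k l
      assume "(i, j) \<in> ord_pairs T" "(k, l) \<in> ord_pairs T"
        and eq: "(if y i < y j then (y i, y j) else (y j, y i)) = (if y k < y l then (y k, y l) else (y l, y k))"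
      then have *: "i \<in> T" "j \<in> T" "i < j" "k \<in> T" "l \<in> T" "k < l" by (auto simp: ord_pairs_def)
      have "{y i, y j} = {y k, y l}" using eq by (auto split: if_splits)
      then have "y ` {i, j} = y ` {k, l}" by simp
      then have "{i, j} = {k, l}" using inj_on_image_eq_iff[OF y, of "{i, j}" "{k, l}"] * by auto
      then show "i = k \<and> j = l" using * by (auto simp: doubleton_eq_iff)
    qed
    have surj: "(k, l) \<in> ?m ` ord_pairs T" if kl: "k \<in> y ` T" "l \<in> y ` T" "k < l" for k l
    proof -
      obtain i j where ij: "i \<in> T" "j \<in> T" "k = y i" "l = y j" using kl by auto
      then have "i \<noteq> j" using kl by auto
      then show ?thesis
      proof (cases "i < j")
        case True
        then have "(i, j) \<in> ord_pairs T" "(k, l) = ?m (i, j)" using ij kl(3) by (auto simp: ord_pairs_def)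
        then show ?thesis by (intro image_eqI)
      next
        case False
        then have "(j, i) \<in> ord_pairs T" "(k, l) = ?m (j, i)"
          using ij kl(3) \<open>i \<noteq> j\<close> by (auto simp: ord_pairs_def)
        then show ?thesis by (intro image_eqI)
      qed
    qed
    have sub: "?m ` ord_pairs T \<subseteq> ord_pairs (y ` T)"
    proof (rule image_subsetI)
      fix e assume "e \<in> ord_pairs T"
      then obtain i j where ij: "e = (i, j)" "i \<in> T" "j \<in> T" "i < j" by (auto simp: ord_pairs_def)
      then have "y i \<noteq> y j" using y by (auto simp: inj_on_def)
      then show "?m e \<in> ord_pairs (y ` T)"
        using ij by (auto simp: ord_pairs_def)
    qed
    have sup: "ord_pairs (y ` T) \<subseteq> ?m ` ord_pairs T"
    proof (rule subrelI)
      fix k l assume "(k, l) \<in> ord_pairs (y ` T)"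
      then have "k \<in> y ` T" "l \<in> y ` T" "k < l" by (simp_all add: ord_pairs_def)
      then show "(k, l) \<in> ?m ` ord_pairs T" by (rule surj)
    qed
    from sub sup show "?m ` ord_pairs T = ord_pairs (y ` T)" by (rule equalityI)
  qed
  have "(\<Prod>(i, j)\<in>ord_pairs (y ` T). F i j) = (\<Prod>e\<in>ord_pairs T. case ?m e of (i, j) \<Rightarrow> F i j)"
    by (rule prod.reindex_bij_betw[OF bij, symmetric])
  also have "\<dots> = (\<Prod>(i, j)\<in>ord_pairs T. F (y i) (y j))"
    using F by (intro prod.cong) auto
  finally show ?thesis .
qed

text \<open>Passing from \<open>q\<close> to \<open>q \<circ> y\<close> reverses exactly the inversions of \<open>y\<close> that \<open>q\<close> does not collapse.\<close>

lemma ord_sign_comp_gen: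
  assumes y: "inj_on y T"
  shows "ord_sign T (q \<circ> y) = ord_sign (y ` T) q *
    (\<Prod>(i, j)\<in>ord_pairs T. if y j < y i \<and> q (y i) \<noteq> q (y j) then -1 else 1)"
proof -
  let ?F = "\<lambda>i j. if i < j \<and> q j < q i \<or> j < i \<and> q i < q j then -1 else 1 :: rat"
  have "ord_sign (y ` T) q = (\<Prod>(i, j)\<in>ord_pairs (y ` T). ?F i j)"
    unfolding ord_sign_def by (intro prod.cong) (auto simp: ord_pairs_def)
  also have "\<dots> = (\<Prod>(i, j)\<in>ord_pairs T. ?F (y i) (y j))"
    by (rule prod_ord_pairs_image[OF y]) auto
  finally have "ord_sign (y ` T) q * (\<Prod>(i, j)\<in>ord_pairs T. if y j < y i \<and> q (y i) \<noteq> q (y j) then -1 else 1)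
     = (\<Prod>(i, j)\<in>ord_pairs T. ?F (y i) (y j) * (if y j < y i \<and> q (y i) \<noteq> q (y j) then -1 else 1))"
    by (simp only: prod.distrib[symmetric] case_prod_unfold)
  also have "\<dots> = ord_sign T (q \<circ> y)"
    unfolding ord_sign_def
  proof (intro prod.cong refl, clarify)
    fix i j assume "(i, j) \<in> ord_pairs T"
    then have "y i \<noteq> y j" using y by (auto simp: ord_pairs_def inj_on_def)
    then show "?F (y i) (y j) * (if y j < y i \<and> q (y i) \<noteq> q (y j) then -1 else 1)
        = (if (q \<circ> y) j < (q \<circ> y) i then -1 else 1)" by auto
  qed
  finally show ?thesis by simp
qed

lemma ord_sign_comp:
  assumes "inj_on y T" "inj_on q (y ` T)"
  shows "ord_sign T (q \<circ> y) = ord_sign T y * ord_sign (y ` T) q"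
proof -
  have "q (y i) \<noteq> q (y j)" if "(i, j) \<in> ord_pairs T" for i j
  proof
    have ij: "i \<in> T" "j \<in> T" "i \<noteq> j" using that by (auto simp: ord_pairs_def)
    assume "q (y i) = q (y j)"
    then have "y i = y j" using inj_onD[OF assms(2), of "y i" "y j"] ij by blast
    then show False using inj_onD[OF assms(1), of i j] ij by blast
  qed
  then have "(\<Prod>(i, j)\<in>ord_pairs T. if y j < y i \<and> q (y i) \<noteq> q (y j) then -1 else 1) = ord_sign T y"
    unfolding ord_sign_def by (intro prod.cong) auto
  then show ?thesis using ord_sign_comp_gen[OF assms(1), of q] by simp
qed

lemma ord_sign_cong: "(\<And>i. i \<in> T \<Longrightarrow> p i = q i) \<Longrightarrow> ord_sign T p = ord_sign T q"
  unfolding ord_sign_def by (intro prod.cong) (auto simp: ord_pairs_def)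

lemma ord_sign_mono: "(\<And>i j. i \<in> T \<Longrightarrow> j \<in> T \<Longrightarrow> i < j \<Longrightarrow> p i \<le> p j) \<Longrightarrow> ord_sign T p = 1"
  unfolding ord_sign_def by (intro prod.neutral) (fastforce simp: ord_pairs_def)

lemma ord_sign_square: "ord_sign T p * ord_sign T p = 1"
  unfolding ord_sign_def prod.distrib[symmetric] by (intro prod.neutral) auto

lemma insertion_sign_square: "insertion_sign i T * insertion_sign i T = 1"
  unfolding insertion_sign_def prod.distrib[symmetric] by (intro prod.neutral) auto

lemma finite_ord_pairs: "finite T \<Longrightarrow> finite (ord_pairs T)"
  by (rule finite_subset[of _ "T \<times> T"]) (auto simp: ord_pairs_def)

lemma ord_sign_insert:
  assumes "finite T" "i \<notin> T"
  shows "ord_sign (insert i T) p = ord_sign T p *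
    (\<Prod>j\<in>T. if j < i \<and> p i < p j \<or> i < j \<and> p j < p i then -1 else 1)"
proof -
  let ?m = "\<lambda>j. if j < i then (j, i) else (i, j)"
  have un: "ord_pairs (insert i T) = ord_pairs T \<union> ?m ` T"
  proof (intro equalityI subsetI)
    fix e assume "e \<in> ord_pairs (insert i T)"
    then obtain k l where e: "e = (k, l)" "k \<in> insert i T" "l \<in> insert i T" "k < l"
      by (auto simp: ord_pairs_def)
    consider "k = i" "l \<in> T" | "l = i" "k \<in> T" | "k \<in> T" "l \<in> T" using e by auto
    then show "e \<in> ord_pairs T \<union> ?m ` T"
    proof cases
      case 1 then have "e = ?m l" using e by simp
      then have "e \<in> ?m ` T" using 1(2) by (rule image_eqI)
      then show ?thesis by (rule UnI2)
    next
      case 2 then have "e = ?m k" using e by simp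
      then have "e \<in> ?m ` T" using 2(2) by (rule image_eqI)
      then show ?thesis by (rule UnI2)
    next
      case 3 then show ?thesis using e by (simp add: ord_pairs_def)
    qed
  next
    fix e assume e: "e \<in> ord_pairs T \<union> ?m ` T"
    have "?m j \<in> ord_pairs (insert i T)" if "j \<in> T" for j
    proof -
      have "j \<noteq> i" using that assms(2) by auto
      then show ?thesis using that by (simp add: ord_pairs_def)
    qed
    moreover have "ord_pairs T \<subseteq> ord_pairs (insert i T)" by (auto simp: ord_pairs_def)
    ultimately have "ord_pairs T \<union> ?m ` T \<subseteq> ord_pairs (insert i T)"
      by (intro Un_least image_subsetI)
    then show "e \<in> ord_pairs (insert i T)" using e by (rule subsetD)
  qed
  have dis: "ord_pairs T \<inter> ?m ` T = {}" using assms(2) by (auto simp: ord_pairs_def)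
  have inj: "inj_on ?m T" using assms(2) by (auto simp: inj_on_def)
  have "ord_sign (insert i T) p = ord_sign T p * (\<Prod>(k, l)\<in>?m ` T. if p l < p k then -1 else 1)"
    unfolding ord_sign_def un by (rule prod.union_disjoint) (use assms dis finite_ord_pairs in auto)
  also have "(\<Prod>(k, l)\<in>?m ` T. if p l < p k then -1 else 1 :: rat)
      = (\<Prod>j\<in>T. if j < i \<and> p i < p j \<or> i < j \<and> p j < p i then -1 else 1)"
    using assms(2) by (subst prod.reindex[OF inj]) (auto intro!: prod.cong split: if_splits)
  finally show ?thesis .
qed

lemma insertion_sign_insert:
  "finite T \<Longrightarrow> i \<notin> T \<Longrightarrow> insertion_sign k (insert i T) = (if i < k then -1 else 1) * insertion_sign k T"
  by (simp add: insertion_sign_def)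

lemma insertion_sign_remove: "insertion_sign i (T - {i}) = insertion_sign i T"
  by (cases "finite T") (auto simp: insertion_sign_def prod.remove[of T i] intro: prod.mono_neutral_left)

text \<open>Inserting one position after the other in either order: the orientations differ by a sign.\<close>

lemma insertion_sign_swap:
  assumes "finite T" "i \<in> T" "k \<in> T" "i \<noteq> k"
  shows "insertion_sign i T * insertion_sign k (T - {i}) = - (insertion_sign k T * insertion_sign i (T - {k}))"
proof -
  define R where "R = T - {i, k}"
  have T: "T - {i} = insert k R" "T - {k} = insert i R" "T = insert i (insert k R)"
    "finite R" "i \<notin> R" "k \<notin> R"
    using assms by (auto simp: R_def)
  show ?thesis
    unfolding T(1,2) unfolding T(3) using T(4-6) assms(4)
    by (auto simp: insertion_sign_insert)
qed

text \<open>How the orientation sign of \<open>y\<close> changes when one more position is inserted. This is what makes the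
  coboundary below commute with permutations of the positions.\<close>

lemma ord_sign_insert_perm:
  assumes "finite T" "i \<notin> T" "inj_on y (insert i T)"
  shows "ord_sign (insert i T) y = ord_sign T y * (insertion_sign i T * insertion_sign (y i) (y ` T))"
proof -
  have "insertion_sign (y i) (y ` T) = (\<Prod>j\<in>T. if y j < y i then -1 else 1)"
    unfolding insertion_sign_def using assms(3) by (subst prod.reindex) (auto simp: inj_on_insert)
  then have "insertion_sign i T * insertion_sign (y i) (y ` T)
      = (\<Prod>j\<in>T. (if j < i then -1 else 1) * (if y j < y i then -1 else 1))"
    by (simp add: insertion_sign_def prod.distrib)
  also have "\<dots> = (\<Prod>j\<in>T. if j < i \<and> y i < y j \<or> i < j \<and> y j < y i then -1 else 1)"
  proof (intro prod.cong refl)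
    fix j assume j: "j \<in> T"
    then have "j \<noteq> i" "y j \<noteq> y i" using assms(2,3) by (auto simp: inj_on_def)
    then show "(if j < i then -1 else 1) * (if y j < y i then -1 else 1)
      = (if j < i \<and> y i < y j \<or> i < j \<and> y j < y i then -1 else (1::rat))" by auto
  qed
  finally show ?thesis using ord_sign_insert[OF assms(1,2), of y] by simp
qed

lemma ord_sign_transpose:
  assumes "finite S" "i \<in> S" "j \<in> S" "i \<noteq> j"
  shows "ord_sign S (transpose i j) = -1"
proof -
  have *: "ord_sign S (transpose i j) = -1" if "i \<in> S" "j \<in> S" "i < j" for i j
  proof -
    let ?y = "transpose i j"
    define R where "R = S - {i, j}"
    have R: "S = insert i (insert j R)" "finite R" "i \<notin> insert j R" "j \<notin> R" "finite (insert j R)"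
      using that assms(1) by (auto simp: R_def)
    have tr: "?y k = k" if "k \<in> R" for k using that R by (auto simp: transpose_def)
    have "ord_sign R ?y = 1" by (rule ord_sign_mono) (simp add: tr)
    moreover have "(\<Prod>k\<in>R. if k < j \<and> ?y j < ?y k \<or> j < k \<and> ?y k < ?y j then -1 else 1 :: rat)
        = (\<Prod>k\<in>R. if i < k \<and> k < j then -1 else 1)" (is "?l = ?r")
      using that by (intro prod.cong) (auto simp: tr)
    moreover have "(\<Prod>k\<in>insert j R. if k < i \<and> ?y i < ?y k \<or> i < k \<and> ?y k < ?y i then -1 else 1 :: rat)
        = - ?r"
    proof -
      have "(\<Prod>k\<in>R. if k < i \<and> ?y i < ?y k \<or> i < k \<and> ?y k < ?y i then -1 else 1 :: rat) = ?r"
        using that by (intro prod.cong) (auto simp: tr)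
      then show ?thesis using R that by simp
    qed
    moreover have "?r * ?r = 1" unfolding prod.distrib[symmetric] by (intro prod.neutral) auto
    ultimately show ?thesis
      unfolding R(1) ord_sign_insert[OF R(5,3)] ord_sign_insert[OF R(2,4)] by simp
  qed
  show ?thesis
    using *[of i j] *[of j i] assms by (cases "i < j") (auto simp: transpose_commute)
qed

text \<open>Both sides are multiplicative and agree on transpositions.\<close>

lemma sign_eq_ord_sign:
  assumes "y permutes S" "finite S"
  shows "of_int (sign y) = ord_sign S y"
  using assms
proof (induction rule: permutes_induct)
  case id
  show ?case using ord_sign_mono[of S id] by (simp add: id_def)
next
  case (swap i j p)
  have "permutation p" using swap assms(2) permutation_permutes by blast
  then have A: "sign (transpose i j \<circ> p) = - sign p"
    using swap by (simp add: sign_compose sign_swap_id permutation_swap_id)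
  have B: "ord_sign S (transpose i j \<circ> p) = ord_sign S p * ord_sign (p ` S) (transpose i j)"
  proof (rule ord_sign_comp)
    show "inj_on p S" using \<open>p permutes S\<close> by (rule permutes_inj_on)
    show "inj_on (transpose i j) (p ` S)" by (rule inj_onI) (metis transpose_involutory)
  qed
  have C: "ord_sign (p ` S) (transpose i j) = -1"
    using ord_sign_transpose[OF assms(2)] swap by (simp add: permutes_image)
  have D: "of_int (sign p) = ord_sign S p" by fact
  show ?case unfolding A B C by (simp add: D)
qed

section \<open>The complex of partially defined surjections\<close>

text \<open>A partially defined map from \<open>{1..b}\<close> to \<open>{1..a}\<close> is encoded as a total one that takes the value \<open>0\<close>
  where it is not defined, and also outside of \<open>{1..b}\<close>.\<close>

definition pmaps :: "nat \<Rightarrow> nat \<Rightarrow> (nat \<Rightarrow> nat) set" where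
  "pmaps b a = {p. (\<forall>i. i \<notin> {1..b} \<longrightarrow> p i = 0) \<and> (\<forall>i. p i \<le> a)}"

definition holes :: "nat \<Rightarrow> (nat \<Rightarrow> nat) \<Rightarrow> nat set" where
  "holes b p = {i \<in> {1..b}. p i = 0}"

text \<open>Only the values up to \<open>c\<close> are required to be attained. The case \<open>c = a\<close> is the one of interest; the case
  \<open>c < a\<close> gives the acyclic complexes with which it is compared.\<close>

definition covering :: "nat \<Rightarrow> nat \<Rightarrow> nat \<Rightarrow> (nat \<Rightarrow> nat) set" where
  "covering b a c = {p \<in> pmaps b a. {1..c} \<subseteq> range p}"

definition cells :: "nat \<Rightarrow> nat \<Rightarrow> nat \<Rightarrow> nat \<Rightarrow> (nat \<Rightarrow> nat) set" where
  "cells b a c t = {p \<in> covering b a c. card (holes b p) = t}"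

text \<open>In terms of the basis given by partially defined maps, the coboundary sends a map to the signed sum
  of its restrictions with one position less in the domain, a restriction being replaced by zero when it no
  longer attains the required values. The formula gives the coefficient at \<open>p\<close>, so it runs over the
  extensions of \<open>p\<close> by one position.\<close>

definition coboundary :: "nat \<Rightarrow> nat \<Rightarrow> nat \<Rightarrow> ((nat \<Rightarrow> nat) \<Rightarrow> rat) \<Rightarrow> (nat \<Rightarrow> nat) \<Rightarrow> rat" where
  "coboundary b a c \<Phi> = (\<lambda>p. if p \<in> covering b a c
     then \<Sum>i\<in>holes b p. insertion_sign i (holes b p) * (\<Sum>v=1..a. \<Phi> (p(i := v))) else 0)"

lemma finite_holes [simp]: "finite (holes b p)"
  by (simp add: holes_def)

lemma finite_pmaps: "finite (pmaps b a)"
  by (rule finite_subset[OF _ finite_set_of_finite_funs[of "{1..b}" "{..a}" 0]]) (auto simp: pmaps_def)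

lemma finite_cells: "finite (cells b a c t)"
  by (rule finite_subset[OF _ finite_pmaps[of b a]]) (auto simp: cells_def covering_def)

lemma holes_upd: "v \<noteq> 0 \<Longrightarrow> holes b (p(i := v)) = holes b p - {i}"
  by (auto simp: holes_def)

lemma covering_assign:
  assumes "p \<in> covering b a c" "i \<in> holes b p" "v \<le> a"
  shows "p(i := v) \<in> covering b a c"
proof -
  have "{1..c} \<subseteq> range (p(i := v))"
  proof
    fix w assume w: "w \<in> {1..c}"
    then obtain j where "w = p j" using assms(1) by (auto simp: covering_def)
    moreover then have "j \<noteq> i" using w assms(2) by (auto simp: holes_def)
    ultimately have "w = (p(i := v)) j" by simp
    then show "w \<in> range (p(i := v))" by blast
  qed
  then show ?thesis using assms by (auto simp: covering_def pmaps_def holes_def)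
qed

lemma cells_assign_iff:
  assumes "p \<in> covering b a c" "i \<in> holes b p" "v \<in> {1..a}"
  shows "p(i := v) \<in> cells b a c t \<longleftrightarrow> p \<in> cells b a c (Suc t)"
proof -
  have "holes b (p(i := v)) = holes b p - {i}" using assms(3) by (intro holes_upd) auto
  then have "Suc (card (holes b (p(i := v)))) = card (holes b p)"
    using assms(2) card_Suc_Diff1[of "holes b p" i] by simp
  moreover have "p(i := v) \<in> covering b a c" using assms by (intro covering_assign) auto
  ultimately show ?thesis using assms(1) by (auto simp: cells_def)
qed

lemma coboundary_closed:
  assumes x: "x \<in> free_module (cells b a c t)"
  shows "coboundary b a c x \<in> free_module (cells b a c (Suc t))"
proof -
  have "coboundary b a c x p = 0" if p: "p \<notin> cells b a c (Suc t)" for p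
  proof (cases "p \<in> covering b a c")
    case True
    have "x (p(i := v)) = 0" if "i \<in> holes b p" "v \<in> {1..a}" for i v
      using cells_assign_iff[OF True that, of t] p x by (auto simp: free_module_def)
    then show ?thesis by (simp add: coboundary_def)
  qed (simp add: coboundary_def)
  then show ?thesis by (simp add: free_module_def)
qed

lemma coboundary_add: "coboundary b a c (x + y) = coboundary b a c x + coboundary b a c y"
  by (auto simp: coboundary_def fun_eq_iff sum.distrib distrib_left)

lemma coboundary_scale: "coboundary b a c (r *Q x) = r *Q coboundary b a c x"
  by (auto simp: coboundary_def fun_eq_iff sum_distrib_left mult_ac)

lemma coboundary_diff: "coboundary b a c (x - y) = coboundary b a c x - coboundary b a c y"
  by (auto simp: coboundary_def fun_eq_iff sum_subtractf right_diff_distrib)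

text \<open>Extending by two positions in either order gives the same maps with opposite signs.\<close>

lemma coboundary_coboundary: "coboundary b a c (coboundary b a c x) = 0"
proof
  fix p
  show "coboundary b a c (coboundary b a c x) p = (0 :: (nat \<Rightarrow> nat) \<Rightarrow> rat) p"
  proof (cases "p \<in> covering b a c")
    case p: True
    let ?U = "holes b p"
    define G where "G = (\<lambda>i k. insertion_sign i ?U * insertion_sign k (?U - {i}) *
      (\<Sum>v=1..a. \<Sum>u=1..a. x (p(i := v, k := u))))"
    have "coboundary b a c (coboundary b a c x) p = (\<Sum>i\<in>?U. insertion_sign i ?U * (\<Sum>v=1..a. coboundary b a c x (p(i := v))))"
      using p by (simp add: coboundary_def)
    also have "\<dots> = (\<Sum>i\<in>?U. \<Sum>k\<in>?U - {i}. G i k)"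
    proof (intro sum.cong refl)
      fix i assume i: "i \<in> ?U"
      have "coboundary b a c x (p(i := v)) = (\<Sum>k\<in>?U - {i}. insertion_sign k (?U - {i}) * (\<Sum>u=1..a. x (p(i := v, k := u))))"
        if "v \<in> {1..a}" for v
      proof -
        have "p(i := v) \<in> covering b a c" using that by (intro covering_assign p i) auto
        moreover have "holes b (p(i := v)) = ?U - {i}" using that by (intro holes_upd) auto
        ultimately show ?thesis by (simp add: coboundary_def)
      qed
      then have "(\<Sum>v=1..a. coboundary b a c x (p(i := v)))
          = (\<Sum>v=1..a. \<Sum>k\<in>?U - {i}. insertion_sign k (?U - {i}) * (\<Sum>u=1..a. x (p(i := v, k := u))))"
        by (intro sum.cong refl) blast
      also have "\<dots> = (\<Sum>k\<in>?U - {i}. insertion_sign k (?U - {i}) * (\<Sum>v=1..a. \<Sum>u=1..a. x (p(i := v, k := u))))"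
        unfolding sum_distrib_left by (rule sum.swap)
      finally show "insertion_sign i ?U * (\<Sum>v=1..a. coboundary b a c x (p(i := v))) = (\<Sum>k\<in>?U - {i}. G i k)"
        by (simp add: G_def sum_distrib_left mult.assoc)
    qed
    also have "\<dots> = (\<Sum>i\<in>?U. \<Sum>k\<in>{k\<in>?U. k \<noteq> i}. G i k)"
      by (intro sum.cong) auto
    finally have eq: "coboundary b a c (coboundary b a c x) p = (\<Sum>i\<in>?U. \<Sum>k\<in>{k\<in>?U. k \<noteq> i}. G i k)" .
    have anti: "G k i = - G i k" if "i \<in> ?U" "k \<in> ?U" "k \<noteq> i" for i k
    proof -
      have "(\<Sum>v=1..a. \<Sum>u=1..a. x (p(k := v, i := u))) = (\<Sum>v=1..a. \<Sum>u=1..a. x (p(i := v, k := u)))"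
        using that by (subst sum.swap) (simp add: fun_upd_twist)
      then show ?thesis using insertion_sign_swap[of ?U k i] that by (simp add: G_def)
    qed
    have "(\<Sum>i\<in>?U. \<Sum>k\<in>{k\<in>?U. k \<noteq> i}. G i k) = (\<Sum>k\<in>?U. \<Sum>i\<in>{i\<in>?U. k \<noteq> i}. G i k)"
      by (rule sum.swap_restrict) simp_all
    also have "\<dots> = (\<Sum>k\<in>?U. \<Sum>i\<in>{i\<in>?U. i \<noteq> k}. - G k i)"
    proof (intro sum.cong refl)
      fix k i assume k: "k \<in> ?U" and i: "i \<in> {i \<in> ?U. i \<noteq> k}"
      show "G i k = - G k i" by (rule anti) (use k i in auto)
    qed auto
    also have "\<dots> = - (\<Sum>k\<in>?U. \<Sum>i\<in>{i\<in>?U. i \<noteq> k}. G k i)"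
      by (simp add: sum_negf)
    finally show ?thesis using eq by simp
  qed (simp add: coboundary_def)
qed

text \<open>If the value \<open>a\<close> need not be attained, assigning it to an undefined position \<open>i\<close> is a contracting
  homotopy up to cochains that vanish when \<open>i\<close> is undefined. Applied to one position after the other,
  it moves a cocycle of positive degree to one that vanishes as soon as any position is undefined.\<close>

lemma acyclic_covering:
  assumes ca: "c < a" and x: "x \<in> free_module (cells b a c (Suc t))" and cyc: "coboundary b a c x = 0"
  shows "\<exists>y\<in>free_module (cells b a c t). coboundary b a c y = x"
proof -
  have "\<exists>y\<in>free_module (cells b a c t). \<forall>p. \<forall>m\<in>{1..k}. p m = 0 \<longrightarrow> (x - coboundary b a c y) p = 0"
    if "k \<le> b" for k
    using that
  proof (induction k)
    case 0
    have "0 \<in> free_module (cells b a c t)" by (simp add: free_module_def)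
    then show ?case by auto
  next
    case (Suc k)
    have "k \<le> b" using Suc.prems by simp
    from Suc.IH[OF this] obtain y where y: "y \<in> free_module (cells b a c t)"
      and van: "\<forall>p. \<forall>m\<in>{1..k}. p m = 0 \<longrightarrow> (x - coboundary b a c y) p = 0" by (elim bexE)
    define z where "z = x - coboundary b a c y"
    have z: "z \<in> free_module (cells b a c (Suc t))"
      using x coboundary_closed[OF y] Q.subspace_diff[OF subspace_free_module] unfolding z_def by blast
    have bdz: "coboundary b a c z = 0" unfolding z_def coboundary_diff coboundary_coboundary cyc by simp
    define i where "i = Suc k"
    have i: "i \<in> {1..b}" using Suc.prems by (simp add: i_def)
    define h where "h = (\<lambda>p. if p i = a then insertion_sign i (holes b p) * z (p(i := 0)) else 0)"
    have h: "h \<in> free_module (cells b a c t)"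
    proof -
      have "h p = 0" if p: "p \<notin> cells b a c t" for p
      proof (cases "p i = a")
        case True
        let ?q = "p(i := 0)"
        have "?q \<notin> cells b a c (Suc t)"
        proof
          assume q: "?q \<in> cells b a c (Suc t)"
          then have "?q \<in> covering b a c" by (simp add: cells_def)
          moreover have "i \<in> holes b ?q" using i by (simp add: holes_def)
          moreover have "a \<in> {1..a}" using ca by auto
          ultimately have "?q(i := a) \<in> cells b a c t" using q cells_assign_iff by blast
          moreover have "?q(i := a) = p" using True by auto
          ultimately show False using p by simp
        qed
        then show ?thesis using z by (simp add: h_def free_module_def)
      qed (simp add: h_def)
      then show ?thesis by (simp add: free_module_def)
    qed
    have main: "(z - coboundary b a c h) p = 0" if m: "m \<in> {1..Suc k}" and pm: "p m = 0" for p m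
    proof (cases "p \<in> covering b a c")
      case False
      then have "z p = 0" using z by (auto simp: free_module_def cells_def)
      then show ?thesis using False by (simp add: coboundary_def)
    next
      case p: True
      let ?U = "holes b p"
      have bdh: "coboundary b a c h p = (\<Sum>j\<in>?U. insertion_sign j ?U * (\<Sum>v=1..a. h (p(j := v))))"
        using p by (simp add: coboundary_def)
      show ?thesis
      proof (cases "p i = 0")
        case True
        have iU: "i \<in> ?U" using True i by (simp add: holes_def)
        have "h (p(j := v)) = 0" if "j \<noteq> i" for j v using that True ca by (simp add: h_def)
        then have "coboundary b a c h p = insertion_sign i ?U * (\<Sum>v=1..a. h (p(i := v)))"
          unfolding bdh using iU by (subst sum.remove[OF _ iU]) auto
        also have "(\<Sum>v=1..a. h (p(i := v))) = (\<Sum>v=1..a. if v = a then insertion_sign i (?U - {i}) * z p else 0)"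
        proof (intro sum.cong refl)
          fix v assume "v \<in> {1..a}"
          then have "holes b (p(i := v)) = ?U - {i}" by (intro holes_upd) auto
          then show "h (p(i := v)) = (if v = a then insertion_sign i (?U - {i}) * z p else 0)"
            using True by (cases "v = a") (simp_all add: h_def fun_upd_idem)
        qed
        also have "\<dots> = insertion_sign i ?U * z p" using ca by (simp add: insertion_sign_remove)
        finally show ?thesis using insertion_sign_square[of i ?U] by (simp flip: mult.assoc)
      next
        case False
        then have m': "m \<in> {1..k}" "m \<noteq> i" using m pm by (auto simp: i_def le_Suc_eq)
        have mU: "m \<in> ?U" using m' pm Suc.prems by (auto simp: holes_def)
        have zv: "z q = 0" if "q m = 0" for q using van m'(1) that unfolding z_def by blast
        have "coboundary b a c h p = 0"
        proof (cases "p i = a")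
          case False
          have "h (p(j := v)) = 0" if "j \<in> ?U" for j v
          proof -
            have "j \<noteq> i" using that \<open>p i \<noteq> 0\<close> by (auto simp: holes_def)
            then show ?thesis using False by (simp add: h_def)
          qed
          then show ?thesis unfolding bdh by simp
        next
          case True
          let ?q = "p(i := 0)"
          have hval: "h (p(j := v)) = insertion_sign i (?U - {j}) * z (?q(j := v))" if "j \<in> ?U" "v \<in> {1..a}" for j v
          proof -
            have "j \<noteq> i" using that \<open>p i \<noteq> 0\<close> by (auto simp: holes_def)
            moreover have "holes b (p(j := v)) = ?U - {j}" using that by (intro holes_upd) auto
            ultimately show ?thesis using True by (simp add: h_def fun_upd_twist)
          qed
          have iq: "i \<in> holes b ?q" using i by (simp add: holes_def)
          have "(?q)(i := a) = p" using True by auto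
          have qc: "?q \<in> covering b a c"
          proof -
            have "w \<in> range ?q" if "w \<in> {1..c}" for w
            proof -
              obtain j where "p j = w" using p \<open>w \<in> {1..c}\<close> by (auto simp: covering_def)
              then have "?q j = w" using True ca \<open>w \<in> {1..c}\<close> by auto
              then show ?thesis by blast
            qed
            then show ?thesis using p by (auto simp: covering_def pmaps_def)
          qed
          let ?V = "holes b ?q"
          have mV: "m \<in> ?V" using mU m' by (auto simp: holes_def)
          have "0 = coboundary b a c z ?q" using bdz by simp
          also have "\<dots> = (\<Sum>j\<in>?V. insertion_sign j ?V * (\<Sum>v=1..a. z (?q(j := v))))"
            using qc by (simp add: coboundary_def)
          also have "\<dots> = insertion_sign m ?V * (\<Sum>v=1..a. z (?q(m := v)))"
            using pm m'(2) by (subst sum.remove[OF _ mV]) (auto intro!: sum.neutral zv)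
          finally have S: "(\<Sum>v=1..a. z (?q(m := v))) = 0"
            using insertion_sign_square[of m ?V] by auto
          have "coboundary b a c h p = (\<Sum>j\<in>?U. insertion_sign j ?U * (\<Sum>v=1..a. insertion_sign i (?U - {j}) * z (?q(j := v))))"
            unfolding bdh by (intro sum.cong refl arg_cong2[where f = "(*)"]) (auto simp: hval)
          also have "\<dots> = insertion_sign m ?U * (\<Sum>v=1..a. insertion_sign i (?U - {m}) * z (?q(m := v)))"
            using pm m'(2) by (subst sum.remove[OF _ mU]) (auto intro!: sum.neutral zv)
          also have "\<dots> = 0" using S by (simp flip: sum_distrib_left)
          finally show ?thesis .
        qed
        then show ?thesis using zv[of p] pm by simp
      qed
    qed
    have yh: "y + h \<in> free_module (cells b a c t)"
      using y h Q.subspace_add[OF subspace_free_module] by blast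
    have "x - coboundary b a c (y + h) = z - coboundary b a c h" unfolding z_def coboundary_add by simp
    then have "\<forall>p. \<forall>m\<in>{1..Suc k}. p m = 0 \<longrightarrow> (x - coboundary b a c (y + h)) p = 0"
      using main by metis
    then show ?case using yh by (rule bexI[where x = "y + h"])
  qed
  from this[OF order_refl] obtain y where y: "y \<in> free_module (cells b a c t)"
    and van: "\<forall>p. \<forall>m\<in>{1..b}. p m = 0 \<longrightarrow> (x - coboundary b a c y) p = 0" by (elim bexE)
  have "(x - coboundary b a c y) p = 0" for p
  proof (cases "p \<in> cells b a c (Suc t)")
    case True
    then have "holes b p \<noteq> {}" by (auto simp: cells_def)
    then obtain m where "m \<in> {1..b}" "p m = 0" by (auto simp: holes_def)
    then show ?thesis using van by blast
  next
    case False
    then show ?thesis using x coboundary_closed[OF y] by (simp add: free_module_def)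
  qed
  then have "coboundary b a c y = x" by (simp add: fun_eq_iff)
  then show ?thesis using y by blast
qed

section \<open>Cohomology in positive degree\<close>

text \<open>In the highest degree \<open>b - a\<close> a cell is a bijection from a subset of \<open>{1..b}\<close> to \<open>{1..a}\<close>. The following
  functional is the one that detects the only cohomology in positive degree.\<close>

definition top_sign :: "nat \<Rightarrow> nat \<Rightarrow> ((nat \<Rightarrow> nat) \<Rightarrow> rat) \<Rightarrow> rat" where
  "top_sign b a x = (\<Sum>p\<in>cells b a a (b - a). ord_sign {1..b} p * x p)"

lemma cells_image:
  assumes "p \<in> cells b a a t"
  shows "p ` ({1..b} - holes b p) = {1..a}"
proof (intro equalityI subsetI)
  fix v assume v: "v \<in> {1..a}"
  then obtain i where i: "p i = v" using assms by (auto simp: cells_def covering_def)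
  then have "i \<in> {1..b} - holes b p"
    using assms v by (auto simp: cells_def covering_def pmaps_def holes_def)
  then show "v \<in> p ` ({1..b} - holes b p)" using i by blast
qed (use assms in \<open>auto simp: cells_def covering_def pmaps_def holes_def\<close>)

lemma cells_inj:
  assumes "p \<in> cells b a a t" "a + t = b"
  shows "inj_on p ({1..b} - holes b p)"
proof (rule eq_card_imp_inj_on)
  have "card ({1..b} - holes b p) = b - t"
    using assms by (subst card_Diff_subset) (auto simp: cells_def holes_def)
  then show "card (p ` ({1..b} - holes b p)) = card ({1..b} - holes b p)"
    using assms(2) by (simp only: cells_image[OF assms(1)]) simp
qed simp

lemma cells_bij:
  assumes "p \<in> cells b a a t" "a + t = b"
  shows "bij_betw p ({1..b} - holes b p) {1..a}"
  using cells_image[OF assms(1)] cells_inj[OF assms] by (simp add: bij_betw_def)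

text \<open>All positions with value \<open>0\<close> are tied, so their inversions are missing from the sign of \<open>q \<circ> y\<close>.\<close>

lemma ord_sign_comp_partial:
  assumes q: "inj_on q ({1..b} - holes b q)" and y: "y permutes {1..b}"
  shows "ord_sign {1..b} (q \<circ> y) * ord_sign (holes b (q \<circ> y)) y = ord_sign {1..b} q * ord_sign {1..b} y"
proof -
  have ij: "y i = y j \<longleftrightarrow> i = j" for i j using permutes_inj[OF y] by (simp add: inj_eq)
  let ?f = "\<lambda>(i, j). if y j < y i \<and> q (y i) \<noteq> q (y j) then -1 else 1 :: rat"
  have "ord_sign (holes b (q \<circ> y)) y
      = (\<Prod>(i, j)\<in>ord_pairs {1..b}. if y j < y i \<and> q (y i) = q (y j) then -1 else 1)"
    unfolding ord_sign_def
  proof (rule prod.mono_neutral_cong_left)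
    show "\<forall>e\<in>ord_pairs {1..b} - ord_pairs (holes b (q \<circ> y)).
        (case e of (i, j) \<Rightarrow> if y j < y i \<and> q (y i) = q (y j) then -1 else 1) = (1 :: rat)"
    proof clarify
      fix i j assume *: "(i, j) \<in> ord_pairs {1..b}" "(i, j) \<notin> ord_pairs (holes b (q \<circ> y))"
      have yin: "y i \<in> {1..b}" "y j \<in> {1..b}" "i \<noteq> j"
        using * permutes_in_image[OF y] by (auto simp: ord_pairs_def)
      have "q (y i) \<noteq> q (y j)"
      proof
        assume eq: "q (y i) = q (y j)"
        show False
        proof (cases "q (y i) = 0")
          case True
          then show False using * eq by (auto simp: ord_pairs_def holes_def)
        next
          case False
          then show False using inj_onD[OF q eq] eq yin ij by (auto simp: holes_def)
        qed
      qed
      then show "(if y j < y i \<and> q (y i) = q (y j) then -1 else 1) = (1 :: rat)" by simp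
    qed
    show "ord_pairs (holes b (q \<circ> y)) \<subseteq> ord_pairs {1..b}"
      by (auto simp: ord_pairs_def holes_def)
    have "q (y i) = q (y j)" if "(i, j) \<in> ord_pairs (holes b (q \<circ> y))" for i j
      using that by (simp add: ord_pairs_def holes_def)
    then show "(case e of (i, j) \<Rightarrow> if y j < y i then -1 else 1)
        = (case e of (i, j) \<Rightarrow> if y j < y i \<and> q (y i) = q (y j) then -1 else (1 :: rat))"
      if "e \<in> ord_pairs (holes b (q \<circ> y))" for e
      using that by (cases e) auto
  qed (simp add: finite_ord_pairs)
  moreover have "ord_sign {1..b} (q \<circ> y) = ord_sign {1..b} q * prod ?f (ord_pairs {1..b})"
    using ord_sign_comp_gen[of y "{1..b}" q] permutes_inj_on[OF y] permutes_image[OF y] by simp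
  moreover have "prod ?f (ord_pairs {1..b}) *
      (\<Prod>(i, j)\<in>ord_pairs {1..b}. if y j < y i \<and> q (y i) = q (y j) then -1 else 1) = ord_sign {1..b} y"
    unfolding ord_sign_def prod.distrib[symmetric] by (intro prod.cong) auto
  ultimately show ?thesis by (simp add: mult.assoc)
qed

text \<open>A cell of one degree less has exactly two positions with a common value. Removing the one or the
  other gives cells that differ by a transposition, and their contributions cancel.\<close>

lemma top_sign_coboundary:
  assumes x: "x \<in> free_module (cells b a a t)" and b: "a + Suc t = b"
  shows "top_sign b a (coboundary b a a x) = 0"
proof -
  let ?U = "holes b"
  let ?S = "Sigma (cells b a a (Suc t)) (\<lambda>q. ?U q \<times> ({1..b} - ?U q))"
  define F where "F = (\<lambda>(q, i, j). ord_sign {1..b} q * (insertion_sign i (?U q) * x (q(i := q j))))"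
  have "top_sign b a (coboundary b a a x) = (\<Sum>q\<in>cells b a a (Suc t). ord_sign {1..b} q * coboundary b a a x q)"
    using b by (simp add: top_sign_def flip: b)
  also have "\<dots> = (\<Sum>q\<in>cells b a a (Suc t). \<Sum>(i, j)\<in>?U q \<times> ({1..b} - ?U q). F (q, i, j))"
  proof (intro sum.cong refl)
    fix q assume q: "q \<in> cells b a a (Suc t)"
    have "(\<Sum>v=1..a. x (q(i := v))) = (\<Sum>j\<in>{1..b} - ?U q. x (q(i := q j)))" for i
      by (rule sum.reindex_bij_betw[OF cells_bij[OF q b], symmetric])
    then have "coboundary b a a x q = (\<Sum>i\<in>?U q. \<Sum>j\<in>{1..b} - ?U q. insertion_sign i (?U q) * x (q(i := q j)))"
      using q by (simp add: coboundary_def cells_def sum_distrib_left)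
    then show "ord_sign {1..b} q * coboundary b a a x q = (\<Sum>(i, j)\<in>?U q \<times> ({1..b} - ?U q). F (q, i, j))"
      by (simp add: F_def sum_distrib_left sum.cartesian_product case_prod_unfold)
  qed
  also have "\<dots> = sum F ?S"
    by (subst sum.Sigma) (auto simp: finite_cells case_prod_unfold intro!: sum.cong)
  finally have eq: "top_sign b a (coboundary b a a x) = sum F ?S" .
  have U: "?U (q \<circ> transpose i j) = insert j (?U q - {i})" if "i \<in> ?U q" "j \<in> {1..b} - ?U q" for q i j
  proof (rule Set.set_eqI)
    fix k show "k \<in> ?U (q \<circ> transpose i j) \<longleftrightarrow> k \<in> insert j (?U q - {i})"
      using that by (auto simp: holes_def transpose_def)
  qed
  let ?inv = "\<lambda>(q, i, j). (q \<circ> transpose i j, j, i)"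
  have inv_in: "?inv s \<in> ?S" if s: "s \<in> ?S" for s
  proof -
    obtain q i j where s: "s = (q, i, j)" and q: "q \<in> cells b a a (Suc t)" and i: "i \<in> ?U q"
      and j: "j \<in> {1..b} - ?U q" using s by auto
    have "i \<noteq> j" using i j by auto
    have tr: "transpose i j permutes {1..b}" using i j by (intro permutes_swap_id) (auto simp: holes_def)
    have "range (q \<circ> transpose i j) = range q"
      using permutes_surj[OF tr] by (metis image_comp)
    moreover have "q \<circ> transpose i j \<in> pmaps b a"
      using q i j by (auto simp: cells_def covering_def pmaps_def holes_def transpose_def)
    moreover have "card (insert j (?U q - {i})) = card (?U q)"
      using i j by (subst card_insert_disjoint) (auto simp: card_Suc_Diff1 simp del: card_Diff_insert)
    ultimately have "q \<circ> transpose i j \<in> cells b a a (Suc t)"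
      using q U[OF i j] by (simp add: cells_def covering_def)
    then show ?thesis using i j \<open>i \<noteq> j\<close> unfolding s by (auto simp: U[OF i j] holes_def)
  qed
  have F: "F (?inv s) = - F s" if s: "s \<in> ?S" for s
  proof -
    obtain q i j where s: "s = (q, i, j)" and q: "q \<in> cells b a a (Suc t)" and i: "i \<in> ?U q"
      and j: "j \<in> {1..b} - ?U q" using s by auto
    have ne: "i \<noteq> j" and ib: "i \<in> {1..b}" "j \<in> {1..b}" using i j by (auto simp: holes_def)
    let ?y = "transpose i j" and ?T = "?U q - {i}"
    have y: "?y permutes {1..b}" using ib by (intro permutes_swap_id)
    have T: "finite ?T" "j \<notin> ?T" "i \<notin> ?T" using j by auto
    have fixT: "?y k = k" if "k \<in> ?T" for k using that T by (auto simp: transpose_def)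
    have "ord_sign (insert j ?T) ?y = ord_sign ?T ?y * (insertion_sign j ?T * insertion_sign (?y j) (?y ` ?T))"
      by (rule ord_sign_insert_perm[OF T(1,2) permutes_inj_on[OF y]])
    moreover have "ord_sign ?T ?y = 1" by (rule ord_sign_mono) (simp add: fixT)
    moreover have "?y ` ?T = ?T" using fixT by (simp add: image_cong)
    moreover have "insertion_sign j ?T = insertion_sign j (insert j ?T)"
      using insertion_sign_remove[of j "insert j ?T"] T(2) by simp
    ultimately have "ord_sign (insert j ?T) ?y = insertion_sign j (insert j ?T) * insertion_sign i (?U q)"
      by (simp add: insertion_sign_remove)
    moreover have "ord_sign {1..b} (q \<circ> ?y) * ord_sign (insert j ?T) ?y = - ord_sign {1..b} q"
      using ord_sign_comp_partial[OF cells_inj[OF q b] y] ord_sign_transpose[OF _ ib ne]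
      by (simp add: U[OF i j])
    ultimately have e: "ord_sign {1..b} (q \<circ> ?y) * (insertion_sign j (insert j ?T) * insertion_sign i (?U q))
        = - ord_sign {1..b} q" by simp
    have "ord_sign {1..b} (q \<circ> ?y) * insertion_sign j (insert j ?T)
      = ord_sign {1..b} (q \<circ> ?y) * insertion_sign j (insert j ?T) * (insertion_sign i (?U q) * insertion_sign i (?U q))"
      by (simp add: insertion_sign_square)
    also have "\<dots> = ord_sign {1..b} (q \<circ> ?y) * (insertion_sign j (insert j ?T) * insertion_sign i (?U q)) * insertion_sign i (?U q)"
      by (simp only: mult.assoc)
    finally have sgn: "ord_sign {1..b} (q \<circ> ?y) * insertion_sign j (insert j ?T) = - ord_sign {1..b} q * insertion_sign i (?U q)"
      unfolding e .
    have "(q \<circ> ?y)(j := (q \<circ> ?y) i) = q(i := q j)"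
      by (auto simp: fun_eq_iff transpose_def)
    then have "F (?inv s) = (ord_sign {1..b} (q \<circ> ?y) * insertion_sign j (insert j ?T)) * x (q(i := q j))"
      unfolding s F_def by (simp only: prod.case U[OF i j] mult.assoc)
    then show ?thesis unfolding sgn unfolding s F_def by simp
  qed
  have ii: "?inv (?inv s) = s" for s :: "(nat \<Rightarrow> nat) \<times> nat \<times> nat"
    by (cases s) (simp add: comp_assoc transpose_commute)
  have "sum F ?S = (\<Sum>s\<in>?S. F (?inv s))"
    by (rule sum.reindex_bij_witness[where i = ?inv and j = ?inv]) (simp_all only: ii inv_in)
  also have "\<dots> = (\<Sum>s\<in>?S. - F s)" by (intro sum.cong refl F)
  also have "\<dots> = - sum F ?S" by (rule sum_negf)
  finally show ?thesis using eq by simp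
qed

text \<open>With the smallest value \<open>0\<close>, position \<open>i\<close> forms inversions with the earlier defined positions; with the
  largest value \<open>a + 1\<close>, with all later positions. The insertion sign counts the earlier undefined positions,
  so the three together count every other position once.\<close>

lemma ord_sign_top_value:
  assumes p: "p \<in> pmaps b a" and i: "i \<in> holes b p"
  shows "ord_sign {1..b} p * insertion_sign i (holes b p) = (-1) ^ (b - 1) * ord_sign {1..b} (p(i := Suc a))"
proof -
  define R where "R = {1..b} - {i}"
  have ib: "i \<in> {1..b}" and pi: "p i = 0" using i by (auto simp: holes_def)
  have R: "{1..b} = insert i R" "finite R" "i \<notin> R" "card R = b - 1" using ib by (auto simp: R_def)
  have pa: "p j \<le> a" for j using p by (simp add: pmaps_def)
  have same: "ord_sign R (p(i := Suc a)) = ord_sign R p"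
    using R(3) by (intro ord_sign_cong) auto
  have eps: "insertion_sign i (holes b p) = (\<Prod>j\<in>R. if j < i \<and> p j = 0 then -1 else 1)"
    unfolding insertion_sign_remove[of i "holes b p", symmetric] unfolding insertion_sign_def
    by (rule prod.mono_neutral_cong_left) (auto simp: R_def holes_def)
  have A: "(\<Prod>j\<in>R. if j < i \<and> p i < p j \<or> i < j \<and> p j < p i then -1 else 1 :: rat)
      = (\<Prod>j\<in>R. if j < i \<and> p j \<noteq> 0 then -1 else 1)" unfolding pi by simp
  have B: "(\<Prod>j\<in>R. if j < i \<and> (p(i := Suc a)) i < (p(i := Suc a)) j \<or> i < j \<and> (p(i := Suc a)) j < (p(i := Suc a)) i then -1 else 1 :: rat)
      = (\<Prod>j\<in>R. if i < j then -1 else 1)"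
    by (intro prod.cong) (use R(3) pa in \<open>auto simp: less_Suc_eq_le not_less le_SucI\<close>)
  have "(\<Prod>j\<in>R. if j < i \<and> p j \<noteq> 0 then -1 else 1 :: rat) * (\<Prod>j\<in>R. if j < i \<and> p j = 0 then -1 else 1)
      = (\<Prod>j\<in>R. - (if i < j then -1 else 1))"
    unfolding prod.distrib[symmetric] using R(3) by (intro prod.cong) auto
  also have "\<dots> = (-1) ^ (b - 1) * (\<Prod>j\<in>R. if i < j then -1 else 1)"
    using R(4) by (simp add: prod_uminus)
  finally show ?thesis
    unfolding R(1) ord_sign_insert[OF R(2,3)] A B same eps by (simp add: mult_ac)
qed

lemma top_sign_coboundary_Suc:
  assumes x: "x \<in> free_module (cells b (Suc a) (Suc a) t)" and b: "Suc a + t = b"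
  shows "top_sign b a (coboundary b (Suc a) a x) = (-1) ^ (b - 1) * top_sign b (Suc a) x"
proof -
  let ?U = "holes b" and ?A = "Suc a"
  let ?S = "Sigma (cells b a a (Suc t)) ?U"
  have ba: "b - a = Suc t" "b - ?A = t" using b by auto
  have val: "coboundary b ?A a x q = (\<Sum>i\<in>?U q. insertion_sign i (?U q) * x (q(i := ?A)))"
    if q: "q \<in> cells b a a (Suc t)" for q
  proof -
    have qa: "q j \<le> a" for j using q by (simp add: cells_def covering_def pmaps_def)
    have "(\<Sum>v=1..?A. x (q(i := v))) = x (q(i := ?A))" for i
    proof -
      have "x (q(i := v)) = 0" if "v \<le> a" for v
      proof -
        have "(q(i := v)) j \<noteq> ?A" for j using qa[of j] that by auto
        then have "?A \<notin> range (q(i := v))" by (metis rangeE)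
        moreover have "?A \<in> {1..?A}" by simp
        ultimately have "q(i := v) \<notin> cells b ?A ?A t" unfolding cells_def covering_def by blast
        then show ?thesis using x by (simp add: free_module_def)
      qed
      then show ?thesis by simp
    qed
    moreover have "q \<in> covering b ?A a"
      using q by (auto simp: cells_def covering_def pmaps_def le_Suc_eq)
    ultimately show ?thesis by (simp add: coboundary_def)
  qed
  have "top_sign b a (coboundary b ?A a x) = (\<Sum>q\<in>cells b a a (Suc t). \<Sum>i\<in>?U q. ord_sign {1..b} q * insertion_sign i (?U q) * x (q(i := ?A)))"
    unfolding top_sign_def ba by (intro sum.cong) (simp_all add: val sum_distrib_left mult.assoc)
  also have "\<dots> = (\<Sum>q\<in>cells b a a (Suc t). \<Sum>i\<in>?U q. (-1) ^ (b - 1) * (ord_sign {1..b} (q(i := ?A)) * x (q(i := ?A))))"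
  proof (intro sum.cong refl)
    fix q i assume "q \<in> cells b a a (Suc t)" "i \<in> ?U q"
    then show "ord_sign {1..b} q * insertion_sign i (?U q) * x (q(i := ?A))
        = (-1) ^ (b - 1) * (ord_sign {1..b} (q(i := ?A)) * x (q(i := ?A)))"
      using ord_sign_top_value[of q b a i] by (simp add: cells_def covering_def)
  qed
  also have "\<dots> = (\<Sum>(q, i)\<in>?S. (-1) ^ (b - 1) * (ord_sign {1..b} (q(i := ?A)) * x (q(i := ?A))))"
    by (rule sum.Sigma) (simp_all add: finite_cells)
  also have "\<dots> = (\<Sum>p\<in>cells b ?A ?A t. (-1) ^ (b - 1) * (ord_sign {1..b} p * x p))"
  proof -
    have bij: "bij_betw (\<lambda>(q, i). q(i := ?A)) ?S (cells b ?A ?A t)"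
      unfolding bij_betw_def
    proof (intro conjI equalityI)
      show "inj_on (\<lambda>(q, i). q(i := ?A)) ?S"
      proof (rule inj_onI, clarify)
        fix q i r j assume q: "q \<in> cells b a a (Suc t)" "i \<in> ?U q" and r: "r \<in> cells b a a (Suc t)" "j \<in> ?U r"
          and eq: "q(i := ?A) = r(j := ?A)"
        have qa: "q k \<le> a" "r k \<le> a" for k using q r by (auto simp: cells_def covering_def pmaps_def)
        have "(r(j := ?A)) i = ?A" using fun_cong[OF eq, of i] by simp
        then have ij: "i = j" using qa(2)[of i] by (auto split: if_splits)
        have "q k = r k" for k
          using fun_cong[OF eq, of k] ij q(2) r(2) by (cases "k = i") (auto simp: holes_def)
        then show "q = r \<and> i = j" using ij by auto
      qed
      show "(\<lambda>(q, i). q(i := ?A)) ` ?S \<subseteq> cells b ?A ?A t"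
      proof clarify
        fix q i assume q: "q \<in> cells b a a (Suc t)" and i: "i \<in> ?U q"
        have qc: "q \<in> covering b ?A a" using q by (auto simp: cells_def covering_def pmaps_def le_Suc_eq)
        then have c: "q(i := ?A) \<in> covering b ?A a" using i by (intro covering_assign) auto
        have "q \<in> cells b ?A a (Suc t)" using q qc by (simp add: cells_def)
        then have "q(i := ?A) \<in> cells b ?A a t"
          using cells_assign_iff[OF qc i, of ?A t] by simp
        moreover have "?A \<in> range (q(i := ?A))" by (rule range_eqI[of _ _ i]) simp
        ultimately show "q(i := ?A) \<in> cells b ?A ?A t"
          by (simp add: cells_def covering_def atLeastAtMostSuc_conv)
      qed
      show "cells b ?A ?A t \<subseteq> (\<lambda>(q, i). q(i := ?A)) ` ?S"
      proof
        fix p assume p: "p \<in> cells b ?A ?A t"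
        have "?A \<in> p ` ({1..b} - ?U p)" using cells_image[OF p] by simp
        then obtain i where i: "i \<in> {1..b} - ?U p" "p i = ?A" by auto
        let ?q = "p(i := 0)"
        have "p k \<le> a" if "k \<noteq> i" for k
        proof -
          have "p k \<le> ?A" using p by (simp add: cells_def covering_def pmaps_def)
          moreover have "p k \<noteq> ?A"
          proof
            assume k: "p k = ?A"
            then have "k \<in> {1..b} - ?U p" using p by (auto simp: cells_def covering_def pmaps_def holes_def)
            then show False using inj_onD[OF cells_inj[OF p b], of k i] i k that by simp
          qed
          ultimately show ?thesis by simp
        qed
        then have qp: "?q \<in> pmaps b a" using p by (auto simp: cells_def covering_def pmaps_def)
        moreover have "{1..a} \<subseteq> range ?q"
        proof
          fix v assume v: "v \<in> {1..a}"
          then have "v \<in> {1..?A}" by simp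
          then obtain k where "p k = v" using p by (auto simp: cells_def covering_def)
          then have "?q k = v" using i v by auto
          then show "v \<in> range ?q" by blast
        qed
        ultimately have qc: "?q \<in> covering b a a" by (simp add: covering_def)
        have iU: "i \<in> ?U ?q" using i by (simp add: holes_def)
        have "?U ?q = insert i (?U p)" using i by (auto simp: holes_def)
        then have "card (?U ?q) = Suc t" using i p by (simp add: cells_def)
        then have "?q \<in> cells b a a (Suc t)" using qc by (simp add: cells_def)
        moreover have "p = ?q(i := ?A)" using i by auto
        ultimately show "p \<in> (\<lambda>(q, i). q(i := ?A)) ` ?S"
          using iU by (intro image_eqI[of _ _ "(?q, i)"]) auto
      qed
    qed
    show ?thesis unfolding sum.reindex_bij_betw[OF bij, symmetric] by (simp add: case_prod_unfold)
  qed
  also have "\<dots> = (-1) ^ (b - 1) * top_sign b ?A x"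
    unfolding top_sign_def ba sum_distrib_left ..
  finally show ?thesis .
qed

lemma cells_mono: "cells b a a t \<subseteq> cells b (Suc a) a t"
  by (auto simp: cells_def covering_def pmaps_def le_Suc_eq)

lemma free_module_mono: "S \<subseteq> T \<Longrightarrow> free_module S \<subseteq> free_module T"
  by (auto simp: free_module_def)

lemma coboundary_extend:
  assumes z: "z \<in> free_module (cells b a a t)"
  shows "coboundary b (Suc a) a z = coboundary b a a z"
proof
  fix p
  have z0: "z q = 0" if "q k = Suc a" for q k
  proof -
    have "q \<notin> cells b a a t" using that by (auto simp: cells_def covering_def pmaps_def) (metis Suc_n_not_le_n)
    then show ?thesis using z by (simp add: free_module_def)
  qed
  show "coboundary b (Suc a) a z p = coboundary b a a z p"
  proof (cases "p \<in> covering b a a")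
    case True
    then have "p \<in> covering b (Suc a) a" by (auto simp: covering_def pmaps_def le_Suc_eq)
    then show ?thesis using True z0[of "p(i := Suc a)" i for i] by (simp add: coboundary_def)
  next
    case False
    show ?thesis
    proof (cases "p \<in> covering b (Suc a) a")
      case True
      then obtain k where k: "p k = Suc a"
        using False by (auto simp: covering_def pmaps_def le_Suc_eq)
      have "z (p(i := v)) = 0" if "i \<in> holes b p" for i v
        by (rule z0[of _ k]) (use that k in \<open>auto simp: holes_def\<close>)
      then show ?thesis using False by (simp add: coboundary_def)
    qed (use False in \<open>simp add: coboundary_def\<close>)
  qed
qed

text \<open>Dropping the condition that the largest value \<open>a + 1\<close> be attained gives an acyclic complex; the
  cells that miss this value form the complex for \<open>a\<close>. Hence the cohomology for \<open>a + 1\<close> is that for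
  \<open>a\<close> in the next degree, and the recursion ends at \<open>a = 0\<close>, where the only cell is the empty map.\<close>

theorem exact_positive_degree:
  assumes "x \<in> free_module (cells b a a (Suc t))" "coboundary b a a x = 0"
    and "a + Suc t = b \<Longrightarrow> top_sign b a x = 0"
  shows "\<exists>y\<in>free_module (cells b a a t). coboundary b a a y = x"
  using assms
proof (induction a arbitrary: x t)
  case 0
  have single: "cells b 0 0 s \<subseteq> {\<lambda>_. 0}" for s
    by (auto simp: cells_def covering_def pmaps_def)
  have "x p = 0" for p
  proof (cases "p \<in> cells b 0 0 (Suc t)")
    case True
    then have p: "p = (\<lambda>_. 0)" using single by blast
    have "holes b p = {1..b}" by (auto simp: p holes_def)
    then have b: "0 + Suc t = b" using True by (simp add: cells_def)
    then have "cells b 0 0 b = {p}" using True single p by auto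
    then have "ord_sign {1..b} p * x p = 0" using 0(3)[OF b] by (simp add: top_sign_def)
    then show ?thesis using ord_sign_square[of "{1..b}" p] by auto
  next
    case False
    then show ?thesis using 0(1) by (simp add: free_module_def)
  qed
  then have "coboundary b 0 0 0 = x" by (auto simp: coboundary_def)
  moreover have "0 \<in> free_module (cells b 0 0 t)" by (simp add: free_module_def)
  ultimately show ?case by (rule bexI)
next
  case (Suc a)
  let ?A = "Suc a"
  have sub: "cells b ?A ?A s \<subseteq> cells b ?A a s" for s
    by (auto simp: cells_def covering_def atLeastAtMostSuc_conv)
  have cov: "p \<in> covering b ?A ?A \<longleftrightarrow> p \<in> covering b ?A a \<and> ?A \<in> range p" for p
    by (auto simp: covering_def atLeastAtMostSuc_conv)
  have xE: "x \<in> free_module (cells b ?A a (Suc t))"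
    using Suc.prems(1) free_module_mono[OF sub] by blast
  define e where "e = coboundary b ?A a x"
  have "e \<in> free_module (cells b ?A a (Suc (Suc t)))" unfolding e_def by (rule coboundary_closed[OF xE])
  moreover have e0: "e p = 0" if "?A \<in> range p" for p
  proof (cases "p \<in> covering b ?A a")
    case True
    then have "e p = coboundary b ?A ?A x p" using that cov by (simp add: e_def coboundary_def)
    then show ?thesis using Suc.prems(2) by simp
  qed (simp add: e_def coboundary_def)
  moreover have "p \<in> cells b a a s" if "p \<in> cells b ?A a s" "?A \<notin> range p" for p s
  proof -
    have "p k \<le> a" for k
    proof -
      have "p k \<le> ?A" using that(1) by (simp add: cells_def covering_def pmaps_def)
      moreover have "p k \<noteq> ?A" using that(2) by (metis rangeI)
      ultimately show ?thesis by simp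
    qed
    then show ?thesis using that(1) by (auto simp: cells_def covering_def pmaps_def)
  qed
  ultimately have e: "e \<in> free_module (cells b a a (Suc (Suc t)))"
    unfolding free_module_def by blast
  have "coboundary b a a e = 0" using coboundary_extend[OF e] by (simp add: e_def coboundary_coboundary)
  moreover have "top_sign b a e = 0" if "a + Suc (Suc t) = b"
    using top_sign_coboundary_Suc[OF Suc.prems(1)] Suc.prems(3) that by (simp add: e_def)
  ultimately obtain z where z: "z \<in> free_module (cells b a a (Suc t))" "coboundary b a a z = e"
    using Suc.IH[OF e] by blast
  have zE: "z \<in> free_module (cells b ?A a (Suc t))" using z(1) free_module_mono[OF cells_mono] by blast
  have "x - z \<in> free_module (cells b ?A a (Suc t))"
    using xE zE Q.subspace_diff[OF subspace_free_module] by blast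
  moreover have "coboundary b ?A a (x - z) = 0"
    unfolding coboundary_diff coboundary_extend[OF z(1)] z(2) by (simp add: e_def)
  ultimately obtain w where w: "w \<in> free_module (cells b ?A a t)" "coboundary b ?A a w = x - z"
    using acyclic_covering[of a ?A "x - z" b t] by auto
  define y where "y = (\<lambda>p. if p \<in> covering b ?A ?A then w p else 0)"
  have "y \<in> free_module (cells b ?A ?A t)"
    using w(1) by (auto simp: y_def free_module_def cells_def cov)
  moreover have "coboundary b ?A ?A y p = x p" for p
  proof (cases "p \<in> covering b ?A ?A")
    case True
    have "y (p(i := v)) = w (p(i := v))" if "i \<in> holes b p" "v \<in> {1..?A}" for i v
      using covering_assign[OF True that(1), of v] that(2) by (simp add: y_def)
    then have "coboundary b ?A ?A y p = coboundary b ?A a w p" using True cov by (simp add: coboundary_def)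
    also have "\<dots> = x p - z p" by (simp add: w(2))
    also have "z p = 0"
    proof -
      obtain k where k: "p k = ?A" using True cov by auto
      have "p \<notin> cells b a a (Suc t)"
      proof
        assume "p \<in> cells b a a (Suc t)"
        then have "p k \<le> a" by (simp add: cells_def covering_def pmaps_def)
        then show False using k by simp
      qed
      then show ?thesis using z(1) by (simp add: free_module_def)
    qed
    finally show ?thesis by simp
  next
    case False
    then show ?thesis using Suc.prems(1) by (auto simp: coboundary_def free_module_def cells_def)
  qed
  ultimately show ?case by blast
qed

section \<open>The complex as a complex of representations\<close>

lemma sym_bigroup_simps:
  "(\<sigma>, y) \<in> carrier (sym_bigroup a b) \<longleftrightarrow> \<sigma> permutes {1..a} \<and> y permutes {1..b}"
  "(\<sigma>, y) \<otimes>\<^bsub>sym_bigroup a b\<^esub> (\<sigma>', y') = (\<sigma> \<circ> \<sigma>', y' \<circ> y)"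
  "\<one>\<^bsub>sym_bigroup a b\<^esub> = (id, id)"
  by (simp_all add: sym_group_def op_group_def)

text \<open>Permuting the positions also reorients the set of undefined positions; this sign makes the
  coboundary equivariant.\<close>

definition cell_rep :: "nat \<Rightarrow> nat \<Rightarrow> nat \<Rightarrow> ((nat \<Rightarrow> nat) \<times> (nat \<Rightarrow> nat), (nat \<Rightarrow> nat) \<Rightarrow> rat) rep" where
  "cell_rep a b t =
     \<lparr>rspace = free_module (cells b a a t),
      ract = \<lambda>(\<sigma>, y) \<Phi> p. ord_sign (holes b p) y * \<Phi> (inv' \<sigma> \<circ> p \<circ> inv' y)\<rparr>"

lemma permutes_zero: "\<sigma> permutes {1..a} \<Longrightarrow> \<sigma> 0 = (0::nat)"
  by (rule permutes_not_in) auto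

lemma permutes_eq_zero: "\<sigma> permutes {1..a} \<Longrightarrow> \<sigma> v = (0::nat) \<longleftrightarrow> v = 0"
  by (metis permutes_zero permutes_inj injD)

lemma permutes_le: "\<sigma> permutes {1..a} \<Longrightarrow> v \<le> a \<Longrightarrow> \<sigma> v \<le> (a::nat)"
  using permutes_in_image[of \<sigma> "{1..a}" v] permutes_zero[of \<sigma> a] by (cases "v = 0") auto

lemma holes_conj:
  assumes "\<sigma> permutes {1..a}" "y permutes {1..b}"
  shows "holes b (\<sigma> \<circ> p \<circ> inv' y) = y ` holes b p"
proof (intro equalityI subsetI)
  fix k assume "k \<in> holes b (\<sigma> \<circ> p \<circ> inv' y)"
  then have "inv' y k \<in> holes b p"
    using assms permutes_in_image[OF permutes_inv[OF assms(2)], of k]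
    by (simp add: holes_def permutes_eq_zero)
  moreover have "k = y (inv' y k)" by (simp add: permutes_inverses[OF assms(2)])
  ultimately show "k \<in> y ` holes b p" by blast
next
  fix k assume "k \<in> y ` holes b p"
  then obtain i where i: "k = y i" "i \<in> {1..b}" "p i = 0" by (auto simp: holes_def)
  then have "k \<in> {1..b}" using permutes_in_image[OF assms(2), of i] by blast
  then show "k \<in> holes b (\<sigma> \<circ> p \<circ> inv' y)"
    using i assms by (simp add: holes_def permutes_inverses[OF assms(2)] permutes_eq_zero)
qed

lemma covering_conj:
  assumes s: "\<sigma> permutes {1..a}" and y: "y permutes {1..b}" and p: "p \<in> covering b a a"
  shows "\<sigma> \<circ> p \<circ> inv' y \<in> covering b a a"
proof -
  have "{1..a} \<subseteq> range (\<sigma> \<circ> p \<circ> inv' y)"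
  proof
    fix v assume "v \<in> {1..a}"
    then have "inv' \<sigma> v \<in> {1..a}" using permutes_in_image[OF permutes_inv[OF s]] by blast
    then obtain i where "p i = inv' \<sigma> v" using p by (auto simp: covering_def)
    then have "v = (\<sigma> \<circ> p \<circ> inv' y) (y i)" by (simp add: permutes_inverses[OF s] permutes_inverses[OF y])
    then show "v \<in> range (\<sigma> \<circ> p \<circ> inv' y)" by (rule range_eqI)
  qed
  moreover have "\<sigma> \<circ> p \<circ> inv' y \<in> pmaps b a"
    using p permutes_not_in[OF permutes_inv[OF y]] permutes_le[OF s] permutes_zero[OF s]
    by (auto simp: covering_def pmaps_def)
  ultimately show ?thesis by (simp add: covering_def)
qed

lemma cells_conj:
  assumes s: "\<sigma> permutes {1..a}" and y: "y permutes {1..b}" and p: "p \<in> cells b a a t"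
  shows "\<sigma> \<circ> p \<circ> inv' y \<in> cells b a a t"
  using covering_conj[OF s y, of p] p card_image[OF permutes_inj_on[OF y], of "holes b p"]
  by (simp add: cells_def holes_conj[OF s y])

lemma conj_inverse:
  assumes s: "\<sigma> permutes S" and y: "y permutes T"
  shows "\<sigma> \<circ> (inv' \<sigma> \<circ> p \<circ> inv' y) \<circ> y = p" "inv' \<sigma> \<circ> (\<sigma> \<circ> p \<circ> y) \<circ> inv' y = p"
  by (simp_all add: fun_eq_iff permutes_inverses[OF s] permutes_inverses[OF y])

lemma cells_conj_inv:
  assumes s: "\<sigma> permutes {1..a}" and y: "y permutes {1..b}"
  shows "\<sigma> \<circ> p \<circ> y \<in> cells b a a t \<longleftrightarrow> p \<in> cells b a a t"
    and "inv' \<sigma> \<circ> p \<circ> inv' y \<in> cells b a a t \<longleftrightarrow> p \<in> cells b a a t"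
    and "inv' \<sigma> \<circ> p \<circ> inv' y \<in> covering b a a \<longleftrightarrow> p \<in> covering b a a"
proof -
  note s' = permutes_inv[OF s] and y' = permutes_inv[OF y]
  have ii: "inv' (inv' y) = y" using y by (rule permutes_inv_inv)
  have A: "\<sigma> \<circ> p \<circ> y \<in> cells b a a t" if "p \<in> cells b a a t" for p
    using cells_conj[OF s y' that] by (simp add: ii)
  have B: "inv' \<sigma> \<circ> p \<circ> inv' y \<in> cells b a a t" if "p \<in> cells b a a t" for p
    using cells_conj[OF s' y that] by simp
  have C: "\<sigma> \<circ> p \<circ> y \<in> covering b a a" if "p \<in> covering b a a" for p
    using covering_conj[OF s y' that] by (simp add: ii)
  have D: "inv' \<sigma> \<circ> p \<circ> inv' y \<in> covering b a a" if "p \<in> covering b a a" for p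
    using covering_conj[OF s' y that] by simp
  show "\<sigma> \<circ> p \<circ> y \<in> cells b a a t \<longleftrightarrow> p \<in> cells b a a t"
    using A[of p] B[of "\<sigma> \<circ> p \<circ> y"] unfolding conj_inverse[OF s y] by blast
  show "inv' \<sigma> \<circ> p \<circ> inv' y \<in> cells b a a t \<longleftrightarrow> p \<in> cells b a a t"
    using B[of p] A[of "inv' \<sigma> \<circ> p \<circ> inv' y"] unfolding conj_inverse[OF s y] by blast
  show "inv' \<sigma> \<circ> p \<circ> inv' y \<in> covering b a a \<longleftrightarrow> p \<in> covering b a a"
    using D[of p] C[of "inv' \<sigma> \<circ> p \<circ> inv' y"] unfolding conj_inverse[OF s y] by blast
qed

lemma cell_rep_act: "ract (cell_rep a b t) (\<sigma>, y) \<Phi> p = ord_sign (holes b p) y * \<Phi> (inv' \<sigma> \<circ> p \<circ> inv' y)"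
  by (simp add: cell_rep_def)

lemma fd_rep_cell: "fd_rep (sym_bigroup a b) (cell_rep a b t)"
  unfolding fd_rep_def
proof (intro conjI ballI)
  let ?C = "cell_rep a b t"
  show "\<exists>B. finite B \<and> rspace ?C = Q.span B"
    using free_module_fd[OF finite_cells] by (simp add: cell_rep_def)
  fix g assume g: "g \<in> carrier (sym_bigroup a b)"
  obtain \<sigma> y where gd: "g = (\<sigma>, y)" by (cases g)
  have s: "\<sigma> permutes {1..a}" and y: "y permutes {1..b}" using g unfolding gd sym_bigroup_simps by blast+
  have "ract ?C g \<Phi> \<in> free_module (cells b a a t)" if "\<Phi> \<in> free_module (cells b a a t)" for \<Phi>
    using that cells_conj_inv(2)[OF s y] by (simp add: free_module_def gd cell_rep_act)
  then show "linear_on (rspace ?C) (rspace ?C) (ract ?C g)"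
    by (auto simp: linear_on_def cell_rep_def gd fun_eq_iff algebra_simps)
  fix h \<Phi> assume h: "h \<in> carrier (sym_bigroup a b)"
  obtain \<sigma>' y' where hd: "h = (\<sigma>', y')" by (cases h)
  have s': "\<sigma>' permutes {1..a}" and y': "y' permutes {1..b}" using h unfolding hd sym_bigroup_simps by blast+
  show "ract ?C (g \<otimes>\<^bsub>sym_bigroup a b\<^esub> h) \<Phi> = ract ?C g (ract ?C h \<Phi>)"
  proof
    fix p
    have "holes b (inv' \<sigma> \<circ> p \<circ> inv' y) = y ` holes b p"
      by (rule holes_conj[OF permutes_inv[OF s] y])
    moreover have "ord_sign (holes b p) (y' \<circ> y) = ord_sign (holes b p) y * ord_sign (y ` holes b p) y'"
      by (intro ord_sign_comp permutes_inj_on[OF y] permutes_inj_on[OF y'])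
    moreover have "inv' (\<sigma> \<circ> \<sigma>') = inv' \<sigma>' \<circ> inv' \<sigma>" "inv' (y' \<circ> y) = inv' y \<circ> inv' y'"
      using permutes_bij[OF s] permutes_bij[OF s'] permutes_bij[OF y] permutes_bij[OF y']
      by (simp_all add: o_inv_distrib)
    ultimately show "ract ?C (g \<otimes>\<^bsub>sym_bigroup a b\<^esub> h) \<Phi> p = ract ?C g (ract ?C h \<Phi>) p"
      unfolding gd hd sym_bigroup_simps cell_rep_act by (simp add: comp_assoc mult.assoc)
  qed
next
  fix \<Phi>
  have "ord_sign T id = 1" for T by (rule ord_sign_mono) simp
  then show "ract (cell_rep a b t) \<one>\<^bsub>sym_bigroup a b\<^esub> \<Phi> = \<Phi>"
    unfolding sym_bigroup_simps by (intro ext) (simp add: cell_rep_act)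
qed

text \<open>Reindex the undefined positions by \<open>y\<close> and the inserted values by \<open>\<sigma>\<close>; the signs match by
  \<open>ord_sign_insert_perm\<close>.\<close>

lemma coboundary_rep_hom: "coboundary b a a \<in> rep_hom (sym_bigroup a b) (cell_rep a b t) (cell_rep a b (Suc t))"
  unfolding rep_hom_def
proof (intro CollectI conjI ballI)
  have "coboundary b a a \<in> free_module (cells b a a t) \<rightarrow> free_module (cells b a a (Suc t))"
    using coboundary_closed by blast
  then show "linear_on (rspace (cell_rep a b t)) (rspace (cell_rep a b (Suc t))) (coboundary b a a)"
    by (simp add: linear_on_def cell_rep_def coboundary_add coboundary_scale)
  fix g \<Phi> assume g: "g \<in> carrier (sym_bigroup a b)"
  obtain \<sigma> y where gd: "g = (\<sigma>, y)" by (cases g)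
  have s: "\<sigma> permutes {1..a}" and y: "y permutes {1..b}" using g unfolding gd sym_bigroup_simps by blast+
  show "coboundary b a a (ract (cell_rep a b t) g \<Phi>) = ract (cell_rep a b (Suc t)) g (coboundary b a a \<Phi>)"
  proof
    fix p
    let ?q = "inv' \<sigma> \<circ> p \<circ> inv' y" and ?U = "holes b p"
    show "coboundary b a a (ract (cell_rep a b t) g \<Phi>) p = ract (cell_rep a b (Suc t)) g (coboundary b a a \<Phi>) p"
    proof (cases "p \<in> covering b a a")
      case True
      have U: "holes b ?q = y ` ?U" by (rule holes_conj[OF permutes_inv[OF s] y])
      have "coboundary b a a (ract (cell_rep a b t) g \<Phi>) p
          = (\<Sum>i\<in>?U. insertion_sign i ?U * (\<Sum>v=1..a. ract (cell_rep a b t) g \<Phi> (p(i := v))))"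
        using True by (simp add: coboundary_def)
      also have "\<dots> = (\<Sum>i\<in>?U. ord_sign ?U y * (insertion_sign (y i) (y ` ?U) * (\<Sum>v=1..a. \<Phi> (?q(y i := v)))))"
      proof (intro sum.cong refl)
        fix i assume i: "i \<in> ?U"
        have *: "ract (cell_rep a b t) g \<Phi> (p(i := v)) = ord_sign (?U - {i}) y * \<Phi> (?q(y i := inv' \<sigma> v))"
          if "v \<in> {1..a}" for v
        proof -
          have "inv' \<sigma> \<circ> p(i := v) \<circ> inv' y = ?q(y i := inv' \<sigma> v)"
            by (auto simp: fun_eq_iff permutes_inverses[OF y])
          moreover have "holes b (p(i := v)) = ?U - {i}" using that by (intro holes_upd) auto
          ultimately show ?thesis unfolding gd cell_rep_act by simp
        qed
        have "(\<Sum>v=1..a. ract (cell_rep a b t) g \<Phi> (p(i := v)))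
            = ord_sign (?U - {i}) y * (\<Sum>v=1..a. \<Phi> (?q(y i := inv' \<sigma> v)))"
          unfolding sum_distrib_left by (intro sum.cong refl *)
        also have "(\<Sum>v=1..a. \<Phi> (?q(y i := inv' \<sigma> v))) = (\<Sum>v=1..a. \<Phi> (?q(y i := v)))"
          by (rule sum.reindex_bij_betw[OF permutes_imp_bij[OF permutes_inv[OF s]]])
        finally have inner: "(\<Sum>v=1..a. ract (cell_rep a b t) g \<Phi> (p(i := v)))
            = ord_sign (?U - {i}) y * (\<Sum>v=1..a. \<Phi> (?q(y i := v)))" .
        have "y ` (?U - {i}) = y ` ?U - {y i}"
          using permutes_inj[OF y] by (simp add: image_set_diff)
        then have "ord_sign ?U y = ord_sign (?U - {i}) y * (insertion_sign i ?U * insertion_sign (y i) (y ` ?U))"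
          using ord_sign_insert_perm[of "?U - {i}" i y, OF _ _ permutes_inj_on[OF y]] i
          by (simp add: insert_absorb insertion_sign_remove)
        then have "ord_sign ?U y * insertion_sign (y i) (y ` ?U)
            = ord_sign (?U - {i}) y * insertion_sign i ?U * (insertion_sign (y i) (y ` ?U) * insertion_sign (y i) (y ` ?U))"
          by (simp only: mult.assoc)
        then have "ord_sign ?U y * insertion_sign (y i) (y ` ?U) = insertion_sign i ?U * ord_sign (?U - {i}) y"
          by (simp add: insertion_sign_square)
        then show "insertion_sign i ?U * (\<Sum>v=1..a. ract (cell_rep a b t) g \<Phi> (p(i := v)))
            = ord_sign ?U y * (insertion_sign (y i) (y ` ?U) * (\<Sum>v=1..a. \<Phi> (?q(y i := v))))"
          unfolding inner mult.assoc[symmetric] by simp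
      qed
      also have "\<dots> = ord_sign ?U y * (\<Sum>k\<in>y ` ?U. insertion_sign k (y ` ?U) * (\<Sum>v=1..a. \<Phi> (?q(k := v))))"
        unfolding sum_distrib_left[symmetric] by (subst sum.reindex[OF permutes_inj_on[OF y]]) simp
      also have "\<dots> = ract (cell_rep a b (Suc t)) g (coboundary b a a \<Phi>) p"
        using True cells_conj_inv(3)[OF s y] unfolding gd cell_rep_act by (simp only: coboundary_def U if_True)
      finally show ?thesis .
    next
      case False
      then show ?thesis using cells_conj_inv(3)[OF s y] unfolding gd cell_rep_act by (simp add: coboundary_def)
    qed
  qed
qed

text \<open>Only pairs of defined positions can change their order under a permutation of the nonzero values.\<close>

lemma ord_sign_permute_values:
  assumes q: "q \<in> cells b a a t" "a + t = b" and s: "\<sigma> permutes {1..a}"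
  shows "ord_sign {1..b} (\<sigma> \<circ> q) = of_int (sign \<sigma>) * ord_sign {1..b} q"
proof -
  let ?W = "{1..b} - holes b q"
  let ?R = "ord_pairs {1..b} - ord_pairs ?W"
  have sub: "ord_pairs ?W \<subseteq> ord_pairs {1..b}" "finite (ord_pairs {1..b})"
    by (simp_all only: finite_ord_pairs finite_atLeastAtMost) (auto simp: ord_pairs_def)
  have decomp: "ord_sign {1..b} f = (\<Prod>(i, j)\<in>?R. if f j < f i then -1 else 1) * ord_sign ?W f" for f
    unfolding ord_sign_def by (rule prod.subset_diff[OF sub])
  have "(\<Prod>(i, j)\<in>?R. if (\<sigma> \<circ> q) j < (\<sigma> \<circ> q) i then -1 else 1 :: rat)
      = (\<Prod>(i, j)\<in>?R. if q j < q i then -1 else 1)"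
  proof (intro prod.cong refl, clarify)
    fix i j assume "(i, j) \<in> ord_pairs {1..b}" "(i, j) \<notin> ord_pairs ?W"
    then have "q i = 0 \<or> q j = 0" by (auto simp: ord_pairs_def holes_def)
    then show "(if (\<sigma> \<circ> q) j < (\<sigma> \<circ> q) i then -1 else 1) = (if q j < q i then -1 else 1 :: rat)"
    proof
      assume "q i = 0"
      then show ?thesis by (simp add: permutes_zero[OF s])
    next
      assume "q j = 0"
      moreover have "0 < \<sigma> (q i) \<longleftrightarrow> 0 < q i"
        unfolding neq0_conv[symmetric] by (simp only: permutes_eq_zero[OF s])
      ultimately show ?thesis by (simp add: permutes_zero[OF s])
    qed
  qed
  moreover have "ord_sign ?W (\<sigma> \<circ> q) = ord_sign ?W q * of_int (sign \<sigma>)"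
    using ord_sign_comp[OF cells_inj[OF q] permutes_inj_on[OF s]] cells_image[OF q(1)]
      sign_eq_ord_sign[OF s] by simp
  ultimately show ?thesis unfolding decomp[of q] decomp[of "\<sigma> \<circ> q"] by (simp add: mult_ac)
qed

lemma top_sign_rep_hom:
  assumes "a + t = b"
  shows "top_sign b a \<in> rep_hom (sym_bigroup a b) (cell_rep a b t) sgn_rep"
  unfolding rep_hom_def
proof (intro CollectI conjI ballI)
  show "linear_on (rspace (cell_rep a b t)) (rspace sgn_rep) (top_sign b a)"
    by (auto simp: linear_on_def sgn_rep_def top_sign_def distrib_left sum.distrib sum_distrib_left mult.left_commute)
  have t: "b - a = t" using assms by simp
  fix g \<Phi> assume g: "g \<in> carrier (sym_bigroup a b)"
  obtain \<sigma> y where gd: "g = (\<sigma>, y)" by (cases g)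
  have s: "\<sigma> permutes {1..a}" and y: "y permutes {1..b}" using g unfolding gd sym_bigroup_simps by blast+
  let ?C = "cells b a a t"
  have "top_sign b a (ract (cell_rep a b t) g \<Phi>)
      = (\<Sum>p\<in>?C. ord_sign {1..b} p * (ord_sign (holes b p) y * \<Phi> (inv' \<sigma> \<circ> p \<circ> inv' y)))"
    unfolding top_sign_def t gd cell_rep_act ..
  also have "\<dots> = (\<Sum>q\<in>?C. ord_sign {1..b} (\<sigma> \<circ> q \<circ> y) * (ord_sign (holes b (\<sigma> \<circ> q \<circ> y)) y * \<Phi> q))"
    by (rule sum.reindex_bij_witness[where i = "\<lambda>q. \<sigma> \<circ> q \<circ> y" and j = "\<lambda>p. inv' \<sigma> \<circ> p \<circ> inv' y"])
      (simp_all only: conj_inverse[OF s y] cells_conj_inv[OF s y])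
  also have "\<dots> = (\<Sum>q\<in>?C. of_int (sign \<sigma>) * of_int (sign y) * (ord_sign {1..b} q * \<Phi> q))"
  proof (intro sum.cong refl)
    fix q assume q: "q \<in> ?C"
    have U: "holes b (\<sigma> \<circ> q) = holes b q" using permutes_eq_zero[OF s] by (simp add: holes_def)
    have "inj_on (\<sigma> \<circ> q) ({1..b} - holes b q)"
      by (intro comp_inj_on cells_inj[OF q assms] permutes_inj_on[OF s])
    then have "ord_sign {1..b} (\<sigma> \<circ> q \<circ> y) * ord_sign (holes b (\<sigma> \<circ> q \<circ> y)) y
        = ord_sign {1..b} (\<sigma> \<circ> q) * ord_sign {1..b} y"
      using ord_sign_comp_partial[of "\<sigma> \<circ> q" b y] y U by simp
    then show "ord_sign {1..b} (\<sigma> \<circ> q \<circ> y) * (ord_sign (holes b (\<sigma> \<circ> q \<circ> y)) y * \<Phi> q)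
        = of_int (sign \<sigma>) * of_int (sign y) * (ord_sign {1..b} q * \<Phi> q)"
      unfolding ord_sign_permute_values[OF q assms s] mult.assoc[symmetric]
      using sign_eq_ord_sign[OF y] by (simp add: mult_ac)
  qed
  also have "\<dots> = ract sgn_rep g (top_sign b a \<Phi>)"
    unfolding top_sign_def t gd by (simp add: sgn_rep_def sum_distrib_left)
  finally show "top_sign b a (ract (cell_rep a b t) g \<Phi>) = ract sgn_rep g (top_sign b a \<Phi>)" .
qed

lemma top_sign_surj:
  assumes b: "a + t = b"
  shows "top_sign b a ` free_module (cells b a a t) = UNIV"
proof -
  define p where "p = (\<lambda>i. if i \<in> {1..a} then i else 0)"
  have "holes b p = {Suc a..b}" using b by (auto simp: holes_def p_def)
  then have "card (holes b p) = t" using b by simp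
  moreover have "{1..a} \<subseteq> range p"
  proof
    fix v assume "v \<in> {1..a}"
    then have "v = p v" by (simp add: p_def)
    then show "v \<in> range p" by (rule range_eqI)
  qed
  ultimately have p: "p \<in> cells b a a t" using b by (auto simp: cells_def covering_def pmaps_def p_def)
  have "r \<in> top_sign b a ` free_module (cells b a a t)" for r
  proof
    let ?x = "\<lambda>q. if q = p then ord_sign {1..b} p * r else 0"
    show "?x \<in> free_module (cells b a a t)" using p by (auto simp: free_module_def)
    have "top_sign b a ?x = (\<Sum>q\<in>cells b a a t. if q = p then ord_sign {1..b} p * (ord_sign {1..b} p * r) else 0)"
      unfolding top_sign_def using b by (intro sum.cong) auto
    also have "\<dots> = r" using p finite_cells by (simp add: mult.assoc[symmetric] ord_sign_square)
    finally show "r = top_sign b a ?x" by simp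
  qed
  then show ?thesis by blast
qed

section \<open>The terms of the complex as induced representations\<close>

lemma finite_image_cong_perm:
  assumes "L \<subseteq> S" "U \<subseteq> S" "finite S" "card L = card U"
  shows "\<exists>x. x permutes S \<and> x ` L = U"
proof -
  have fin: "finite L" "finite U" "finite (S - L)" "finite (S - U)" using assms finite_subset by auto
  obtain f where f: "bij_betw f L U" using fin assms(4) finite_same_card_bij by blast
  have "card (S - L) = card (S - U)" using assms fin by (simp add: card_Diff_subset)
  then obtain g where g: "bij_betw g (S - L) (S - U)" using fin finite_same_card_bij by blast
  define x where "x = (\<lambda>i. if i \<in> L then f i else if i \<in> S then g i else i)"
  have "bij_betw x L U" using f by (subst bij_betw_cong[of _ x f]) (auto simp: x_def)
  moreover have "bij_betw x (S - L) (S - U)" using g by (subst bij_betw_cong[of _ x g]) (auto simp: x_def)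
  ultimately have "bij_betw x (L \<union> (S - L)) (U \<union> (S - U))" by (rule bij_betw_combine) auto
  then have "bij_betw x S S" using assms by (simp add: Un_absorb1 Un_Diff_cancel)
  then have "x permutes S" using assms(1) by (intro bij_imp_permutes) (auto simp: x_def)
  moreover have "x ` L = U" using \<open>bij_betw x L U\<close> by (simp add: bij_betw_def)
  ultimately show ?thesis by blast
qed

lemma linearize_surjections:
  assumes s: "\<sigma> permutes {1..a}" and t: "\<tau> permutes {1..n}"
  shows "linearize (surjections n a) (\<lambda>f. compose {1..n} \<sigma> (compose {1..n} f \<tau>)) c f
    = (if f \<in> surjections n a then c (compose {1..n} (inv' \<sigma>) (compose {1..n} f (inv' \<tau>))) else 0)"
proof -
  let ?L = "\<lambda>f. compose {1..n} \<sigma> (compose {1..n} f \<tau>)"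
  let ?M = "\<lambda>f. compose {1..n} (inv' \<sigma>) (compose {1..n} f (inv' \<tau>))"
  have ext: "f \<in> extensional {1..n}" if "f \<in> surjections n a" for f
    using that by (auto simp: surjections_def PiE_def)
  have tin: "\<tau> i \<in> {1..n} \<longleftrightarrow> i \<in> {1..n}" "inv' \<tau> i \<in> {1..n} \<longleftrightarrow> i \<in> {1..n}" for i
    using permutes_in_image[OF t] permutes_in_image[OF permutes_inv[OF t]] by blast+
  have LM: "?L (?M f) = f" "?M (?L f) = f" if "f \<in> surjections n a" for f
    using ext[OF that] tin
    by (auto simp: fun_eq_iff compose_def extensional_def permutes_inverses[OF s] permutes_inverses[OF t]
        simp del: One_nat_def atLeastAtMost_iff)
  have "{g. g \<in> surjections n a \<and> ?L g = f} = (if f \<in> surjections n a then {?M f} else {})"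
    using LM surjections_comp[OF s t] surjections_comp[OF permutes_inv[OF s] permutes_inv[OF t]]
    by (auto simp del: One_nat_def)
  then show ?thesis unfolding linearize_def by simp
qed

text \<open>The partially defined map that is \<open>f\<close> on the first positions of the arrangement \<open>x\<close>.\<close>

definition transport :: "nat \<Rightarrow> (nat \<Rightarrow> nat) \<Rightarrow> (nat \<Rightarrow> nat) \<Rightarrow> nat \<Rightarrow> nat" where
  "transport n x f = (\<lambda>i. if inv' x i \<in> {1..n} then f (inv' x i) else 0)"

lemma transport_holes:
  assumes x: "x permutes {1..b}" and f: "f \<in> surjections n a" and nb: "n \<le> b"
  shows "holes b (transport n x f) = x ` {n + 1..b}"
proof -
  have f0: "f k \<noteq> 0" if "k \<in> {1..n}" for k using f that by (force simp: surjections_def)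
  have "i \<in> holes b (transport n x f) \<longleftrightarrow> inv' x i \<in> {n + 1..b}" for i
  proof -
    have "inv' x i \<in> {1..b} \<longleftrightarrow> i \<in> {1..b}" using permutes_in_image[OF permutes_inv[OF x]] .
    then show ?thesis using f0[of "inv' x i"] by (auto simp: holes_def transport_def)
  qed
  moreover have "inv' x i \<in> {n + 1..b} \<longleftrightarrow> i \<in> x ` {n + 1..b}" for i
    using permutes_inverses[OF x] by (metis image_iff)
  ultimately show ?thesis by blast
qed

lemma transport_cells:
  assumes x: "x permutes {1..b}" and f: "f \<in> surjections (b - t) a" and tb: "t \<le> b"
  shows "transport (b - t) x f \<in> cells b a a t"
proof -
  have "card (holes b (transport (b - t) x f)) = t"
    using transport_holes[OF x f] card_image[OF permutes_inj_on[OF x]] tb by simp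
  moreover have "transport (b - t) x f \<in> pmaps b a"
  proof -
    have "inv' x i \<notin> {1..b - t}" if "i \<notin> {1..b}" for i
      using permutes_not_in[OF permutes_inv[OF x] that] that by auto
    moreover have "f k \<le> a" if "k \<in> {1..b - t}" for k using f that by (auto simp: surjections_def)
    ultimately show ?thesis by (auto simp: pmaps_def transport_def)
  qed
  moreover have "{1..a} \<subseteq> range (transport (b - t) x f)"
  proof
    fix v assume "v \<in> {1..a}"
    then have "v \<in> f ` {1..b - t}" using f by (simp add: surjections_def)
    then obtain k where k: "k \<in> {1..b - t}" "v = f k" by blast
    then have "v = transport (b - t) x f (x k)" by (simp add: transport_def permutes_inverses[OF x])
    then show "v \<in> range (transport (b - t) x f)" by (rule range_eqI)
  qed
  ultimately show ?thesis by (simp add: cells_def covering_def)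
qed

lemma transport_restrict:
  assumes x: "x permutes {1..b}" and p: "p \<in> cells b a a t" and img: "x ` {b - t + 1..b} = holes b p"
    and tb: "t \<le> b"
  shows "transport (b - t) x (restrict (p \<circ> x) {1..b - t}) = p"
    and "restrict (p \<circ> x) {1..b - t} \<in> surjections (b - t) a"
proof -
  have pa: "p i \<le> a" "i \<notin> {1..b} \<Longrightarrow> p i = 0" for i using p by (auto simp: cells_def covering_def pmaps_def)
  have U: "p (x k) = 0 \<longleftrightarrow> k \<notin> {1..b - t}" for k
  proof (cases "k \<in> {1..b}")
    case True
    then have xk: "x k \<in> {1..b}" using permutes_in_image[OF x] by blast
    have "p (x k) = 0 \<longleftrightarrow> x k \<in> x ` {b - t + 1..b}" using xk unfolding img holes_def by simp
    also have "\<dots> \<longleftrightarrow> k \<in> {b - t + 1..b}" using permutes_inj[OF x] by (simp add: inj_image_mem_iff)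
    finally show ?thesis using True by auto
  next
    case False
    then show ?thesis using pa(2) permutes_not_in[OF x] by auto
  qed
  show "transport (b - t) x (restrict (p \<circ> x) {1..b - t}) = p"
  proof
    fix i
    have "p i = 0 \<longleftrightarrow> inv' x i \<notin> {1..b - t}" using U[of "inv' x i"] by (simp add: permutes_inverses[OF x])
    then show "transport (b - t) x (restrict (p \<circ> x) {1..b - t}) i = p i"
      by (auto simp: transport_def permutes_inverses[OF x])
  qed
  have "restrict (p \<circ> x) {1..b - t} ` {1..b - t} = {1..a}"
  proof (intro equalityI subsetI)
    fix v assume "v \<in> restrict (p \<circ> x) {1..b - t} ` {1..b - t}"
    then obtain k where "k \<in> {1..b - t}" "v = p (x k)" by auto
    then show "v \<in> {1..a}" using U[of k] pa(1)[of "x k"] by simp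
  next
    fix v assume v: "v \<in> {1..a}"
    then obtain i where i: "v = p i" using p by (auto simp: cells_def covering_def)
    then have "v = p (x (inv' x i))" by (simp add: permutes_inverses[OF x])
    then show "v \<in> restrict (p \<circ> x) {1..b - t} ` {1..b - t}"
      using v U[of "inv' x i"] by (intro image_eqI[of _ _ "inv' x i"]) auto
  qed
  then show "restrict (p \<circ> x) {1..b - t} \<in> surjections (b - t) a"
    by (auto simp: surjections_def PiE_iff simp del: One_nat_def)
qed

lemma block_sum_high:
  assumes "\<rho> permutes {1..t}" "n < i"
  shows "n < block_sum n (\<tau>, \<rho>) i"
proof -
  have "\<rho> (i - n) \<noteq> 0" using permutes_eq_zero[OF assms(1), of "i - n"] assms(2) by simp
  then show ?thesis using assms(2) by (simp add: block_sum_def)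
qed

lemma block_sum_image:
  assumes t: "\<tau> permutes {1..n}" and r: "\<rho> permutes {1..t}"
  shows "block_sum n (\<tau>, \<rho>) ` {n + 1..n + t} = {n + 1..n + t}"
proof (rule endo_inj_surj)
  note B = block_sum_permutes[OF t r]
  show "inj_on (block_sum n (\<tau>, \<rho>)) {n + 1..n + t}" by (rule permutes_inj_on[OF B])
  show "block_sum n (\<tau>, \<rho>) ` {n + 1..n + t} \<subseteq> {n + 1..n + t}"
  proof (rule image_subsetI)
    fix i assume i: "i \<in> {n + 1..n + t}"
    then have "block_sum n (\<tau>, \<rho>) i \<in> {1..n + t}" using permutes_in_image[OF B, of i] by auto
    then show "block_sum n (\<tau>, \<rho>) i \<in> {n + 1..n + t}" using block_sum_high[OF r, of n i \<tau>] i by simp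
  qed
qed simp

lemma ord_sign_block_sum:
  assumes t: "\<tau> permutes {1..n}" and r: "\<rho> permutes {1..t}"
  shows "ord_sign {n + 1..n + t} (block_sum n (\<tau>, \<rho>)) = of_int (sign \<rho>)"
proof -
  let ?s = "\<lambda>i. i + n" and ?B = "block_sum n (\<tau>, \<rho>)"
  have s1: "ord_sign T ?s = 1" for T by (rule ord_sign_mono) simp
  have inj: "inj_on ?s T" for T by (simp add: inj_on_def)
  have img: "?s ` {1..t} = {n + 1..n + t}" by (simp add: image_add_atLeastAtMost' add.commute)
  have "ord_sign {1..t} (?B \<circ> ?s) = ord_sign {1..t} ?s * ord_sign (?s ` {1..t}) ?B"
    by (intro ord_sign_comp inj permutes_inj_on[OF block_sum_permutes[OF t r]])
  also have "ord_sign {1..t} (?B \<circ> ?s) = ord_sign {1..t} (?s \<circ> \<rho>)"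
    by (rule ord_sign_cong) (auto simp: block_sum_def)
  also have "\<dots> = ord_sign {1..t} \<rho> * ord_sign (\<rho> ` {1..t}) ?s"
    by (intro ord_sign_comp inj permutes_inj_on[OF r])
  finally show ?thesis unfolding s1 img using sign_eq_ord_sign[OF r] by simp
qed

lemma block_sum_inverse_low:
  assumes t: "\<tau> permutes {1..n}" and r: "\<rho> permutes {1..t}"
  shows "inv' (block_sum n (\<tau>, \<rho>)) k \<in> {1..n} \<longleftrightarrow> k \<in> {1..n}"
    and "k \<in> {1..n} \<Longrightarrow> inv' (block_sum n (\<tau>, \<rho>)) k = inv' \<tau> k"
proof -
  let ?B = "block_sum n (\<tau>, \<rho>)"
  note B = block_sum_permutes[OF t r]
  have low: "?B i = \<tau> i" if "i \<in> {1..n}" for i using that by (simp add: block_sum_def)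
  show *: "inv' ?B k = inv' \<tau> k" if "k \<in> {1..n}" for k
  proof -
    have "inv' \<tau> k \<in> {1..n}" using that permutes_in_image[OF permutes_inv[OF t]] by blast
    then have "?B (inv' \<tau> k) = k" using low permutes_inverses(1)[OF t] by simp
    then show ?thesis using permutes_inverses(2)[OF B] by metis
  qed
  show "inv' ?B k \<in> {1..n} \<longleftrightarrow> k \<in> {1..n}"
  proof
    assume i: "inv' ?B k \<in> {1..n}"
    then have "\<tau> (inv' ?B k) \<in> {1..n}" using permutes_in_image[OF t] by blast
    then show "k \<in> {1..n}" using low[OF i] permutes_inverses(1)[OF B] by simp
  next
    assume k: "k \<in> {1..n}"
    then show "inv' ?B k \<in> {1..n}" using *[OF k] permutes_in_image[OF permutes_inv[OF t]] by metis
  qed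
qed

text \<open>The stabiliser of the last \<open>t\<close> places is the Young subgroup along which the induction takes place.\<close>

lemma block_sum_decomp:
  assumes y: "y permutes {1..n + t}" and img: "y ` {n + 1..n + t} = {n + 1..n + t}"
  shows "\<exists>\<tau> \<rho>. \<tau> permutes {1..n} \<and> \<rho> permutes {1..t} \<and> y = block_sum n (\<tau>, \<rho>)"
proof -
  define \<tau> where "\<tau> = (\<lambda>i. if i \<in> {1..n} then y i else i)"
  define \<rho> where "\<rho> = (\<lambda>i. if i \<in> {1..t} then y (i + n) - n else i)"
  have high: "y i \<in> {n + 1..n + t} \<longleftrightarrow> i \<in> {n + 1..n + t}" for i
    using img permutes_inj[OF y] by (metis inj_image_mem_iff)
  have low: "y i \<in> {1..n} \<longleftrightarrow> i \<in> {1..n}" for i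
    using high[of i] permutes_in_image[OF y, of i] by auto
  have "\<tau> permutes {1..n}"
  proof (rule bij_imp_permutes)
    have "\<tau> ` {1..n} = {1..n}"
      by (rule endo_inj_surj) (use low permutes_inj_on[OF y] in \<open>auto simp: \<tau>_def inj_on_def\<close>)
    moreover have "inj_on \<tau> {1..n}"
      using permutes_inj_on[OF y, of "{1..n}"] by (subst inj_on_cong[of _ \<tau> y]) (simp_all add: \<tau>_def)
    ultimately show "bij_betw \<tau> {1..n} {1..n}" by (simp add: bij_betw_def)
  qed (auto simp: \<tau>_def)
  moreover have "\<rho> permutes {1..t}"
  proof (rule bij_imp_permutes)
    have yh: "y (i + n) \<in> {n + 1..n + t}" if "i \<in> {1..t}" for i using high[of "i + n"] that by auto
    have inj: "inj_on \<rho> {1..t}"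
    proof (rule inj_onI)
      fix i j assume ij: "i \<in> {1..t}" "j \<in> {1..t}" "\<rho> i = \<rho> j"
      then have "y (i + n) = y (j + n)" using yh[of i] yh[of j] by (auto simp: \<rho>_def)
      then have "i + n = j + n" by (rule injD[OF permutes_inj[OF y]])
      then show "i = j" by simp
    qed
    moreover have "\<rho> ` {1..t} \<subseteq> {1..t}" using yh by (force simp: \<rho>_def)
    ultimately have "\<rho> ` {1..t} = {1..t}" by (intro endo_inj_surj) auto
    then show "bij_betw \<rho> {1..t} {1..t}" using inj by (simp add: bij_betw_def)
  qed (auto simp: \<rho>_def)
  moreover have "y = block_sum n (\<tau>, \<rho>)"
  proof
    fix i
    consider "i = 0" | "i \<in> {1..n}" | "i \<in> {n + 1..n + t}" | "i > n + t" by force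
    then show "y i = block_sum n (\<tau>, \<rho>) i"
    proof cases
      case 1 then show ?thesis using permutes_not_in[OF y, of 0] by (simp add: block_sum_def \<tau>_def)
    next
      case 2 then show ?thesis by (simp add: block_sum_def \<tau>_def)
    next
      case 3
      then have "i - n \<in> {1..t}" "i - n + n = i" "n < i" by auto
      moreover have "n \<le> y i" using high[of i] 3 by simp
      ultimately show ?thesis by (auto simp: block_sum_def \<rho>_def)
    next
      case 4
      then have "y i = i" using permutes_not_in[OF y, of i] by simp
      then show ?thesis using 4 by (simp add: block_sum_def \<rho>_def)
    qed
  qed
  ultimately show ?thesis by blast
qed

text \<open>A cell with its undefined positions is the class of an arrangement of \<open>{1..b}\<close> followed by a
  surjection on the first \<open>b - t\<close> places; the sign of the arrangement on the last \<open>t\<close> places absorbs the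
  sign representation.\<close>

definition spread :: "nat \<Rightarrow> nat \<Rightarrow> nat \<Rightarrow> ((nat \<Rightarrow> nat) \<Rightarrow> rat) \<Rightarrow> (nat \<Rightarrow> nat) \<Rightarrow> (nat \<Rightarrow> nat) \<Rightarrow> rat" where
  "spread a b t \<Phi> = (\<lambda>x f. if x permutes {1..b} \<and> f \<in> surjections (b - t) a
     then ord_sign {b - t + 1..b} x * \<Phi> (transport (b - t) x f) else 0)"

text \<open>The equivariance condition and the action of the induced representation, with the opposite groups
  and their products multiplied out.\<close>

lemma induced_surj_space:
  "F \<in> rspace (induced_surj_rep a b t) \<longleftrightarrow>
    (\<forall>x. \<not> x permutes {1..b} \<longrightarrow> F x = 0) \<and>
    (\<forall>x. x permutes {1..b} \<longrightarrow> F x \<in> free_module (surjections (b - t) a)) \<and>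
    (\<forall>\<tau> \<rho> x. \<tau> permutes {1..b - t} \<longrightarrow> \<rho> permutes {1..t} \<longrightarrow> x permutes {1..b} \<longrightarrow>
      F (x \<circ> block_sum (b - t) (\<tau>, \<rho>)) = of_int (sign \<rho>) *Q
        linearize (surjections (b - t) a) (\<lambda>f. compose {1..b - t} id (compose {1..b - t} f \<tau>)) (F x))"
  unfolding induced_surj_rep_def induced_rep_def
  by (auto simp: op_group_def sym_group_def surj_sgn_rep_def simp del: One_nat_def)

lemma induced_surj_act:
  "ract (induced_surj_rep a b t) (\<sigma>, y) F x = (if x permutes {1..b}
     then linearize (surjections (b - t) a) (\<lambda>f. compose {1..b - t} \<sigma> (compose {1..b - t} f id)) (F (y \<circ> x)) else 0)"
  unfolding induced_surj_rep_def induced_rep_def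
  by (auto simp: op_group_def sym_group_def surj_sgn_rep_def scaleQ_one simp del: One_nat_def)


text \<open>Each cell arises from some arrangement, and two arrangements giving the same undefined positions differ
  by a block permutation, so an equivariant function on arrangements is the same as a function on cells.\<close>

theorem cell_rep_iso_induced:
  assumes tb: "t \<le> b"
  shows "rep_iso (sym_bigroup a b) (cell_rep a b t) (induced_surj_rep a b t)"
proof -
  define n where "n = b - t"
  have nb: "n + t = b" "b - t = n" using tb by (simp_all add: n_def)
  let ?L = "{n + 1..b}" and ?C = "cells b a a t" and ?S = "surjections n a" and ?I = "induced_surj_rep a b t"
  note space = induced_surj_space[of _ a b t, unfolded nb]
  note spread_n = spread_def[of a b t, unfolded nb]
  note cells_n = transport_cells[OF _ _ tb, unfolded nb]
  have closed: "spread a b t \<Phi> \<in> rspace ?I" for \<Phi>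
    unfolding space
  proof (intro conjI allI impI)
    show "spread a b t \<Phi> x = 0" if "\<not> x permutes {1..b}" for x
      using that by (simp add: spread_n fun_eq_iff)
    show "spread a b t \<Phi> x \<in> free_module ?S" for x by (simp add: spread_n free_module_def)
    fix \<tau> \<rho> x assume t: "\<tau> permutes {1..n}" and r: "\<rho> permutes {1..t}" and x: "x permutes {1..b}"
    let ?B = "block_sum n (\<tau>, \<rho>)"
    have B: "?B permutes {1..b}" using block_sum_permutes[OF t r] nb by simp
    have xB: "x \<circ> ?B permutes {1..b}" by (rule permutes_compose[OF B x])
    have sgn: "ord_sign ?L (x \<circ> ?B) = of_int (sign \<rho>) * ord_sign ?L x"
      using ord_sign_comp[OF permutes_inj_on[OF B] permutes_inj_on[OF x], of ?L]
        block_sum_image[OF t r] ord_sign_block_sum[OF t r] by (simp only: nb)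
    show "spread a b t \<Phi> (x \<circ> ?B) = of_int (sign \<rho>) *Q
        linearize ?S (\<lambda>f. compose {1..n} id (compose {1..n} f \<tau>)) (spread a b t \<Phi> x)"
    proof
      fix f :: "nat \<Rightarrow> nat"
      let ?f = "compose {1..n} (inv' id) (compose {1..n} f (inv' \<tau>))"
      have "spread a b t \<Phi> (x \<circ> ?B) f = of_int (sign \<rho>) * spread a b t \<Phi> x ?f" if f: "f \<in> ?S"
      proof -
        have f': "?f \<in> ?S"
          by (rule surjections_comp[OF permutes_inv[OF permutes_id] permutes_inv[OF t] f])
        have "inv' (x \<circ> ?B) = inv' ?B \<circ> inv' x"
          using permutes_bij[OF x] permutes_bij[OF B] by (rule o_inv_distrib)
        moreover have "f (inv' ?B k) = ?f k" if k: "k \<in> {1..n}" for k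
          unfolding block_sum_inverse_low(2)[OF t r k] using k by (simp add: compose_def del: One_nat_def)
        ultimately have "transport n (x \<circ> ?B) f = transport n x ?f"
          using block_sum_inverse_low(1)[OF t r] by (simp add: transport_def fun_eq_iff del: One_nat_def atLeastAtMost_iff)
        then show ?thesis using f f' x xB sgn by (simp add: spread_n mult.assoc)
      qed
      moreover have "spread a b t \<Phi> (x \<circ> ?B) f = 0" if "f \<notin> ?S" using that by (simp add: spread_n)
      ultimately show "spread a b t \<Phi> (x \<circ> ?B) f = (of_int (sign \<rho>) *Q
          linearize ?S (\<lambda>f. compose {1..n} id (compose {1..n} f \<tau>)) (spread a b t \<Phi> x)) f"
        unfolding scaleQ_fun_apply linearize_surjections[OF permutes_id t] by (cases "f \<in> ?S") simp_all
    qed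
  qed
  have lin: "linear_on (free_module ?C) (rspace ?I) (spread a b t)"
    using closed by (auto simp: linear_on_def spread_n fun_eq_iff algebra_simps)
  have equi: "spread a b t (ract (cell_rep a b t) (\<sigma>, y) \<Phi>) = ract ?I (\<sigma>, y) (spread a b t \<Phi>)"
    if s: "\<sigma> permutes {1..a}" and y: "y permutes {1..b}" for \<sigma> y \<Phi>
  proof (intro ext)
    fix x f :: "nat \<Rightarrow> nat"
    let ?f = "compose {1..n} (inv' \<sigma>) (compose {1..n} f (inv' id))"
    show "spread a b t (ract (cell_rep a b t) (\<sigma>, y) \<Phi>) x f = ract ?I (\<sigma>, y) (spread a b t \<Phi>) x f"
    proof (cases "x permutes {1..b} \<and> f \<in> ?S")
      case True
      then have x: "x permutes {1..b}" and f: "f \<in> ?S" by auto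
      have f': "?f \<in> ?S"
        by (rule surjections_comp[OF permutes_inv[OF s] permutes_inv[OF permutes_id] f])
      have yx: "y \<circ> x permutes {1..b}" by (rule permutes_compose[OF x y])
      have "inv' (y \<circ> x) = inv' x \<circ> inv' y"
        using permutes_bij[OF y] permutes_bij[OF x] by (rule o_inv_distrib)
      moreover have "inv' \<sigma> 0 = 0" by (rule permutes_zero[OF permutes_inv[OF s]])
      ultimately have "inv' \<sigma> \<circ> transport n x f \<circ> inv' y = transport n (y \<circ> x) ?f"
        by (auto simp: transport_def fun_eq_iff compose_def simp del: One_nat_def atLeastAtMost_iff)
      moreover have "holes b (transport n x f) = x ` ?L" using transport_holes[OF x f] nb by simp
      moreover have "ord_sign ?L (y \<circ> x) = ord_sign ?L x * ord_sign (x ` ?L) y"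
        by (intro ord_sign_comp permutes_inj_on[OF x] permutes_inj_on[OF y])
      ultimately have "spread a b t (ract (cell_rep a b t) (\<sigma>, y) \<Phi>) x f = spread a b t \<Phi> (y \<circ> x) ?f"
        using x f f' yx by (simp add: spread_n cell_rep_act mult.assoc)
      then show ?thesis
        unfolding induced_surj_act nb linearize_surjections[OF s permutes_id] using x f by simp
    next
      case False
      then show ?thesis
        unfolding induced_surj_act nb linearize_surjections[OF s permutes_id] by (auto simp: spread_n)
    qed
  qed
  have arr: "\<exists>x. x permutes {1..b} \<and> x ` ?L = holes b p" if "p \<in> ?C" for p
    by (rule finite_image_cong_perm) (use that nb in \<open>auto simp: cells_def holes_def\<close>)
  note recover = transport_restrict[OF _ _ _ tb, unfolded nb]
  have "inj_on (spread a b t) (free_module ?C)"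
  proof (rule inj_onI)
    fix \<Phi> \<Phi>' assume 1: "\<Phi> \<in> free_module ?C" and 2: "\<Phi>' \<in> free_module ?C" and eq: "spread a b t \<Phi> = spread a b t \<Phi>'"
    show "\<Phi> = \<Phi>'"
    proof
      fix p show "\<Phi> p = \<Phi>' p"
      proof (cases "p \<in> ?C")
        case True
        obtain x where x: "x permutes {1..b}" "x ` ?L = holes b p" using arr[OF True] by blast
        have "spread a b t \<Psi> x (restrict (p \<circ> x) {1..n}) = ord_sign ?L x * \<Psi> p" for \<Psi>
          using x(1) recover[OF x(1) True x(2)] by (simp add: spread_n del: One_nat_def)
        then have "ord_sign ?L x * \<Phi> p = ord_sign ?L x * \<Phi>' p" using eq by metis
        then show ?thesis using ord_sign_square[of ?L x] by auto
      next
        case False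
        then show ?thesis using 1 2 by (simp add: free_module_def)
      qed
    qed
  qed
  moreover have "rspace ?I \<subseteq> spread a b t ` free_module ?C"
  proof
    fix F assume "F \<in> rspace ?I"
    note F = this[unfolded space]
    have F0: "F x = 0" if "\<not> x permutes {1..b}" for x using F that by blast
    have FS: "F x \<in> free_module ?S" if "x permutes {1..b}" for x using F that by blast
    have FB: "F (x \<circ> block_sum n (\<tau>, \<rho>)) = of_int (sign \<rho>) *Q
        linearize ?S (\<lambda>f. compose {1..n} id (compose {1..n} f \<tau>)) (F x)"
      if "\<tau> permutes {1..n}" "\<rho> permutes {1..t}" "x permutes {1..b}" for \<tau> \<rho> x
      using F that by blast
    define X where "X = (\<lambda>p. SOME x. x permutes {1..b} \<and> x ` ?L = holes b p)"
    have X: "X p permutes {1..b}" "X p ` ?L = holes b p" if "p \<in> ?C" for p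
      using someI_ex[OF arr[OF that]] unfolding X_def by blast+
    define \<Phi> where "\<Phi> = (\<lambda>p. if p \<in> ?C then ord_sign ?L (X p) * F (X p) (restrict (p \<circ> X p) {1..n}) else 0)"
    have "\<Phi> \<in> free_module ?C" by (simp add: \<Phi>_def free_module_def)
    moreover have "F = spread a b t \<Phi>"
    proof (intro ext)
      fix x f
      show "F x f = spread a b t \<Phi> x f"
      proof (cases "x permutes {1..b} \<and> f \<in> ?S")
        case True
        then have x: "x permutes {1..b}" and f: "f \<in> ?S" by auto
        let ?p = "transport n x f"
        have p: "?p \<in> ?C" by (rule cells_n[OF x f])
        let ?y = "inv' x \<circ> X ?p"
        have "?y permutes {1..b}" by (rule permutes_compose[OF X(1)[OF p] permutes_inv[OF x]])
        moreover have "?y ` ?L = ?L"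
        proof -
          have "?y ` ?L = inv' x ` X ?p ` ?L" by (rule image_comp[symmetric])
          also have "X ?p ` ?L = x ` ?L" using X(2)[OF p] transport_holes[OF x f] nb by simp
          finally show ?thesis by (simp only: image_inv_f_f[OF permutes_inj[OF x]])
        qed
        ultimately obtain \<tau> \<rho> where tr: "\<tau> permutes {1..n}" "\<rho> permutes {1..t}" and y: "?y = block_sum n (\<tau>, \<rho>)"
          using block_sum_decomp[of ?y n t] nb by auto
        \<comment> \<open>The chosen arrangement differs from \<open>x\<close> by a block permutation, under which \<open>F\<close> is equivariant.\<close>
        have Xp: "X ?p = x \<circ> block_sum n (\<tau>, \<rho>)"
          unfolding y[symmetric] by (simp add: fun_eq_iff permutes_inverses[OF x])
        have B: "block_sum n (\<tau>, \<rho>) permutes {1..b}" using block_sum_permutes[OF tr] nb by simp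
        have sgn: "ord_sign ?L (X ?p) = of_int (sign \<rho>) * ord_sign ?L x"
          using ord_sign_comp[OF permutes_inj_on[OF B] permutes_inj_on[OF x], of ?L]
            block_sum_image[OF tr] ord_sign_block_sum[OF tr] unfolding Xp by (simp only: nb)
        let ?g = "restrict (?p \<circ> X ?p) {1..n}"
        have g: "?g \<in> ?S" using recover(2)[OF X(1)[OF p] p X(2)[OF p]] .
        have "compose {1..n} (inv' id) (compose {1..n} ?g (inv' \<tau>)) = f"
        proof
          fix i
          show "compose {1..n} (inv' id) (compose {1..n} ?g (inv' \<tau>)) i = f i"
          proof (cases "i \<in> {1..n}")
            case True
            have k: "inv' \<tau> i \<in> {1..n}" using True permutes_in_image[OF permutes_inv[OF tr(1)]] by blast
            then have "block_sum n (\<tau>, \<rho>) (inv' \<tau> i) = i"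
              by (simp add: block_sum_def permutes_inverses[OF tr(1)])
            then have "X ?p (inv' \<tau> i) = x i" by (simp add: Xp)
            then have "?g (inv' \<tau> i) = f i"
              using k True by (simp add: transport_def permutes_inverses[OF x] del: One_nat_def atLeastAtMost_iff)
            then show ?thesis using True by (simp add: compose_def del: One_nat_def atLeastAtMost_iff)
          next
            case False
            have "f i = undefined" using f False by (auto simp: surjections_def PiE_def extensional_def)
            then show ?thesis using False by (simp add: compose_def del: One_nat_def atLeastAtMost_iff)
          qed
        qed
        then have "F (X ?p) ?g = of_int (sign \<rho>) * F x f"
          unfolding Xp FB[OF tr x] scaleQ_fun_apply linearize_surjections[OF permutes_id tr(1)]
          using g by (simp add: Xp del: One_nat_def)
        moreover have "spread a b t \<Phi> x f = ord_sign ?L x * (ord_sign ?L (X ?p) * F (X ?p) ?g)"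
          using x f p by (simp add: spread_n \<Phi>_def del: One_nat_def)
        ultimately have "spread a b t \<Phi> x f
            = (ord_sign ?L x * ord_sign ?L x) * (of_int (sign \<rho>) * of_int (sign \<rho>)) * F x f"
          unfolding sgn by (simp only: mult_ac)
        then show ?thesis by (simp add: ord_sign_square flip: of_int_mult)
      next
        case False
        then have "F x f = 0"
        proof (cases "x permutes {1..b}")
          case True
          then show ?thesis using False FS by (simp add: free_module_def)
        qed (simp add: F0)
        then show ?thesis using False by (auto simp: spread_n)
      qed
    qed
    ultimately show "F \<in> spread a b t ` free_module ?C" by blast
  qed
  ultimately have "bij_betw (spread a b t) (free_module ?C) (rspace ?I)"
    using closed by (auto simp: bij_betw_def)
  moreover have "spread a b t \<in> rep_hom (sym_bigroup a b) (cell_rep a b t) ?I"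
    unfolding rep_hom_def
  proof (intro CollectI conjI ballI)
    show "linear_on (rspace (cell_rep a b t)) (rspace ?I) (spread a b t)"
      using lin by (simp add: cell_rep_def)
    fix g \<Phi> assume g: "g \<in> carrier (sym_bigroup a b)"
    obtain \<sigma> y where gd: "g = (\<sigma>, y)" by (cases g)
    show "spread a b t (ract (cell_rep a b t) g \<Phi>) = ract ?I g (spread a b t \<Phi>)"
      using g equi unfolding gd sym_bigroup_simps by blast
  qed
  ultimately show ?thesis unfolding rep_iso_def by (auto simp: cell_rep_def)
qed

section \<open>Exact sequences and classes in the Grothendieck group\<close>

lemma fd_repD:
  assumes "fd_rep G V"
  shows "Q.subspace (rspace V)" "g \<in> carrier G \<Longrightarrow> v \<in> rspace V \<Longrightarrow> ract V g v \<in> rspace V"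
proof -
  show "Q.subspace (rspace V)" using assms unfolding fd_rep_def by (metis Q.subspace_span)
  show "g \<in> carrier G \<Longrightarrow> v \<in> rspace V \<Longrightarrow> ract V g v \<in> rspace V"
    using assms unfolding fd_rep_def linear_on_def by blast
qed

lemma rep_homD:
  assumes "f \<in> rep_hom G V W"
  shows "v \<in> rspace V \<Longrightarrow> f v \<in> rspace W"
    and "v \<in> rspace V \<Longrightarrow> w \<in> rspace V \<Longrightarrow> f (v + w) = f v + f w"
    and "v \<in> rspace V \<Longrightarrow> f (c *Q v) = c *Q f v"
    and "g \<in> carrier G \<Longrightarrow> v \<in> rspace V \<Longrightarrow> f (ract V g v) = ract W g (f v)"
  using assms unfolding rep_hom_def linear_on_def by auto

lemma rep_homI:
  assumes "\<And>v. v \<in> rspace V \<Longrightarrow> f v \<in> rspace W"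
    and "\<And>v w. v \<in> rspace V \<Longrightarrow> w \<in> rspace V \<Longrightarrow> f (v + w) = f v + f w"
    and "\<And>c v. v \<in> rspace V \<Longrightarrow> f (c *Q v) = c *Q f v"
    and "\<And>g v. g \<in> carrier G \<Longrightarrow> v \<in> rspace V \<Longrightarrow> f (ract V g v) = ract W g (f v)"
  shows "f \<in> rep_hom G V W"
  using assms unfolding rep_hom_def linear_on_def by auto

lemma rep_hom_zero:
  assumes "f \<in> rep_hom G V W" "fd_rep G V"
  shows "f 0 = 0"
  using rep_homD(3)[OF assms(1) Q.subspace_0[OF fd_repD(1)[OF assms(2)]], of 0] by simp

lemma rep_hom_comp:
  assumes "f \<in> rep_hom G U V" "h \<in> rep_hom G V W"
  shows "(\<lambda>u. h (f u)) \<in> rep_hom G U W"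
  by (rule rep_homI) (simp_all add: rep_homD[OF assms(1)] rep_homD[OF assms(2)])

lemma rep_hom_inverse:
  assumes f: "f \<in> rep_hom G V W" and bij: "bij_betw f (rspace V) (rspace W)" and V: "fd_rep G V"
  shows "the_inv_into (rspace V) f \<in> rep_hom G W V"
proof (rule rep_homI)
  let ?i = "the_inv_into (rspace V) f"
  have inj: "inj_on f (rspace V)" and im: "f ` rspace V = rspace W" using bij by (auto simp: bij_betw_def)
  note i = the_inv_into_f_f[OF inj]
  note sub = fd_repD[OF V]
  fix w assume "w \<in> rspace W"
  then obtain v where v: "v \<in> rspace V" "w = f v" using im by blast
  show "?i w \<in> rspace V" using v i by simp
  have "?i (f (c *Q v)) = c *Q v" for c using v Q.subspace_scale[OF sub(1)] i by blast
  then show "?i (c *Q w) = c *Q ?i w" for c using v i by (simp add: rep_homD(3)[OF f])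
  have "?i (f (ract V g v)) = ract V g v" if "g \<in> carrier G" for g using v sub(2) that i by blast
  then show "?i (ract W g w) = ract V g (?i w)" if "g \<in> carrier G" for g
    using v i that by (simp add: rep_homD(4)[OF f])
  fix w' assume "w' \<in> rspace W"
  then obtain v' where v': "v' \<in> rspace V" "w' = f v'" using im by blast
  have "?i (f (v + v')) = v + v'" using v v' Q.subspace_add[OF sub(1)] i by blast
  then show "?i (w + w') = ?i w + ?i w'" using v v' i by (simp add: rep_homD(2)[OF f])
qed

lemma rep_iso_sym: "rep_iso G V W \<Longrightarrow> fd_rep G V \<Longrightarrow> rep_iso G W V"
  unfolding rep_iso_def using rep_hom_inverse bij_betw_the_inv_into by blast

lemma short_exact_iso:
  assumes ex: "short_exact G U V W"
    and U: "rep_iso G U U'" "fd_rep G U" and V: "rep_iso G V V'" "fd_rep G V" and W: "rep_iso G W W'" "fd_rep G W"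
  shows "short_exact G U' V' W'"
proof -
  obtain i p where i: "i \<in> rep_hom G U V" and p: "p \<in> rep_hom G V W" and inj: "inj_on i (rspace U)"
    and surj: "p ` rspace V = rspace W" and mid: "i ` rspace U = {v \<in> rspace V. p v = 0}"
    using ex unfolding short_exact_def by blast
  obtain \<alpha> where \<alpha>: "\<alpha> \<in> rep_hom G U' U" "bij_betw \<alpha> (rspace U') (rspace U)"
    using rep_iso_sym[OF U] unfolding rep_iso_def by blast
  obtain \<beta> where \<beta>: "\<beta> \<in> rep_hom G V V'" "bij_betw \<beta> (rspace V) (rspace V')"
    using V unfolding rep_iso_def by blast
  define \<beta>' where "\<beta>' = the_inv_into (rspace V) \<beta>"
  have \<beta>': "\<beta>' \<in> rep_hom G V' V" "bij_betw \<beta>' (rspace V') (rspace V)"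
    unfolding \<beta>'_def by (rule rep_hom_inverse[OF \<beta> V(2)]) (rule bij_betw_the_inv_into[OF \<beta>(2)])
  have \<beta>\<beta>': "\<beta>' (\<beta> v) = v" if "v \<in> rspace V" for v
    unfolding \<beta>'_def using \<beta>(2) that by (intro the_inv_into_f_f) (auto simp: bij_betw_def)
  obtain \<gamma> where \<gamma>: "\<gamma> \<in> rep_hom G W W'" "bij_betw \<gamma> (rspace W) (rspace W')"
    using W unfolding rep_iso_def by blast
  have \<gamma>0: "\<gamma> w = 0 \<longleftrightarrow> w = 0" if "w \<in> rspace W" for w
    using \<gamma>(2) that rep_hom_zero[OF \<gamma>(1) W(2)] Q.subspace_0[OF fd_repD(1)[OF W(2)]]
    unfolding bij_betw_def by (metis inj_onD)
  let ?i = "\<lambda>u. \<beta> (i (\<alpha> u))" and ?p = "\<lambda>v. \<gamma> (p (\<beta>' v))"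
  show ?thesis
    unfolding short_exact_def
  proof (intro bexI conjI)
    show "?i \<in> rep_hom G U' V'" by (intro rep_hom_comp[OF rep_hom_comp[OF \<alpha>(1) i] \<beta>(1)])
    show "?p \<in> rep_hom G V' W'" by (intro rep_hom_comp[OF rep_hom_comp[OF \<beta>'(1) p] \<gamma>(1)])
    have \<alpha>im: "\<alpha> ` rspace U' = rspace U" and \<beta>im: "\<beta> ` rspace V = rspace V'" "\<beta>' ` rspace V' = rspace V"
      and \<gamma>im: "\<gamma> ` rspace W = rspace W'"
      using \<alpha>(2) \<beta>(2) \<beta>'(2) \<gamma>(2) by (auto simp: bij_betw_def)
    show "inj_on ?i (rspace U')"
    proof (rule inj_onI)
      fix u v assume uv: "u \<in> rspace U'" "v \<in> rspace U'" "?i u = ?i v"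
      have U: "\<alpha> u \<in> rspace U" "\<alpha> v \<in> rspace U" using rep_homD(1)[OF \<alpha>(1)] uv by blast+
      then have "i (\<alpha> u) = i (\<alpha> v)"
        using inj_onD[OF bij_betw_imp_inj_on[OF \<beta>(2)] uv(3)] rep_homD(1)[OF i] by blast
      then have "\<alpha> u = \<alpha> v" using inj_onD[OF inj] U by blast
      then show "u = v" using inj_onD[OF bij_betw_imp_inj_on[OF \<alpha>(2)]] uv by blast
    qed
    have "?p ` rspace V' = \<gamma> ` p ` \<beta>' ` rspace V'" by (simp add: image_image)
    then show "?p ` rspace V' = rspace W'" by (simp only: \<beta>im surj \<gamma>im)
    have "?i ` rspace U' = \<beta> ` i ` \<alpha> ` rspace U'" by (simp add: image_image)
    also have "\<dots> = \<beta> ` {v \<in> rspace V. p v = 0}" by (simp only: \<alpha>im mid)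
    also have "\<dots> = {v \<in> rspace V'. ?p v = 0}"
    proof -
      have "?p (\<beta> v) = 0 \<longleftrightarrow> p v = 0" if "v \<in> rspace V" for v
        using \<gamma>0[of "p v"] rep_homD(1)[OF p that] by (simp add: \<beta>\<beta>'[OF that])
      then show ?thesis unfolding \<beta>im(1)[symmetric] by blast
    qed
    finally show "?i ` rspace U' = {v \<in> rspace V'. ?p v = 0}" .
  qed
qed

text \<open>The class of a representation is that of a chosen model on a fixed type; the short exact sequence is
  carried over to the models, where it is one of the defining relations.\<close>

lemma rep_class_exact:
  fixes U :: "('g, 'u::rat_vector) rep" and V :: "('g, 'v::rat_vector) rep" and W :: "('g, 'w::rat_vector) rep"
  assumes ex: "short_exact G U V W" and fd: "fd_rep G U" "fd_rep G V" "fd_rep G W"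
  shows "rep_class G V = rep_class G U \<otimes>\<^bsub>grothendieck_group G\<^esub> rep_class G W"
proof -
  let ?F = "free_Abelian_group (fd_reps G)" and ?R = "exact_relations G"
  interpret F: comm_group ?F by (rule abelian_free_Abelian_group)
  have sub: "subgroup ?R ?F" by (rule subgroup_exact_relations)
  interpret N: normal ?R ?F by (rule F.subgroup_imp_normal[OF sub])
  define U' where "U' = (SOME X. X \<in> fd_reps G \<and> rep_iso G U X)"
  define V' where "V' = (SOME X. X \<in> fd_reps G \<and> rep_iso G V X)"
  define W' where "W' = (SOME X. X \<in> fd_reps G \<and> rep_iso G W X)"
  have U': "U' \<in> fd_reps G" "rep_iso G U U'" unfolding U'_def using someI_ex[OF fd_rep_model[OF fd(1)]] by blast+
  have V': "V' \<in> fd_reps G" "rep_iso G V V'" unfolding V'_def using someI_ex[OF fd_rep_model[OF fd(2)]] by blast+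
  have W': "W' \<in> fd_reps G" "rep_iso G W W'" unfolding W'_def using someI_ex[OF fd_rep_model[OF fd(3)]] by blast+
  have "short_exact G U' V' W'"
    by (rule short_exact_iso[OF ex U'(2) fd(1) V'(2) fd(2) W'(2) fd(3)])
  then have rel: "frag_of V' - frag_of U' - frag_of W' \<in> ?R"
    unfolding exact_relations_def using U' V' W' by (intro generate.incl) blast
  have car: "frag_of U' \<in> carrier ?F" "frag_of V' \<in> carrier ?F" "frag_of W' \<in> carrier ?F"
    using U' V' W' by (simp_all add: keys_frag_of)
  have "frag_of V' = (frag_of V' - frag_of U' - frag_of W') \<otimes>\<^bsub>?F\<^esub> (frag_of U' \<otimes>\<^bsub>?F\<^esub> frag_of W')"
    by simp
  then have "frag_of V' \<in> ?R #>\<^bsub>?F\<^esub> (frag_of U' \<otimes>\<^bsub>?F\<^esub> frag_of W')"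
    using rel unfolding r_coset_def by blast
  then have "?R #>\<^bsub>?F\<^esub> frag_of V' = ?R #>\<^bsub>?F\<^esub> (frag_of U' \<otimes>\<^bsub>?F\<^esub> frag_of W')"
    using F.repr_independence[OF _ F.m_closed[OF car(1,3)] sub] by metis
  also have "\<dots> = (?R #>\<^bsub>?F\<^esub> frag_of U') <#>\<^bsub>?F\<^esub> (?R #>\<^bsub>?F\<^esub> frag_of W')"
    by (rule N.rcos_sum[symmetric]) (use car in auto)
  finally show ?thesis
    unfolding rep_class_def U'_def[symmetric] V'_def[symmetric] W'_def[symmetric]
    by (simp add: grothendieck_group_def FactGroup_def)
qed

text \<open>An isomorphism is a short exact sequence with third term zero, and the class of the zero
  representation is idempotent.\<close>

lemma rep_class_iso:
  fixes V :: "('g, 'v::rat_vector) rep" and W :: "('g, 'w::rat_vector) rep"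
  assumes iso: "rep_iso G V W" and fd: "fd_rep G V" "fd_rep G W"
  shows "rep_class G V = rep_class G W"
proof -
  let ?K = "grothendieck_group G"
  interpret K: comm_group ?K by (rule comm_group_grothendieck)
  define Z :: "('g, rat) rep" where "Z = \<lparr>rspace = {0}, ract = \<lambda>_ _. 0\<rparr>"
  have "fd_rep G Z"
    unfolding fd_rep_def Z_def by (auto simp: linear_on_def intro!: exI[of _ "{}"])
  have "(\<lambda>x. x) \<in> rep_hom G Z Z" by (auto simp: Z_def intro!: rep_homI)
  then have "short_exact G Z Z Z" unfolding short_exact_def by (auto simp: Z_def)
  then have "rep_class G Z = rep_class G Z \<otimes>\<^bsub>?K\<^esub> rep_class G Z"
    using \<open>fd_rep G Z\<close> by (intro rep_class_exact)
  then have Z1: "rep_class G Z = \<one>\<^bsub>?K\<^esub>"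
    using K.l_cancel_one'[OF rep_class_closed rep_class_closed, OF \<open>fd_rep G Z\<close> \<open>fd_rep G Z\<close>] by simp
  obtain f where f: "f \<in> rep_hom G V W" "bij_betw f (rspace V) (rspace W)" using iso unfolding rep_iso_def by blast
  have "(\<lambda>_. 0) \<in> rep_hom G W Z" by (auto simp: Z_def intro!: rep_homI)
  moreover have "(\<lambda>_. 0 :: rat) ` rspace W = {0}" using Q.subspace_0[OF fd_repD(1)[OF fd(2)]] by blast
  ultimately have "short_exact G V W Z"
    unfolding short_exact_def using f by (intro bexI[of _ f] bexI[of _ "\<lambda>_. 0"]) (auto simp: Z_def bij_betw_def)
  then have "rep_class G W = rep_class G V \<otimes>\<^bsub>?K\<^esub> rep_class G Z"
    using fd \<open>fd_rep G Z\<close> by (intro rep_class_exact)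
  then show ?thesis using Z1 rep_class_closed[OF fd(1)] by simp
qed

definition kernel_rep :: "('g, 'v::rat_vector) rep \<Rightarrow> ('v \<Rightarrow> 'w::rat_vector) \<Rightarrow> ('g, 'v) rep" where
  "kernel_rep V f = \<lparr>rspace = {v \<in> rspace V. f v = 0}, ract = ract V\<rparr>"

lemma fd_rep_kernel:
  assumes V: "fd_rep G V" and W: "fd_rep G W" and f: "f \<in> rep_hom G V W"
  shows "fd_rep G (kernel_rep V f)"
proof -
  let ?K = "kernel_rep V f"
  note sub = fd_repD[OF V]
  have sp: "Q.subspace (rspace ?K)"
    unfolding Q.subspace_def kernel_rep_def
    using Q.subspace_0[OF sub(1)] Q.subspace_add[OF sub(1)] Q.subspace_scale[OF sub(1)] rep_hom_zero[OF f V]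
    by (auto simp: rep_homD[OF f])
  obtain B where "finite B" "rspace V = Q.span B" using V unfolding fd_rep_def by blast
  then have "\<exists>C. finite C \<and> rspace ?K = Q.span C" by (intro subspace_fd[OF sp]) (auto simp: kernel_rep_def)
  moreover have "f (ract V g v) = 0" if "g \<in> carrier G" "v \<in> rspace V" "f v = 0" for g v
  proof -
    have W0: "0 \<in> rspace W" by (rule Q.subspace_0[OF fd_repD(1)[OF W]])
    have "ract W g (0 *Q 0) = 0 *Q ract W g 0"
      using W that(1) W0 unfolding fd_rep_def linear_on_def by blast
    then show ?thesis using rep_homD(4)[OF f that(1,2)] that(3) by simp
  qed
  ultimately show ?thesis
    using V unfolding fd_rep_def by (auto simp: kernel_rep_def linear_on_def)
qed

lemma kernel_rep_onto:
  assumes f: "f \<in> rep_hom G V W" and onto: "f ` rspace V = rspace W'"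
    and act: "ract W' = ract W"
  shows "short_exact G (kernel_rep V f) V W'"
  unfolding short_exact_def
proof (intro bexI conjI)
  show "(\<lambda>v. v) \<in> rep_hom G (kernel_rep V f) V" by (rule rep_homI) (auto simp: kernel_rep_def)
  show "f \<in> rep_hom G V W'"
    by (rule rep_homI) (use onto in \<open>auto simp: rep_homD[OF f] act\<close>)
qed (use onto in \<open>auto simp: kernel_rep_def\<close>)

lemma (in comm_group) alternating_telescope:
  assumes z: "\<And>t. z t \<in> carrier G" and c: "\<And>t. t \<le> m \<Longrightarrow> c t = z t \<otimes> z (Suc t)"
  shows "finprod G (\<lambda>t. c t [^] ((-1) ^ t :: int)) {0..m} = z 0 \<otimes> z (Suc m) [^] ((-1) ^ m :: int)"
  using c
proof (induction m)
  case 0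
  then show ?case using z by simp
next
  case (Suc m)
  have cc: "c t \<in> carrier G" if "t \<le> Suc m" for t using Suc.prems[OF that] z by simp
  have "finprod G (\<lambda>t. c t [^] ((-1) ^ t :: int)) {0..Suc m}
      = c (Suc m) [^] ((-1) ^ Suc m :: int) \<otimes> finprod G (\<lambda>t. c t [^] ((-1) ^ t :: int)) {0..m}"
    unfolding atLeast0_atMost_Suc by (rule finprod_insert) (use cc in \<open>auto intro!: int_pow_closed\<close>)
  also have "\<dots> = (z (Suc m) \<otimes> z (Suc (Suc m))) [^] ((-1) ^ Suc m :: int) \<otimes> (z 0 \<otimes> z (Suc m) [^] ((-1) ^ m :: int))"
    using Suc by simp
  also have "\<dots> = z 0 \<otimes> z (Suc (Suc m)) [^] ((-1) ^ Suc m :: int) \<otimes> (z (Suc m) [^] ((-1) ^ Suc m :: int) \<otimes> z (Suc m) [^] ((-1) ^ m :: int))"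
    using z by (simp add: int_pow_distrib m_ac)
  also have "z (Suc m) [^] ((-1) ^ Suc m :: int) \<otimes> z (Suc m) [^] ((-1) ^ m :: int) = \<one>"
    using z by (simp flip: int_pow_mult)
  finally show ?case using z by simp
qed

text \<open>Exactness splits the complex into short exact sequences of kernels, whose classes telescope.\<close>

theorem rep_class_long_exact:
  fixes C :: "nat \<Rightarrow> ('g, 'v::rat_vector) rep" and d :: "nat \<Rightarrow> 'v \<Rightarrow> 'v"
    and S :: "('g, 's::rat_vector) rep" and e :: "'v \<Rightarrow> 's"
  assumes m: "0 < m" and C: "\<And>t. fd_rep G (C t)" and S: "fd_rep G S"
    and d: "\<And>t. d t \<in> rep_hom G (C t) (C (Suc t))" and e: "e \<in> rep_hom G (C m) S"
    and exact: "\<And>t. Suc t < m \<Longrightarrow> d t ` rspace (C t) = {v \<in> rspace (C (Suc t)). d (Suc t) v = 0}"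
    and exact_last: "\<And>t. Suc t = m \<Longrightarrow> d t ` rspace (C t) = {v \<in> rspace (C m). e v = 0}"
    and onto: "e ` rspace (C m) = rspace S"
  shows "rep_class G (kernel_rep (C 0) (d 0)) = rep_class G S [^]\<^bsub>grothendieck_group G\<^esub> ((-1) ^ (m + 1) :: int)
    \<otimes>\<^bsub>grothendieck_group G\<^esub> (\<Otimes>\<^bsub>grothendieck_group G\<^esub>t\<in>{0..m}.
      rep_class G (C t) [^]\<^bsub>grothendieck_group G\<^esub> ((-1) ^ t :: int))"
proof -
  interpret K: comm_group "grothendieck_group G" by (rule comm_group_grothendieck)
  let ?Z = "\<lambda>t. if t < m then kernel_rep (C t) (d t) else kernel_rep (C t) e"
  define z where "z = (\<lambda>t. if t \<le> m then rep_class G (?Z t) else rep_class G S)"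
  have Z: "fd_rep G (?Z t)" if "t \<le> m" for t
  proof (cases "t < m")
    case True
    then show ?thesis using fd_rep_kernel[OF C C d] by simp
  next
    case False
    then have "t = m" using that by simp
    then show ?thesis using fd_rep_kernel[OF C S e] by simp
  qed
  have z: "z t \<in> carrier (grothendieck_group G)" for t
    unfolding z_def using rep_class_closed[OF Z] rep_class_closed[OF S] by simp
  have c: "rep_class G (C t) = z t \<otimes>\<^bsub>grothendieck_group G\<^esub> z (Suc t)" if t: "t \<le> m" for t
  proof -
    consider "Suc t < m" | "Suc t = m" | "t = m" using t by linarith
    then show ?thesis
    proof cases
      case 1
      have "short_exact G (kernel_rep (C t) (d t)) (C t) (kernel_rep (C (Suc t)) (d (Suc t)))"
        by (rule kernel_rep_onto[OF d]) (use exact[OF 1] in \<open>simp_all add: kernel_rep_def\<close>)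
      from rep_class_exact[OF this fd_rep_kernel[OF C C d] C fd_rep_kernel[OF C C d]]
      show ?thesis using 1 by (simp add: z_def)
    next
      case 2
      have "short_exact G (kernel_rep (C t) (d t)) (C t) (kernel_rep (C m) e)"
        by (rule kernel_rep_onto[OF d]) (use exact_last[OF 2] in \<open>simp_all add: kernel_rep_def 2\<close>)
      from rep_class_exact[OF this fd_rep_kernel[OF C C d] C fd_rep_kernel[OF C S e]]
      show ?thesis using 2 by (auto simp: z_def)
    next
      case 3
      have "short_exact G (kernel_rep (C m) e) (C m) S" using onto by (intro kernel_rep_onto[OF e]) auto
      then show ?thesis using 3 rep_class_exact[OF _ fd_rep_kernel[OF C S e] C S] by (simp add: z_def)
    qed
  qed
  have S': "rep_class G S \<in> carrier (grothendieck_group G)" by (rule rep_class_closed[OF S])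
  have tel: "(\<Otimes>\<^bsub>grothendieck_group G\<^esub>t\<in>{0..m}. rep_class G (C t) [^]\<^bsub>grothendieck_group G\<^esub> ((-1) ^ t :: int))
      = z 0 \<otimes>\<^bsub>grothendieck_group G\<^esub> rep_class G S [^]\<^bsub>grothendieck_group G\<^esub> ((-1) ^ m :: int)"
    using K.alternating_telescope[of z m, OF z c] by (simp add: z_def)
  have "rep_class G S [^]\<^bsub>grothendieck_group G\<^esub> ((-1) ^ (m + 1) :: int) \<otimes>\<^bsub>grothendieck_group G\<^esub>
      rep_class G S [^]\<^bsub>grothendieck_group G\<^esub> ((-1) ^ m :: int) = \<one>\<^bsub>grothendieck_group G\<^esub>"
    using S' by (simp flip: K.int_pow_mult)
  then have "rep_class G S [^]\<^bsub>grothendieck_group G\<^esub> ((-1) ^ (m + 1) :: int) \<otimes>\<^bsub>grothendieck_group G\<^esub>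
      (z 0 \<otimes>\<^bsub>grothendieck_group G\<^esub> rep_class G S [^]\<^bsub>grothendieck_group G\<^esub> ((-1) ^ m :: int)) = z 0"
    using z[of 0] S' by (simp add: K.m_lcomm)
  then show ?thesis unfolding tel using m by (simp add: z_def)
qed

section \<open>Tensor powers of the reduced functor as functions without marginals\<close>

abbreviation cube :: "nat \<Rightarrow> nat set \<Rightarrow> (nat \<Rightarrow> nat) set" where
  "cube n X \<equiv> {1..n} \<rightarrow>\<^sub>E X"

text \<open>The \<open>n\<close>-th tensor power of the augmentation kernel, inside the functions on the cube: in each
  coordinate separately the function has sum zero.\<close>

definition marginal_free :: "nat \<Rightarrow> nat set \<Rightarrow> ((nat \<Rightarrow> nat) \<Rightarrow> rat) set" where
  "marginal_free n X = {t \<in> free_module (cube n X). \<forall>i\<in>{1..n}. \<forall>x. (\<Sum>z\<in>X. t (x(i := z))) = 0}"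

definition point_diff :: "nat \<Rightarrow> nat \<Rightarrow> nat \<Rightarrow> rat" where
  "point_diff w z = (\<lambda>y. of_bool (y = z) - of_bool (y = w))"

definition push :: "nat \<Rightarrow> nat set \<Rightarrow> (nat \<Rightarrow> nat) \<Rightarrow> ((nat \<Rightarrow> nat) \<Rightarrow> rat) \<Rightarrow> (nat \<Rightarrow> nat) \<Rightarrow> rat" where
  "push n X f = linearize (cube n X) (\<lambda>x. \<lambda>i\<in>{1..n}. f (x i))"

abbreviation cube_functor :: "nat \<Rightarrow> ((nat \<Rightarrow> nat) \<Rightarrow> rat) fin_functor" where
  "cube_functor n \<equiv> tensor_functor n reduced_functor"

lemma reduced_obj: "v \<in> obj reduced_functor X \<longleftrightarrow> (\<forall>x. x \<notin> X \<longrightarrow> v x = 0) \<and> (\<Sum>x\<in>X. v x) = 0"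
  by (simp add: reduced_functor_def free_module_def)

lemma point_diff_reduced:
  assumes "finite X" "w \<in> X" "z \<in> X"
  shows "point_diff w z \<in> obj reduced_functor X"
  using assms by (auto simp: reduced_obj point_diff_def sum_subtractf of_bool_def)

text \<open>Sum over the coordinate \<open>i\<close> first.\<close>

lemma sum_marginal_free:
  assumes X: "finite X" "x0 \<in> X" and t: "t \<in> marginal_free n X" and i: "i \<in> {1..n}"
    and g: "\<And>x z. g (x(i := z)) = g x"
  shows "(\<Sum>x\<in>cube n X. t x * g x) = 0"
proof -
  let ?h = "\<lambda>x. x(i := x0)"
  have fin: "finite (cube n X)" using X by (intro finite_PiE) auto
  have "(\<Sum>x\<in>cube n X. t x * g x) = (\<Sum>y\<in>?h ` cube n X. \<Sum>x\<in>{x \<in> cube n X. ?h x = y}. t x * g x)"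
    by (rule sum.image_gen[OF fin])
  also have "\<dots> = 0"
  proof (rule sum.neutral, rule ballI)
    fix y assume "y \<in> ?h ` cube n X"
    then obtain x1 where x1: "x1 \<in> cube n X" "y = ?h x1" by blast
    have y: "y \<in> cube n X" unfolding x1(2) by (rule PiE_upd[OF x1(1) i X(2)])
    have yi: "y(i := x0) = y" using x1(2) by simp
    have "(\<Sum>x\<in>{x \<in> cube n X. ?h x = y}. t x * g x) = (\<Sum>z\<in>X. t (y(i := z)) * g (y(i := z)))"
    proof (rule sum.reindex_bij_witness[where i = "\<lambda>z. y(i := z)" and j = "\<lambda>x. x i"])
      fix x assume x: "x \<in> {x \<in> cube n X. ?h x = y}"
      then have "?h x = y" by simp
      then show eq: "y(i := x i) = x" by (metis fun_upd_triv fun_upd_upd)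
      show "x i \<in> X" using x i by auto
      show "t (y(i := x i)) * g (y(i := x i)) = t x * g x" unfolding eq ..
    next
      fix z assume z: "z \<in> X"
      show "y(i := z) \<in> {x \<in> cube n X. ?h x = y}" using PiE_upd[OF y i z] yi by simp
    qed simp
    also have "\<dots> = (\<Sum>z\<in>X. t (y(i := z))) * g y" unfolding g sum_distrib_right ..
    also have "\<dots> = 0" using t i by (simp add: marginal_free_def)
    finally show "(\<Sum>x\<in>{x \<in> cube n X. ?h x = y}. t x * g x) = 0" .
  qed
  finally show ?thesis .
qed

lemma subspace_marginal_free: "Q.subspace (marginal_free n X)"
  unfolding Q.subspace_def marginal_free_def free_module_def
  by (auto simp: sum.distrib sum_distrib_left[symmetric])

lemma pure_tensor_marginal_free:
  assumes v: "v \<in> {1..n} \<rightarrow>\<^sub>E obj reduced_functor X"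
  shows "pure_tensor n v \<in> marginal_free n X"
proof -
  have v0: "v i x = 0" if "i \<in> {1..n}" "x \<notin> X" for i x using v that by (auto simp: reduced_obj PiE_iff)
  have "pure_tensor n v x = 0" if "x \<notin> cube n X" for x
  proof (cases "x \<in> extensional {1..n}")
    case True
    then have "\<exists>i\<in>{1..n}. x i \<notin> X" using that unfolding PiE_iff by blast
    then obtain i where "i \<in> {1..n}" "x i \<notin> X" by blast
    then have "(\<Prod>i=1..n. v i (x i)) = 0" using v0 by (intro prod_zero bexI[of _ i]) auto
    then show ?thesis by (simp add: pure_tensor_def)
  qed (simp add: pure_tensor_def)
  moreover have "(\<Sum>z\<in>X. pure_tensor n v (x(i := z))) = 0" if i: "i \<in> {1..n}" for i x
  proof (cases "x(i := undefined) \<in> extensional ({1..n} - {i})")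
    case True
    then have "x(i := z) \<in> extensional {1..n}" for z using i by (auto simp: extensional_def)
    then have "pure_tensor n v (x(i := z)) = v i z * (\<Prod>j\<in>{1..n} - {i}. v j (x j))" for z
      using i by (simp add: pure_tensor_def prod.remove[of _ i] del: One_nat_def)
    then have "(\<Sum>z\<in>X. pure_tensor n v (x(i := z))) = (\<Sum>z\<in>X. v i z) * (\<Prod>j\<in>{1..n} - {i}. v j (x j))"
      by (simp add: sum_distrib_right del: One_nat_def)
    also have "(\<Sum>z\<in>X. v i z) = 0" using v i by (auto simp: reduced_obj PiE_iff)
    finally show ?thesis by (simp only: mult_zero_left)
  next
    case False
    then have "x(i := z) \<notin> extensional {1..n}" for z using i by (auto simp: extensional_def)
    then show ?thesis by (simp add: pure_tensor_def)
  qed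
  ultimately show ?thesis by (simp add: marginal_free_def free_module_def)
qed

text \<open>Subtracting the base point in each factor changes nothing, since the correction terms are marginals.\<close>

lemma marginal_free_expand:
  assumes X: "finite X" "x0 \<in> X" and t: "t \<in> marginal_free n X"
  shows "t = (\<Sum>x\<in>cube n X. t x *Q pure_tensor n (\<lambda>i\<in>{1..n}. point_diff x0 (x i)))"
proof
  fix y
  have fin: "finite (cube n X)" using X by (intro finite_PiE) auto
  have eval: "(\<Sum>x\<in>A. c x *Q F x) y = (\<Sum>x\<in>A. c x * F x y)" if "finite A"
    for A :: "(nat \<Rightarrow> nat) set" and c and F :: "_ \<Rightarrow> (nat \<Rightarrow> nat) \<Rightarrow> rat"
    using that by (induction rule: finite_induct) auto
  show "t y = (\<Sum>x\<in>cube n X. t x *Q pure_tensor n (\<lambda>i\<in>{1..n}. point_diff x0 (x i))) y"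
  proof (cases "y \<in> extensional {1..n}")
    case True
    \<comment> \<open>The base point has been subtracted in the first \<open>k\<close> coordinates.\<close>
    define T where "T = (\<lambda>k x. \<Prod>i=1..n. of_bool (y i = x i) - (if i \<le> k then of_bool (y i = x0) else 0 :: rat))"
    have T: "(\<Sum>x\<in>cube n X. t x * T k x) = (\<Sum>x\<in>cube n X. t x * T 0 x)" if "k \<le> n" for k
      using that
    proof (induction k)
      case (Suc k)
      let ?i = "Suc k"
      have i: "?i \<in> {1..n}" using Suc.prems by simp
      let ?g = "\<lambda>x. of_bool (y ?i = x0) * (\<Prod>j\<in>{1..n} - {?i}. of_bool (y j = x j) - (if j \<le> k then of_bool (y j = x0) else 0 :: rat))"
      have "T ?i x = T k x - ?g x" for x
      proof -
        have "(\<Prod>j\<in>{1..n} - {?i}. of_bool (y j = x j) - (if j \<le> ?i then of_bool (y j = x0) else 0 :: rat))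
            = (\<Prod>j\<in>{1..n} - {?i}. of_bool (y j = x j) - (if j \<le> k then of_bool (y j = x0) else 0))"
          by (intro prod.cong) (auto simp: le_Suc_eq)
        then show ?thesis
          unfolding T_def by (subst (1 2) prod.remove[OF _ i]) (simp_all add: left_diff_distrib)
      qed
      moreover have "(\<Sum>x\<in>cube n X. t x * ?g x) = 0"
        by (rule sum_marginal_free[OF X t i]) (auto intro!: prod.cong)
      ultimately show ?case using Suc by (simp add: right_diff_distrib sum_subtractf)
    qed simp
    have "T n x = pure_tensor n (\<lambda>i\<in>{1..n}. point_diff x0 (x i)) y" for x
      unfolding T_def pure_tensor_def using True by (auto simp: point_diff_def intro!: prod.cong)
    then have "(\<Sum>x\<in>cube n X. t x *Q pure_tensor n (\<lambda>i\<in>{1..n}. point_diff x0 (x i))) y = (\<Sum>x\<in>cube n X. t x * T n x)"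
      unfolding eval[OF fin] by simp
    also have "\<dots> = (\<Sum>x\<in>cube n X. t x * T 0 x)" by (rule T) simp
    also have "\<dots> = (\<Sum>x\<in>cube n X. if x = y then t x else 0)"
    proof (intro sum.cong refl)
      fix x assume x: "x \<in> cube n X"
      have "T 0 x = of_bool (x = y)"
      proof (cases "x = y")
        case False
        have "x \<in> extensional {1..n}" using x by (simp add: PiE_def)
        then obtain i where "i \<in> {1..n}" "y i \<noteq> x i" using False True extensionalityI by metis
        then have "(\<Prod>i=1..n. of_bool (y i = x i) - (if i \<le> 0 then of_bool (y i = x0) else 0 :: rat)) = 0"
          by (intro prod_zero) auto
        then show ?thesis using False by (simp add: T_def)
      qed (auto simp: T_def intro!: prod.neutral)
      then show "t x * T 0 x = (if x = y then t x else 0)" by simp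
    qed
    also have "\<dots> = t y" using fin t by (auto simp: marginal_free_def free_module_def)
    finally show ?thesis by simp
  next
    case False
    then have "y \<notin> cube n X" by (simp add: PiE_def)
    then have "t y = 0" using t by (simp add: marginal_free_def free_module_def)
    then show ?thesis using False unfolding eval[OF fin] by (simp add: pure_tensor_def)
  qed
qed

lemma cube_obj_span:
  assumes X: "X \<in> fin_ne" and x0: "x0 \<in> X"
  shows "obj (cube_functor n) X = Q.span ((\<lambda>x. pure_tensor n (\<lambda>i\<in>{1..n}. point_diff x0 (x i))) ` cube n X)"
    and "obj (cube_functor n) X = marginal_free n X"
proof -
  have fX: "finite X" using X by (simp add: fin_ne_def)
  let ?S = "(\<lambda>x. pure_tensor n (\<lambda>i\<in>{1..n}. point_diff x0 (x i))) ` cube n X"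
  let ?P = "pure_tensor n ` ({1..n} \<rightarrow>\<^sub>E obj reduced_functor X)"
  have o: "obj (cube_functor n) X = Q.span ?P" by (simp add: tensor_functor_def tensor_power_def)
  have "?S \<subseteq> ?P"
  proof (rule image_subsetI)
    fix x assume x: "x \<in> cube n X"
    have "(\<lambda>i\<in>{1..n}. point_diff x0 (x i)) \<in> {1..n} \<rightarrow>\<^sub>E obj reduced_functor X"
      unfolding restrict_PiE_iff using x by (auto intro: point_diff_reduced[OF fX x0])
    then show "pure_tensor n (\<lambda>i\<in>{1..n}. point_diff x0 (x i)) \<in> ?P" by (rule imageI)
  qed
  then have 1: "Q.span ?S \<subseteq> Q.span ?P" by (rule Q.span_mono)
  have 2: "Q.span ?P \<subseteq> marginal_free n X"
    by (intro Q.span_minimal subspace_marginal_free image_subsetI pure_tensor_marginal_free)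
  have 3: "marginal_free n X \<subseteq> Q.span ?S"
  proof
    fix t assume "t \<in> marginal_free n X"
    then have "t = (\<Sum>x\<in>cube n X. t x *Q pure_tensor n (\<lambda>i\<in>{1..n}. point_diff x0 (x i)))"
      by (rule marginal_free_expand[OF fX x0])
    also have "\<dots> \<in> Q.span ?S" by (intro Q.span_sum Q.span_scale Q.span_base imageI)
    finally show "t \<in> Q.span ?S" .
  qed
  show "obj (cube_functor n) X = Q.span ?S" "obj (cube_functor n) X = marginal_free n X"
    using o 1 2 3 by blast+
qed

lemma cube_obj: "X \<in> fin_ne \<Longrightarrow> obj (cube_functor n) X = marginal_free n X"
  using cube_obj_span(2) by (auto simp: fin_ne_def)

lemma push_pure:
  assumes "finite X"
  shows "push n X f (pure_tensor n v) = pure_tensor n (\<lambda>i. linearize X f (v i))"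
proof
  fix y
  show "push n X f (pure_tensor n v) y = pure_tensor n (\<lambda>i. linearize X f (v i)) y"
  proof (cases "y \<in> extensional {1..n}")
    case True
    have set: "{x. x \<in> cube n X \<and> (\<lambda>i\<in>{1..n}. f (x i)) = y} = (\<Pi>\<^sub>E i\<in>{1..n}. {z. z \<in> X \<and> f z = y i})"
      using True by (auto simp: PiE_iff fun_eq_iff extensional_def simp del: One_nat_def)
    have "push n X f (pure_tensor n v) y = (\<Sum>x\<in>(\<Pi>\<^sub>E i\<in>{1..n}. {z. z \<in> X \<and> f z = y i}). pure_tensor n v x)"
      unfolding push_def linearize_def set ..
    also have "\<dots> = (\<Sum>x\<in>(\<Pi>\<^sub>E i\<in>{1..n}. {z. z \<in> X \<and> f z = y i}). \<Prod>i\<in>{1..n}. v i (x i))"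
      by (intro sum.cong refl) (auto simp: pure_tensor_def PiE_def)
    also have "\<dots> = (\<Prod>i\<in>{1..n}. \<Sum>z | z \<in> X \<and> f z = y i. v i z)"
      by (rule prod_sum_PiE[symmetric]) (use assms in auto)
    finally show ?thesis using True by (simp add: pure_tensor_def linearize_def)
  next
    case False
    then have e: "{x. x \<in> cube n X \<and> (\<lambda>i\<in>{1..n}. f (x i)) = y} = {}" by auto
    show ?thesis unfolding push_def linearize_def e using False by (simp add: pure_tensor_def)
  qed
qed

lemma cube_mor:
  assumes X: "X \<in> fin_ne" and Y: "Y \<in> fin_ne" and f: "f \<in> X \<rightarrow> Y" and t: "t \<in> marginal_free n X"
  shows "mor (cube_functor n) X Y f t = push n X f t"
proof -
  have o: "obj (cube_functor n) X = Q.span (pure_tensor n ` ({1..n} \<rightarrow>\<^sub>E obj reduced_functor X))"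
    by (simp add: tensor_functor_def tensor_power_def)
  have lin: "linear_on (obj (cube_functor n) X) (obj (cube_functor n) Y) (mor (cube_functor n) X Y f)"
    by (rule is_functorD(2)[OF is_functor_tensor[OF is_functor_reduced] X Y f])
  show ?thesis
  proof (rule linear_on_span_ext[OF lin[unfolded o]])
    show "linear_on (Q.span (pure_tensor n ` ({1..n} \<rightarrow>\<^sub>E obj reduced_functor X))) UNIV (push n X f)"
      using linear_on_subset[OF linearize_linear] unfolding push_def by blast
    show "t \<in> Q.span (pure_tensor n ` ({1..n} \<rightarrow>\<^sub>E obj reduced_functor X))"
      using t cube_obj[OF X] o by blast
    fix x assume "x \<in> pure_tensor n ` ({1..n} \<rightarrow>\<^sub>E obj reduced_functor X)"
    then obtain v where v: "v \<in> {1..n} \<rightarrow>\<^sub>E obj reduced_functor X" "x = pure_tensor n v" by blast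
    have "finite X" using X by (simp add: fin_ne_def)
    then show "mor (cube_functor n) X Y f x = push n X f x"
      using tensor_functor_pure(1)[OF is_functor_reduced X Y f v(1)] push_pure v(2)
      by (simp add: reduced_functor_def pure_tensor_restrict del: One_nat_def)
  qed
qed

lemma push_id: "t \<in> marginal_free n X \<Longrightarrow> push n X id t = t"
  unfolding push_def
  by (rule linearize_id) (auto simp: marginal_free_def fun_eq_iff PiE_def extensional_def simp del: One_nat_def)

lemma nat_trans_cubeD:
  assumes "\<eta> \<in> nat_trans (cube_functor a) (cube_functor b)"
  shows "X \<in> fin_ne \<Longrightarrow> linear_on (marginal_free a X) (marginal_free b X) (\<eta> X)"
    and "X \<in> fin_ne \<Longrightarrow> Y \<in> fin_ne \<Longrightarrow> f \<in> X \<rightarrow> Y \<Longrightarrow> t \<in> marginal_free a X \<Longrightarrow>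
      \<eta> Y (push a X f t) = push b X f (\<eta> X t)"
    and "X \<notin> fin_ne \<or> t \<notin> marginal_free a X \<Longrightarrow> \<eta> X t = 0"
proof -
  note eta = assms[unfolded nat_trans_def mem_Collect_eq]
  show lin: "linear_on (marginal_free a X) (marginal_free b X) (\<eta> X)" if "X \<in> fin_ne" for X
    using eta that by (simp add: cube_obj)
  show "\<eta> Y (push a X f t) = push b X f (\<eta> X t)"
    if X: "X \<in> fin_ne" and Y: "Y \<in> fin_ne" and f: "f \<in> X \<rightarrow> Y" and t: "t \<in> marginal_free a X"
  proof -
    have "\<eta> X t \<in> marginal_free b X" using lin[OF X] t by (auto simp: linear_on_def)
    moreover have "\<eta> Y (mor (cube_functor a) X Y f t) = mor (cube_functor b) X Y f (\<eta> X t)"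
      using eta X Y f t cube_obj[OF X] by blast
    ultimately show ?thesis using cube_mor[OF X Y f] t by simp
  qed
  show "\<eta> X t = 0" if "X \<notin> fin_ne \<or> t \<notin> marginal_free a X"
    using eta that cube_obj by metis
qed

lemma nat_trans_cubeI:
  assumes "\<And>X. X \<in> fin_ne \<Longrightarrow> linear_on (marginal_free a X) (marginal_free b X) (\<eta> X)"
    and "\<And>X Y f t. X \<in> fin_ne \<Longrightarrow> Y \<in> fin_ne \<Longrightarrow> f \<in> X \<rightarrow> Y \<Longrightarrow> t \<in> marginal_free a X \<Longrightarrow>
      \<eta> Y (push a X f t) = push b X f (\<eta> X t)"
    and "\<And>X t. X \<notin> fin_ne \<or> t \<notin> marginal_free a X \<Longrightarrow> \<eta> X t = 0"
  shows "\<eta> \<in> nat_trans (cube_functor a) (cube_functor b)"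
  unfolding nat_trans_def
proof (intro CollectI conjI ballI allI impI)
  show "linear_on (obj (cube_functor a) X) (obj (cube_functor b) X) (\<eta> X)" if "X \<in> fin_ne" for X
    using assms(1)[OF that] that by (simp add: cube_obj)
  show "\<eta> Y (mor (cube_functor a) X Y f t) = mor (cube_functor b) X Y f (\<eta> X t)"
    if X: "X \<in> fin_ne" and Y: "Y \<in> fin_ne" and f: "f \<in> X \<rightarrow> Y" and "t \<in> obj (cube_functor a) X" for X Y f t
  proof -
    have t: "t \<in> marginal_free a X" using that cube_obj by blast
    then have "\<eta> X t \<in> marginal_free b X" using assms(1)[OF X] by (auto simp: linear_on_def)
    then show ?thesis using assms(2)[OF X Y f t] cube_mor[OF X Y f] t by simp
  qed
  show "\<eta> X t = 0" if "X \<notin> fin_ne \<or> t \<notin> obj (cube_functor a) X" for X t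
    using assms(3) that cube_obj by metis
qed

lemma place_perm_inverse:
  assumes "f permutes {1..n}"
  shows "place_perm (inv' f) (place_perm f t) = t" "place_perm f (place_perm (inv' f) t) = t"
  unfolding place_perm_def permutes_inv_inv[OF assms] by (simp_all add: comp_assoc permutes_inv_o[OF assms])

lemma cube_permute: "f permutes {1..n} \<Longrightarrow> x \<circ> f \<in> cube n X \<longleftrightarrow> x \<in> cube n X"
proof -
  have *: "x \<circ> f \<in> cube n X" if "f permutes {1..n}" "x \<in> cube n X" for f and x :: "nat \<Rightarrow> nat"
    using that permutes_in_image[OF that(1)] permutes_not_in[OF that(1)]
    by (auto simp: PiE_iff extensional_def simp del: One_nat_def atLeastAtMost_iff)
  assume f: "f permutes {1..n}"
  show ?thesis
    using *[OF f, of x] *[OF permutes_inv[OF f], of "x \<circ> f"] by (auto simp: comp_assoc permutes_inv_o[OF f])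
qed

lemma place_perm_marginal_free:
  assumes f: "f permutes {1..n}" and t: "t \<in> marginal_free n X"
  shows "place_perm f t \<in> marginal_free n X"
proof -
  have "place_perm f t x = 0" if "x \<notin> cube n X" for x
    using t that cube_permute[OF permutes_inv[OF f]] by (simp add: place_perm_def marginal_free_def free_module_def)
  moreover have "(\<Sum>z\<in>X. place_perm f t (x(i := z))) = 0" if i: "i \<in> {1..n}" for i x
  proof -
    have "x(i := z) \<circ> inv' f = (x \<circ> inv' f)(f i := z)" for z
      by (auto simp: fun_eq_iff permutes_inverses[OF f])
    moreover have "f i \<in> {1..n}" using i permutes_in_image[OF f] by blast
    ultimately show ?thesis using t by (simp add: place_perm_def marginal_free_def)
  qed
  ultimately show ?thesis by (simp add: marginal_free_def free_module_def)
qed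

lemma push_place_perm:
  assumes f: "f permutes {1..n}"
  shows "push n X g (place_perm f t) = place_perm f (push n X g t)"
proof
  fix y
  note f' = permutes_inv[OF f]
  have r: "(\<lambda>i\<in>{1..n}. g ((x \<circ> h) i)) = (\<lambda>i\<in>{1..n}. g (x i)) \<circ> h" if "h permutes {1..n}" for h and x :: "nat \<Rightarrow> nat"
    using permutes_in_image[OF that] permutes_not_in[OF that]
    by (auto simp: fun_eq_iff restrict_def simp del: One_nat_def atLeastAtMost_iff)
  have inv: "x \<circ> f \<circ> inv' f = x" "x \<circ> inv' f \<circ> f = x" for x :: "nat \<Rightarrow> nat"
    by (simp_all add: comp_assoc permutes_inv_o[OF f])
  show "push n X g (place_perm f t) y = place_perm f (push n X g t) y"
    unfolding push_def linearize_def place_perm_def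
  proof (rule sum.reindex_bij_witness[where i = "\<lambda>x. x \<circ> f" and j = "\<lambda>x. x \<circ> inv' f"])
    fix x assume x: "x \<in> {x. x \<in> cube n X \<and> (\<lambda>i\<in>{1..n}. g (x i)) = y}"
    then show "x \<circ> inv' f \<in> {x. x \<in> cube n X \<and> (\<lambda>i\<in>{1..n}. g (x i)) = y \<circ> inv' f}"
      using cube_permute[OF f', of x] r[OF f', of x] by auto
  next
    fix x assume x: "x \<in> {x. x \<in> cube n X \<and> (\<lambda>i\<in>{1..n}. g (x i)) = y \<circ> inv' f}"
    then show "x \<circ> f \<in> {x. x \<in> cube n X \<and> (\<lambda>i\<in>{1..n}. g (x i)) = y}"
      using cube_permute[OF f, of x] r[OF f, of x] inv(2)[of y] by auto
  qed (simp_all only: inv)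
qed

section \<open>Natural transformations as cocycles of degree zero\<close>

lemma nat_trans_cube_mem:
  assumes "\<eta> \<in> nat_trans (cube_functor a) (cube_functor b)" "X \<in> fin_ne" "t \<in> marginal_free a X"
  shows "\<eta> X t \<in> marginal_free b X"
  using nat_trans_cubeD(1)[OF assms(1,2)] assms(3) unfolding linear_on_def by blast

text \<open>The element \<open>([1] - [0]) \<otimes> \<dots> \<otimes> ([a] - [0])\<close>, which generates the tensor power as a functor.\<close>

definition generator :: "nat \<Rightarrow> (nat \<Rightarrow> nat) \<Rightarrow> rat" where
  "generator a = pure_tensor a (\<lambda>i\<in>{1..a}. point_diff 0 i)"

text \<open>A surjection from \<open>{1..b}\<close> to \<open>{1..a}\<close> is read as a point of the cube over \<open>{0..a}\<close> that avoids
  the base point \<open>0\<close>.\<close>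

definition coefficients :: "nat \<Rightarrow> nat \<Rightarrow> (nat set \<Rightarrow> ((nat \<Rightarrow> nat) \<Rightarrow> rat) \<Rightarrow> (nat \<Rightarrow> nat) \<Rightarrow> rat)
    \<Rightarrow> (nat \<Rightarrow> nat) \<Rightarrow> rat" where
  "coefficients a b \<eta> p = (if p \<in> cells b a a 0 then \<eta> {0..a} (generator a) (restrict p {1..b}) else 0)"

lemma base_fin_ne [simp]: "{0..a::nat} \<in> fin_ne"
  by (simp add: fin_ne_def)

lemma point_diffs_marginal_free:
  assumes "finite X" "\<And>i. i \<in> {1..n} \<Longrightarrow> w i \<in> X \<and> z i \<in> X"
  shows "pure_tensor n (\<lambda>i\<in>{1..n}. point_diff (w i) (z i)) \<in> marginal_free n X"
proof (rule pure_tensor_marginal_free, unfold restrict_PiE_iff, rule ballI)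
  fix i assume "i \<in> {1..n}"
  then have "w i \<in> X" "z i \<in> X" using assms(2) by blast+
  then show "point_diff (w i) (z i) \<in> obj reduced_functor X" by (rule point_diff_reduced[OF assms(1)])
qed

lemma generator_marginal_free: "generator a \<in> marginal_free a {0..a}"
  unfolding generator_def by (rule point_diffs_marginal_free) auto

lemma linearize_point_diff:
  assumes "finite X" "w \<in> X" "z \<in> X"
  shows "linearize X f (point_diff w z) = point_diff (f w) (f z)"
proof
  fix y
  have "linearize X f (point_diff w z) y = (\<Sum>x | x \<in> X \<and> f x = y. if x = z then 1 else 0) - (\<Sum>x | x \<in> X \<and> f x = y. if x = w then 1 else 0)"
    unfolding linearize_def point_diff_def sum_subtractf[symmetric] by (intro sum.cong) auto
  also have "\<dots> = point_diff (f w) (f z) y"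
    using assms by (auto simp: point_diff_def)
  finally show "linearize X f (point_diff w z) y = point_diff (f w) (f z) y" .
qed

lemma push_generator:
  "push a {0..a} f (generator a) = pure_tensor a (\<lambda>i\<in>{1..a}. point_diff (f 0) (f i))"
proof -
  have "push a {0..a} f (generator a) = pure_tensor a (\<lambda>i. linearize {0..a} f ((\<lambda>i\<in>{1..a}. point_diff 0 i) i))"
    unfolding generator_def by (rule push_pure) simp
  also have "\<dots> = pure_tensor a (\<lambda>i\<in>{1..a}. linearize {0..a} f ((\<lambda>i\<in>{1..a}. point_diff 0 i) i))"
    by (rule pure_tensor_restrict[symmetric])
  also have "(\<lambda>i\<in>{1..a}. linearize {0..a} f ((\<lambda>i\<in>{1..a}. point_diff 0 i) i)) = (\<lambda>i\<in>{1..a}. point_diff (f 0) (f i))"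
    by (auto simp: fun_eq_iff linearize_point_diff)
  finally show ?thesis .
qed

text \<open>An inclusion acts as the identity on functions. So the value of a natural transformation does not
  depend on the ambient set, and it involves no points other than those of its argument.\<close>

lemma nat_trans_local:
  assumes \<eta>: "\<eta> \<in> nat_trans (cube_functor a) (cube_functor b)"
    and XY: "X \<in> fin_ne" "Y \<in> fin_ne" "Y \<subseteq> X" and t: "t \<in> marginal_free a Y"
  shows "\<eta> X t = \<eta> Y t" "\<eta> X t \<in> marginal_free b Y"
proof -
  have Yt: "\<eta> Y t \<in> marginal_free b Y"
    using nat_trans_cubeD(1)[OF \<eta> XY(2)] t by (auto simp: linear_on_def)
  have "\<eta> X (push a Y id t) = push b Y id (\<eta> Y t)"
    by (rule nat_trans_cubeD(2)[OF \<eta> XY(2,1) _ t]) (use XY(3) in auto)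
  then show "\<eta> X t = \<eta> Y t" by (simp add: push_id[OF t] push_id[OF Yt])
  then show "\<eta> X t \<in> marginal_free b Y" using Yt by simp
qed

text \<open>Move the base point \<open>0\<close> to the new point \<open>a + 1\<close>, one factor at a time. The error in each step is a
  tensor that does not involve some point \<open>k + 1\<close>, so its image vanishes at \<open>q\<close>, which takes this value; in the end
  the tensor does not involve \<open>0\<close>.\<close>

lemma generator_image_vanishes:
  assumes \<eta>: "\<eta> \<in> nat_trans (cube_functor a) (cube_functor b)" and q: "{0..a} \<subseteq> q ` {1..b}"
  shows "\<eta> {0..a} (generator a) q = 0"
proof -
  let ?X = "{0..Suc a}"
  have X: "?X \<in> fin_ne" by simp
  let ?v = "\<lambda>k. \<lambda>i\<in>{1..a}. point_diff (if i \<le> k then Suc a else 0) i"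
  have avoid: "\<eta> ?X t q = 0" if "t \<in> marginal_free a Y" "Y \<subseteq> ?X" "Y \<noteq> {}" "z \<in> {0..a}" "z \<notin> Y" for t Y z
  proof -
    have "Y \<in> fin_ne" using that finite_subset by (auto simp: fin_ne_def)
    then have "\<eta> ?X t \<in> marginal_free b Y" using nat_trans_local(2)[OF \<eta> X _ that(2,1)] by blast
    moreover have "q \<notin> cube b Y"
    proof
      assume qY: "q \<in> cube b Y"
      have "z \<in> q ` {1..b}" using q that(4) by blast
      then obtain j where "j \<in> {1..b}" "q j = z" by blast
      then show False using PiE_mem[OF qY] that(5) by blast
    qed
    ultimately show ?thesis by (simp add: marginal_free_def free_module_def)
  qed
  have "\<eta> ?X (pure_tensor a (?v (a - d))) q = 0" if "d \<le> a" for d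
    using that
  proof (induction d)
    case 0
    have "pure_tensor a (?v a) \<in> marginal_free a {1..Suc a}"
      by (rule point_diffs_marginal_free) auto
    then have "\<eta> ?X (pure_tensor a (?v a)) q = 0" by (rule avoid[where z = 0]) auto
    then show ?case by (simp only: diff_zero)
  next
    case (Suc d)
    define k where "k = a - Suc d"
    have k: "Suc k \<in> {1..a}" "a - d = Suc k" using Suc.prems by (auto simp: k_def)
    let ?w = "\<lambda>u. (?v (Suc k))(Suc k := u)"
    have "linear_on UNIV UNIV (\<lambda>u. pure_tensor a (?w u))"
      using pure_tensor_multilinear[of a "UNIV :: (nat \<Rightarrow> rat) set"] k(1) unfolding multilinear_on_def by auto
    moreover have "point_diff 0 (Suc k) = point_diff (Suc a) (Suc k) + point_diff 0 (Suc a)"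
      by (auto simp: point_diff_def)
    ultimately have "pure_tensor a (?w (point_diff 0 (Suc k)))
        = pure_tensor a (?w (point_diff (Suc a) (Suc k))) + pure_tensor a (?w (point_diff 0 (Suc a)))"
      unfolding linear_on_def by simp
    moreover have "?w (point_diff 0 (Suc k)) = ?v k" "?w (point_diff (Suc a) (Suc k)) = ?v (Suc k)"
      using k(1) by (auto simp: fun_eq_iff le_Suc_eq)
    ultimately have dec: "pure_tensor a (?v k) = pure_tensor a (?v (Suc k)) + pure_tensor a (?w (point_diff 0 (Suc a)))"
      by simp
    let ?e = "\<lambda>i\<in>{1..a}. point_diff (if i \<le> k then Suc a else 0) (if i = Suc k then Suc a else i)"
    have e: "?w (point_diff 0 (Suc a)) = ?e"
      using k(1) by (auto simp: fun_eq_iff le_Suc_eq)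
    have err: "pure_tensor a (?w (point_diff 0 (Suc a))) \<in> marginal_free a (?X - {Suc k})"
      unfolding e by (rule point_diffs_marginal_free) (use k(1) in auto)
    have "\<eta> ?X (pure_tensor a (?w (point_diff 0 (Suc a)))) q = 0"
      by (rule avoid[OF err, of "Suc k"]) (use k(1) in auto)
    moreover have "pure_tensor a (?v (Suc k)) \<in> marginal_free a ?X"
      by (rule point_diffs_marginal_free) auto
    moreover have "pure_tensor a (?w (point_diff 0 (Suc a))) \<in> marginal_free a ?X"
      unfolding e by (rule point_diffs_marginal_free) auto
    ultimately have step: "\<eta> ?X (pure_tensor a (?v k)) q = \<eta> ?X (pure_tensor a (?v (Suc k))) q"
      unfolding dec using nat_trans_cubeD(1)[OF \<eta> X] by (simp add: linear_on_def)
    have "d \<le> a" using Suc.prems by simp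
    from step Suc.IH[OF this, unfolded k(2)] show ?case unfolding k_def[symmetric] by (rule trans)
  qed
  from this[OF order_refl] have "\<eta> ?X (pure_tensor a (?v 0)) q = 0" by (simp only: diff_self_eq_0)
  moreover have "?v 0 = (\<lambda>i\<in>{1..a}. point_diff 0 i)" by auto
  ultimately have "\<eta> ?X (generator a) q = 0" by (simp only: generator_def)
  then show ?thesis using nat_trans_local(1)[OF \<eta> X base_fin_ne _ generator_marginal_free] by auto
qed

lemma cells_restrict:
  assumes "p \<in> cells b a c t"
  shows "restrict p {1..b} \<in> cube b {0..a}" "\<And>v. v \<noteq> 0 \<Longrightarrow> v \<in> range p \<Longrightarrow> v \<in> restrict p {1..b} ` {1..b}"
proof -
  have p: "p i \<le> a" "i \<notin> {1..b} \<Longrightarrow> p i = 0" for i using assms by (auto simp: cells_def covering_def pmaps_def)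
  show "restrict p {1..b} \<in> cube b {0..a}" using p(1) by (auto simp: restrict_PiE_iff)
  fix v assume v: "v \<noteq> 0" "v \<in> range p"
  obtain i where i: "v = p i" using v(2) by (rule rangeE)
  have ib: "i \<in> {1..b}"
  proof (rule ccontr)
    assume "i \<notin> {1..b}"
    then have "p i = 0" by (rule p(2))
    then show False using v(1) i by simp
  qed
  show "v \<in> restrict p {1..b} ` {1..b}" by (rule image_eqI[OF _ ib]) (simp add: i ib del: atLeastAtMost_iff One_nat_def)
qed

text \<open>At a map \<open>p\<close> with one undefined position \<open>i\<close>, the coboundary is a marginal of the value on the
  generator, except that the term with \<open>0\<close> at \<open>i\<close> is missing. That term vanishes.\<close>

lemma coefficients_cocycle:
  assumes \<eta>: "\<eta> \<in> nat_trans (cube_functor a) (cube_functor b)"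
  shows "coboundary b a a (coefficients a b \<eta>) = 0"
proof
  let ?c = "coefficients a b \<eta>" and ?w = "\<eta> {0..a} (generator a)"
  have c: "?c \<in> free_module (cells b a a 0)" by (simp add: coefficients_def free_module_def)
  have w: "?w \<in> marginal_free b {0..a}"
    by (rule nat_trans_cube_mem[OF \<eta> base_fin_ne generator_marginal_free])
  fix p
  show "coboundary b a a ?c p = (0 :: (nat \<Rightarrow> nat) \<Rightarrow> rat) p"
  proof (cases "p \<in> cells b a a (Suc 0)")
    case False
    then show ?thesis using coboundary_closed[OF c] by (simp add: free_module_def)
  next
    case True
    then have pc: "p \<in> covering b a a" by (simp add: cells_def)
    have "card (holes b p) = 1" using True by (simp add: cells_def)
    then obtain i where U: "holes b p = {i}" by (auto simp: card_1_singleton_iff)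
    then have i: "i \<in> holes b p" "i \<in> {1..b}" "p i = 0" by (auto simp: holes_def)
    let ?q = "restrict p {1..b}"
    have val: "?c (p(i := v)) = ?w (?q(i := v))" if v: "v \<in> {1..a}" for v
    proof -
      have "p(i := v) \<in> cells b a a 0" using cells_assign_iff[OF pc i(1) v] True by blast
      moreover have "restrict (p(i := v)) {1..b} = ?q(i := v)" using i(2) by (auto simp: fun_eq_iff)
      ultimately show ?thesis by (simp add: coefficients_def)
    qed
    have "?w ?q = 0"
    proof (rule generator_image_vanishes[OF \<eta>], rule subsetI)
      fix v assume v: "v \<in> {0..a}"
      show "v \<in> ?q ` {1..b}"
      proof (cases "v = 0")
        case True
        then show ?thesis using i(2,3) by (intro image_eqI[of _ _ i]) auto
      next
        case False
        moreover then have "v \<in> range p" using v pc by (auto simp: covering_def)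
        ultimately show ?thesis using cells_restrict(2)[OF True] by blast
      qed
    qed
    moreover have "?q(i := 0) = ?q" using i(2,3) by (auto simp: fun_eq_iff)
    ultimately have "(\<Sum>v\<in>{1..a}. ?w (?q(i := v))) = (\<Sum>v\<in>{0..a}. ?w (?q(i := v)))"
      by (simp add: sum.atLeast_Suc_atMost[of 0 a])
    also have "\<dots> = 0" using w i(2) by (simp add: marginal_free_def)
    finally have "(\<Sum>v\<in>{1..a}. ?c (p(i := v))) = 0" using val by simp
    then show ?thesis using pc by (simp add: coboundary_def U)
  qed
qed

text \<open>Collapsing \<open>i\<close> to the base point kills the generator. This expresses a coefficient at a map
  missing \<open>i\<close> by coefficients at maps attaining more values.\<close>

lemma collapsible_zero:
  assumes w: "w \<in> free_module (cube b {0..a})"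
    and collapse: "\<And>i. i \<in> {1..a} \<Longrightarrow> push b {0..a} (id(i := 0)) w = 0"
    and top: "\<And>q. q \<in> cube b {0..a} \<Longrightarrow> {1..a} \<subseteq> q ` {1..b} \<Longrightarrow> w q = 0"
  shows "w = 0"
proof -
  let ?m = "\<lambda>q. {1..a} - q ` {1..b}"
  have "w q = 0" if "q \<in> cube b {0..a}" for q
    using that
  proof (induction "card (?m q)" arbitrary: q rule: less_induct)
    case less
    show ?case
    proof (cases "?m q = {}")
      case True
      then show ?thesis using top[OF less.prems] by blast
    next
      case False
      then obtain i where i: "i \<in> {1..a}" "i \<notin> q ` {1..b}" by blast
      let ?c = "id(i := 0) :: nat \<Rightarrow> nat"
      let ?S = "{x. x \<in> cube b {0..a} \<and> (\<lambda>j\<in>{1..b}. ?c (x j)) = q}"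
      have fin: "finite ?S"
        by (rule finite_subset[of _ "cube b {0..a}"]) (auto intro!: finite_PiE)
      have "?c (q j) = q j" if "j \<in> {1..b}" for j using i that by auto
      moreover have "q \<in> extensional {1..b}" using less.prems by (simp add: PiE_def)
      ultimately have "(\<lambda>j\<in>{1..b}. ?c (q j)) = q"
        by (auto simp: fun_eq_iff extensional_def simp del: One_nat_def atLeastAtMost_iff)
      then have qS: "q \<in> ?S" using less.prems by blast
      have "w x = 0" if x: "x \<in> ?S - {q}" for x
      proof -
        have xc: "x \<in> cube b {0..a}" and eq: "(\<lambda>j\<in>{1..b}. ?c (x j)) = q" and ne: "x \<noteq> q"
          using x by blast+
        have cx: "q j = ?c (x j)" if "j \<in> {1..b}" for j
          using fun_cong[OF eq, of j] that by simp
        have "i \<in> x ` {1..b}"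
        proof (rule ccontr)
          assume "i \<notin> x ` {1..b}"
          then have "q j = x j" if "j \<in> {1..b}" for j using cx[OF that] that by auto
          then have "x = q"
            using xc less.prems by (intro extensionalityI[of x "{1..b}" q]) (auto simp: PiE_def)
          then show False using ne by blast
        qed
        moreover have "v \<in> x ` {1..b}" if v: "v \<in> {1..a}" "v \<in> q ` {1..b}" for v
        proof -
          obtain j where j: "j \<in> {1..b}" "v = q j" using v(2) by blast
          then have "v = x j" using cx[OF j(1)] v(1) by (auto split: if_splits)
          then show ?thesis using j(1) by blast
        qed
        ultimately have "?m x \<subset> ?m q" using i by blast
        then have "card (?m x) < card (?m q)" by (intro psubset_card_mono) auto
        then show ?thesis using less.hyps x by blast
      qed
      then have "w q = (\<Sum>x\<in>?S. w x)"
        using sum.remove[OF fin qS, of w] by simp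
      also have "\<dots> = push b {0..a} ?c w q" by (simp add: push_def linearize_def)
      also have "\<dots> = 0" using collapse[OF i(1)] by simp
      finally show ?thesis .
    qed
  qed
  then show ?thesis using w by (auto simp: free_module_def fun_eq_iff)
qed

text \<open>Every tensor without marginals is a combination of images of the generator.\<close>

lemma nat_trans_determined:
  assumes 1: "\<eta> \<in> nat_trans (cube_functor a) (cube_functor b)"
    and 2: "\<eta>' \<in> nat_trans (cube_functor a) (cube_functor b)"
    and eq: "\<eta> {0..a} (generator a) = \<eta>' {0..a} (generator a)"
  shows "\<eta> = \<eta>'"
proof (rule ext, rule ext)
  fix X t
  show "\<eta> X t = \<eta>' X t"
  proof (cases "X \<in> fin_ne \<and> t \<in> marginal_free a X")
    case True
    then have X: "X \<in> fin_ne" and t: "t \<in> marginal_free a X" by auto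
    then obtain x0 where x0: "x0 \<in> X" by (auto simp: fin_ne_def)
    let ?S = "(\<lambda>x. pure_tensor a (\<lambda>i\<in>{1..a}. point_diff x0 (x i))) ` cube a X"
    have S: "marginal_free a X = Q.span ?S" using cube_obj_span[OF X x0] by simp
    show ?thesis
    proof (rule linear_on_span_ext[OF nat_trans_cubeD(1)[OF 1 X, unfolded S] nat_trans_cubeD(1)[OF 2 X, unfolded S]])
      show "t \<in> Q.span ?S" using t S by blast
      fix s assume "s \<in> ?S"
      then obtain x where x: "x \<in> cube a X" "s = pure_tensor a (\<lambda>i\<in>{1..a}. point_diff x0 (x i))" by blast
      let ?f = "\<lambda>i. if i = 0 then x0 else x i"
      have f: "?f \<in> {0..a} \<rightarrow> X"
      proof
        fix i assume "i \<in> {0..a}"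
        then show "?f i \<in> X" using x0 PiE_mem[OF x(1), of i] by (cases "i = 0") auto
      qed
      have "(\<lambda>i\<in>{1..a}. point_diff (?f 0) (?f i)) = (\<lambda>i\<in>{1..a}. point_diff x0 (x i))" by auto
      then have "s = push a {0..a} ?f (generator a)" unfolding push_generator x(2) by simp
      then show "\<eta> X s = \<eta>' X s"
        by (simp only: nat_trans_cubeD(2)[OF 1 base_fin_ne X f generator_marginal_free]
            nat_trans_cubeD(2)[OF 2 base_fin_ne X f generator_marginal_free] eq)
    qed
  next
    case False
    then show ?thesis using nat_trans_cubeD(3)[OF 1] nat_trans_cubeD(3)[OF 2] by metis
  qed
qed

lemma cells_of_surjective:
  assumes q: "q \<in> cube b {0..a}" "{1..a} \<subseteq> q ` {1..b}" "0 \<notin> q ` {1..b}"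
  shows "\<exists>p\<in>cells b a a 0. restrict p {1..b} = q"
proof
  let ?p = "\<lambda>i. if i \<in> {1..b} then q i else 0"
  have "q i \<noteq> 0" if "i \<in> {1..b}" for i using q(3) that by (metis image_eqI)
  then have "holes b ?p = {}" by (simp add: holes_def)
  moreover have "{1..a} \<subseteq> range ?p"
  proof
    fix v assume "v \<in> {1..a}"
    then obtain i where "i \<in> {1..b}" "v = q i" using q(2) by blast
    then show "v \<in> range ?p" by (intro range_eqI[of _ _ i]) simp
  qed
  moreover have "q i \<le> a" if "i \<in> {1..b}" for i using PiE_mem[OF q(1) that] by simp
  ultimately show "?p \<in> cells b a a 0" by (simp add: cells_def covering_def pmaps_def)
  show "restrict ?p {1..b} = q"
    using q(1) by (auto simp: fun_eq_iff PiE_def extensional_def)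
qed

lemma coefficients_inj:
  assumes 1: "\<eta> \<in> nat_trans (cube_functor a) (cube_functor b)"
    and 2: "\<eta>' \<in> nat_trans (cube_functor a) (cube_functor b)"
    and eq: "coefficients a b \<eta> = coefficients a b \<eta>'"
  shows "\<eta> = \<eta>'"
proof (rule nat_trans_determined[OF 1 2])
  let ?w = "\<eta> {0..a} (generator a)" and ?w' = "\<eta>' {0..a} (generator a)"
  have mf: "\<zeta> {0..a} (generator a) \<in> marginal_free b {0..a}"
    if "\<zeta> \<in> nat_trans (cube_functor a) (cube_functor b)" for \<zeta>
    by (rule nat_trans_cube_mem[OF that base_fin_ne generator_marginal_free])
  have coll: "push b {0..a} (id(i := 0)) (\<zeta> {0..a} (generator a)) = 0"
    if \<zeta>: "\<zeta> \<in> nat_trans (cube_functor a) (cube_functor b)" and i: "i \<in> {1..a}" for \<zeta> i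
  proof -
    let ?c = "id(i := 0) :: nat \<Rightarrow> nat"
    have c: "?c \<in> {0..a} \<rightarrow> {0..a}" by auto
    have "push a {0..a} ?c (generator a) y = 0" for y
    proof -
      have "(\<Prod>k=1..a. (\<lambda>i\<in>{1..a}. point_diff (?c 0) (?c i)) k (y k)) = 0"
        using i by (intro prod_zero bexI[of _ i]) (auto simp: point_diff_def)
      then show ?thesis unfolding push_generator pure_tensor_def by simp
    qed
    then have "push a {0..a} ?c (generator a) = 0" by (simp add: fun_eq_iff)
    then have "push b {0..a} ?c (\<zeta> {0..a} (generator a)) = \<zeta> {0..a} 0"
      using nat_trans_cubeD(2)[OF \<zeta> base_fin_ne base_fin_ne c generator_marginal_free] by simp
    also have "\<zeta> {0..a} (0 *Q 0) = 0 *Q \<zeta> {0..a} 0"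
      using nat_trans_cubeD(1)[OF \<zeta> base_fin_ne] Q.subspace_0[OF subspace_marginal_free]
      unfolding linear_on_def by blast
    then have "\<zeta> {0..a} 0 = 0" by simp
    finally show ?thesis .
  qed
  have "?w - ?w' = 0"
  proof (rule collapsible_zero)
    have "?w - ?w' \<in> marginal_free b {0..a}"
      using mf[OF 1] mf[OF 2] Q.subspace_diff[OF subspace_marginal_free] by blast
    then show "?w - ?w' \<in> free_module (cube b {0..a})" by (simp add: marginal_free_def)
    fix i assume i: "i \<in> {1..a}"
    have "push b {0..a} (id(i := 0)) (?w - ?w')
        = push b {0..a} (id(i := 0)) ?w - push b {0..a} (id(i := 0)) ?w'"
      by (simp add: push_def linearize_def fun_eq_iff sum_subtractf)
    then show "push b {0..a} (id(i := 0)) (?w - ?w') = 0" by (simp only: coll[OF 1 i] coll[OF 2 i] diff_zero)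
  next
    fix q assume q: "q \<in> cube b {0..a}" "{1..a} \<subseteq> q ` {1..b}"
    show "(?w - ?w') q = 0"
    proof (cases "0 \<in> q ` {1..b}")
      case True
      have "v \<in> q ` {1..b}" if "v \<in> {0..a}" for v
        using True q(2) that by (cases "v = 0") auto
      then have "{0..a} \<subseteq> q ` {1..b}" by blast
      then show ?thesis using generator_image_vanishes[OF 1] generator_image_vanishes[OF 2] by simp
    next
      case False
      then obtain p where "p \<in> cells b a a 0" "restrict p {1..b} = q" using cells_of_surjective[OF q] by blast
      then have "?w q = coefficients a b \<eta> p" "?w' q = coefficients a b \<eta>' p" by (simp_all add: coefficients_def)
      then show ?thesis using eq by simp
    qed
  qed
  then show "?w = ?w'" by simp
qed

lemma sum_scaleQ_apply: "(\<Sum>x\<in>A. c x *Q F x) y = (\<Sum>x\<in>A. c x * F x y)"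
  for F :: "'i \<Rightarrow> 'j \<Rightarrow> rat"
  by (induction A rule: infinite_finite_induct) auto

text \<open>A surjection from \<open>{1..b}\<close> to \<open>{1..a}\<close> acts on tensors by copying coordinates.\<close>

definition realization :: "nat \<Rightarrow> nat \<Rightarrow> ((nat \<Rightarrow> nat) \<Rightarrow> rat)
    \<Rightarrow> nat set \<Rightarrow> ((nat \<Rightarrow> nat) \<Rightarrow> rat) \<Rightarrow> (nat \<Rightarrow> nat) \<Rightarrow> rat" where
  "realization a b \<Phi> X t = (if X \<in> fin_ne \<and> t \<in> marginal_free a X
     then \<Sum>p\<in>cells b a a 0. \<Phi> p *Q linearize (cube a X) (\<lambda>x. \<lambda>i\<in>{1..b}. x (p i)) t else 0)"

lemma cells_zero_values:
  assumes "p \<in> cells b a a 0" "i \<in> {1..b}" shows "p i \<in> {1..a}"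
proof -
  have "holes b p = {}" using assms(1) by (simp add: cells_def)
  then have "p i \<noteq> 0" using assms(2) by (auto simp: holes_def)
  then show ?thesis using assms(1) by (simp add: cells_def covering_def pmaps_def)
qed

lemma copy_cube: "p \<in> cells b a a 0 \<Longrightarrow> (\<lambda>x. \<lambda>i\<in>{1..b}. x (p i)) \<in> cube a X \<rightarrow> cube b X"
proof
  fix x assume p: "p \<in> cells b a a 0" and x: "x \<in> cube a X"
  have "x (p i) \<in> X" if "i \<in> {1..b}" for i using PiE_mem[OF x cells_zero_values[OF p that]] .
  then show "(\<lambda>i\<in>{1..b}. x (p i)) \<in> cube b X" by (simp add: restrict_PiE_iff)
qed

text \<open>Summing over coordinate \<open>j\<close> leaves an expression in the restriction \<open>q\<close> of \<open>p\<close> to the other positions.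
  It is zero when \<open>q\<close> misses a value, because \<open>t\<close> has no marginals; otherwise the coefficients of the \<open>p\<close> with
  restriction \<open>q\<close> add up to zero by the cocycle condition.\<close>

lemma realization_marginal_free:
  assumes \<Phi>: "\<Phi> \<in> free_module (cells b a a 0)" and cyc: "coboundary b a a \<Phi> = 0"
    and X: "X \<in> fin_ne" and t: "t \<in> marginal_free a X"
  shows "realization a b \<Phi> X t \<in> marginal_free b X"
proof -
  let ?C = "cells b a a 0"
  let ?L = "\<lambda>p. linearize (cube a X) (\<lambda>x. \<lambda>i\<in>{1..b}. x (p i)) t"
  have fX: "finite X" "X \<noteq> {}" using X by (auto simp: fin_ne_def)
  then obtain x0 where x0: "x0 \<in> X" by blast
  have fin: "finite (cube a X)" using fX by (intro finite_PiE) auto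
  have R: "realization a b \<Phi> X t y = (\<Sum>p\<in>?C. \<Phi> p * ?L p y)" for y
    using X t by (simp add: realization_def sum_scaleQ_apply)
  have "realization a b \<Phi> X t y = 0" if "y \<notin> cube b X" for y
    unfolding R using linearize_free[OF copy_cube] that by (intro sum.neutral) (auto simp: free_module_def)
  moreover have "(\<Sum>z\<in>X. realization a b \<Phi> X t (y(j := z))) = 0" if j: "j \<in> {1..b}" for j y
  proof -
    define S where "S = (\<lambda>q. \<Sum>x\<in>cube a X. t x * of_bool ((\<lambda>i\<in>{1..b}. x (q i))(j := 0) = y(j := 0)))"
    have LS: "(\<Sum>z\<in>X. ?L p (y(j := z))) = S (p(j := 0))" if p: "p \<in> ?C" for p
    proof -
      let ?xp = "\<lambda>x. \<lambda>i\<in>{1..b}. x (p i)"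
      have "(\<Sum>z\<in>X. ?L p (y(j := z))) = (\<Sum>z\<in>X. \<Sum>x\<in>cube a X. t x * of_bool (?xp x = y(j := z)))"
        unfolding linearize_def using fin by (intro sum.cong refl sum.mono_neutral_cong_left) auto
      also have "\<dots> = (\<Sum>x\<in>cube a X. t x * (\<Sum>z\<in>X. of_bool (?xp x = y(j := z))))"
        unfolding sum_distrib_left by (rule sum.swap)
      also have "\<dots> = S (p(j := 0))"
        unfolding S_def
      proof (intro sum.cong refl arg_cong2[where f = "(*)"])
        fix x assume x: "x \<in> cube a X"
        have xj: "?xp x j \<in> X" using PiE_mem[OF funcset_mem[OF copy_cube[OF p] x] j] .
        have eq: "?xp x = y(j := z) \<longleftrightarrow> z = ?xp x j \<and> (?xp x)(j := 0) = y(j := 0)" for z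
          by (auto simp: fun_eq_iff simp del: restrict_apply split: if_splits)
        have "(\<Sum>z\<in>X. of_bool (?xp x = y(j := z)))
            = (\<Sum>z\<in>X. if z = ?xp x j then of_bool ((?xp x)(j := 0) = y(j := 0)) else 0 :: rat)"
          by (intro sum.cong refl) (simp only: eq, simp)
        also have "\<dots> = of_bool ((?xp x)(j := 0) = y(j := 0))" using fX(1) xj by (simp only: sum.delta if_True)
        also have "(?xp x)(j := 0) = (\<lambda>i\<in>{1..b}. x ((p(j := 0)) i))(j := 0)" by (auto simp: fun_eq_iff)
        finally show "(\<Sum>z\<in>X. of_bool (?xp x = y(j := z)))
            = (of_bool ((\<lambda>i\<in>{1..b}. x ((p(j := 0)) i))(j := 0) = y(j := 0)) :: rat)" .
      qed
      finally show ?thesis .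
    qed
    have "(\<Sum>z\<in>X. realization a b \<Phi> X t (y(j := z))) = (\<Sum>p\<in>?C. \<Phi> p * S (p(j := 0)))"
    proof -
      have "(\<Sum>z\<in>X. realization a b \<Phi> X t (y(j := z))) = (\<Sum>p\<in>?C. \<Phi> p * (\<Sum>z\<in>X. ?L p (y(j := z))))"
        unfolding R sum_distrib_left by (rule sum.swap)
      also have "\<dots> = (\<Sum>p\<in>?C. \<Phi> p * S (p(j := 0)))"
        by (intro sum.cong refl) (simp only: LS)
      finally show ?thesis .
    qed
    also have "\<dots> = (\<Sum>q\<in>(\<lambda>p. p(j := 0)) ` ?C. \<Sum>p\<in>{p \<in> ?C. p(j := 0) = q}. \<Phi> p * S (p(j := 0)))"
      by (rule sum.image_gen[OF finite_cells])
    also have "\<dots> = 0"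
    proof (rule sum.neutral, rule ballI)
      fix q assume "q \<in> (\<lambda>p. p(j := 0)) ` ?C"
      then obtain p0 where p0: "p0 \<in> ?C" "q = p0(j := 0)" by blast
      have qj: "q j = 0" using p0(2) by simp
      have U: "holes b q = {j}"
        using p0 j by (auto simp: cells_def holes_def)
      have pm: "q \<in> pmaps b a" using p0 by (auto simp: cells_def covering_def pmaps_def)
      have "(\<Sum>p\<in>{p \<in> ?C. p(j := 0) = q}. \<Phi> p * S (p(j := 0))) = (\<Sum>p\<in>{p \<in> ?C. p(j := 0) = q}. \<Phi> p) * S q"
        unfolding sum_distrib_right by (intro sum.cong) auto
      also have "\<dots> = 0"
      proof (cases "q \<in> covering b a a")
        case True
        have "(\<Sum>p\<in>{p \<in> ?C. p(j := 0) = q}. \<Phi> p) = (\<Sum>v=1..a. \<Phi> (q(j := v)))"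
        proof (rule sum.reindex_bij_witness[where i = "\<lambda>v. q(j := v)" and j = "\<lambda>p. p j"])
          fix p assume p: "p \<in> {p \<in> ?C. p(j := 0) = q}"
          then show eq: "q(j := p j) = p" by auto
          show "p j \<in> {1..a}" using cells_zero_values[OF _ j] p by blast
          show "\<Phi> (q(j := p j)) = \<Phi> p" unfolding eq ..
        next
          fix v assume v: "v \<in> {1..a}"
          have "q \<in> cells b a a (Suc 0)" using True by (simp add: cells_def U)
          then have "q(j := v) \<in> ?C" using cells_assign_iff[OF True _ v, of j 0] U by simp
          then show "q(j := v) \<in> {p \<in> ?C. p(j := 0) = q}" using qj by auto
        qed simp
        moreover have "coboundary b a a \<Phi> q = insertion_sign j {j} * (\<Sum>v=1..a. \<Phi> (q(j := v)))"
          using True by (simp add: coboundary_def U)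
        then have "(\<Sum>v=1..a. \<Phi> (q(j := v))) = 0" using cyc by (simp add: insertion_sign_def)
        ultimately show ?thesis by simp
      next
        case False
        then have "\<not> {1..a} \<subseteq> range q" using pm by (simp add: covering_def)
        then obtain v where v: "v \<in> {1..a}" "v \<notin> range q" unfolding subset_eq by blast
        have "S q = 0"
          unfolding S_def
        proof (rule sum_marginal_free[OF fX(1) x0 t v(1)])
          fix x :: "nat \<Rightarrow> nat" and z
          have "q i \<noteq> v" for i using v(2) by blast
          then have "(\<lambda>i\<in>{1..b}. (x(v := z)) (q i)) = (\<lambda>i\<in>{1..b}. x (q i))" by simp
          then show "of_bool ((\<lambda>i\<in>{1..b}. (x(v := z)) (q i))(j := 0) = y(j := 0))
              = (of_bool ((\<lambda>i\<in>{1..b}. x (q i))(j := 0) = y(j := 0)) :: rat)" by (simp only:)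
        qed
        then show ?thesis by simp
      qed
      finally show "(\<Sum>p\<in>{p \<in> ?C. p(j := 0) = q}. \<Phi> p * S (p(j := 0))) = 0" .
    qed
    finally show ?thesis .
  qed
  ultimately show ?thesis by (simp add: marginal_free_def free_module_def)
qed

lemma realization_nat_trans:
  assumes \<Phi>: "\<Phi> \<in> free_module (cells b a a 0)" and cyc: "coboundary b a a \<Phi> = 0"
  shows "realization a b \<Phi> \<in> nat_trans (cube_functor a) (cube_functor b)"
proof (rule nat_trans_cubeI)
  fix X assume X: "X \<in> fin_ne"
  have add: "linearize S \<phi> (c + d) = linearize S \<phi> c + linearize S \<phi> d"
    and sc: "linearize S \<phi> (r *Q c) = r *Q linearize S \<phi> c"
    for S :: "(nat \<Rightarrow> nat) set" and \<phi> :: "(nat \<Rightarrow> nat) \<Rightarrow> nat \<Rightarrow> nat" and c d r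
    using linearize_linear[of S \<phi>] unfolding linear_on_def by blast+
  show "linear_on (marginal_free a X) (marginal_free b X) (realization a b \<Phi> X)"
    unfolding linear_on_def
  proof (intro conjI ballI allI funcsetI)
    fix s assume s: "s \<in> marginal_free a X"
    show "realization a b \<Phi> X s \<in> marginal_free b X" by (rule realization_marginal_free[OF \<Phi> cyc X s])
    show "realization a b \<Phi> X (r *Q s) = r *Q realization a b \<Phi> X s" for r
      using X s Q.subspace_scale[OF subspace_marginal_free s]
      by (simp add: realization_def sc Q.scale_sum_right mult.commute)
    fix t assume t: "t \<in> marginal_free a X"
    show "realization a b \<Phi> X (s + t) = realization a b \<Phi> X s + realization a b \<Phi> X t"
      using X s t Q.subspace_add[OF subspace_marginal_free s t]
      by (simp add: realization_def add Q.scale_right_distrib sum.distrib)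
  qed
  fix Y f t assume Y: "Y \<in> fin_ne" and f: "f \<in> X \<rightarrow> Y" and t: "t \<in> marginal_free a X"
  have fin: "finite X" "finite Y" using X Y by (auto simp: fin_ne_def)
  have finc: "finite (cube n X)" "finite (cube n Y)" for n using fin by (auto intro!: finite_PiE)
  have pt: "push a X f t \<in> marginal_free a Y"
  proof -
    have "mor (cube_functor a) X Y f t \<in> obj (cube_functor a) Y"
      using is_functorD(2)[OF is_functor_tensor[OF is_functor_reduced] X Y f, of a] t cube_obj[OF X]
      unfolding linear_on_def by blast
    then show ?thesis using cube_mor[OF X Y f t] cube_obj[OF Y] by simp
  qed
  let ?f = "\<lambda>n x. \<lambda>i\<in>{1..n}. f (x i)"
  have fc: "?f n \<in> cube n X \<rightarrow> cube n Y" for n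
  proof
    fix x assume x: "x \<in> cube n X"
    have "f (x i) \<in> Y" if "i \<in> {1..n}" for i using funcset_mem[OF f PiE_mem[OF x that]] .
    then show "?f n x \<in> cube n Y" by (simp add: restrict_PiE_iff)
  qed
  have comm: "linearize (cube a Y) (\<lambda>x. \<lambda>i\<in>{1..b}. x (p i)) (push a X f t)
      = push b X f (linearize (cube a X) (\<lambda>x. \<lambda>i\<in>{1..b}. x (p i)) t)" if p: "p \<in> cells b a a 0" for p
  proof -
    have "linearize (cube a Y) (\<lambda>x. \<lambda>i\<in>{1..b}. x (p i)) (push a X f t)
        = linearize (cube a X) (\<lambda>x. \<lambda>i\<in>{1..b}. ?f a x (p i)) t"
      unfolding push_def by (rule linearize_comp[OF finc fc])
    also have "(\<lambda>x. \<lambda>i\<in>{1..b}. ?f a x (p i)) = (\<lambda>x. ?f b (\<lambda>i\<in>{1..b}. x (p i)))"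
      using cells_zero_values[OF p] by (auto simp: fun_eq_iff simp del: One_nat_def)
    also have "linearize (cube a X) \<dots> t = push b X f (linearize (cube a X) (\<lambda>x. \<lambda>i\<in>{1..b}. x (p i)) t)"
      unfolding push_def by (rule linearize_comp[OF finc(1) finc(1) copy_cube[OF p], symmetric])
    finally show ?thesis .
  qed
  have ps: "push b X f (\<Sum>p\<in>A. c p *Q F p) = (\<Sum>p\<in>A. c p *Q push b X f (F p))"
    for A :: "(nat \<Rightarrow> nat) set" and c F
  proof -
    have "push b X f 0 = 0" by (simp add: push_def linearize_def fun_eq_iff)
    then show ?thesis
      by (induction A rule: infinite_finite_induct) (simp_all add: push_def add sc)
  qed
  have "realization a b \<Phi> Y (push a X f t)
      = (\<Sum>p\<in>cells b a a 0. \<Phi> p *Q linearize (cube a Y) (\<lambda>x. \<lambda>i\<in>{1..b}. x (p i)) (push a X f t))"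
    using Y pt by (simp add: realization_def)
  also have "\<dots> = (\<Sum>p\<in>cells b a a 0. \<Phi> p *Q push b X f (linearize (cube a X) (\<lambda>x. \<lambda>i\<in>{1..b}. x (p i)) t))"
    by (intro sum.cong refl) (simp only: comm)
  also have "\<dots> = push b X f (realization a b \<Phi> X t)"
    using X t by (simp add: realization_def ps)
  finally show "realization a b \<Phi> Y (push a X f t) = push b X f (realization a b \<Phi> X t)" .
next
  show "realization a b \<Phi> X t = 0" if "X \<notin> fin_ne \<or> t \<notin> marginal_free a X" for X t
    using that by (auto simp: realization_def)
qed

text \<open>Copying coordinates along \<open>p'\<close> turns a point \<open>x\<close> into \<open>p\<close>, which avoids the base point, only if \<open>x\<close>
  does so too; then the generator has a nonzero coefficient at \<open>x\<close> only if \<open>x\<close> is the identity.\<close>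

lemma coefficients_realization:
  assumes \<Phi>: "\<Phi> \<in> free_module (cells b a a 0)"
  shows "coefficients a b (realization a b \<Phi>) = \<Phi>"
proof
  fix p
  show "coefficients a b (realization a b \<Phi>) p = \<Phi> p"
  proof (cases "p \<in> cells b a a 0")
    case p: True
    let ?e = "\<lambda>i\<in>{1..a}. i"
    have "linearize (cube a {0..a}) (\<lambda>x. \<lambda>i\<in>{1..b}. x (p' i)) (generator a) (restrict p {1..b}) = of_bool (p' = p)"
      if p': "p' \<in> cells b a a 0" for p'
    proof -
      let ?S = "{x. x \<in> cube a {0..a} \<and> (\<lambda>i\<in>{1..b}. x (p' i)) = restrict p {1..b}}"
      have fin: "finite ?S"
        by (rule finite_subset[of _ "cube a {0..a}"]) (auto intro!: finite_PiE)
      have 0: "generator a x = 0" if x: "x \<in> ?S" "x \<noteq> ?e" for x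
      proof -
        have xe: "x \<in> extensional {1..a}" using x(1) by (simp add: PiE_def)
        then obtain k where k: "k \<in> {1..a}" "x k \<noteq> k"
          using x(2) extensionalityI[OF xe, of ?e] by auto
        obtain i where i: "p' i = k" using p' k(1) by (auto simp: cells_def covering_def)
        have ib: "i \<in> {1..b}"
        proof (rule ccontr)
          assume "i \<notin> {1..b}"
          then have "p' i = 0" using p' by (simp add: cells_def covering_def pmaps_def)
          then show False using i k(1) by simp
        qed
        have "(\<lambda>i\<in>{1..b}. x (p' i)) i = restrict p {1..b} i" using x(1) by simp
        then have "x k = p i" using i ib by simp
        then have "x k \<noteq> 0" using cells_zero_values[OF p ib] by simp
        then have "(\<Prod>i=1..a. (\<lambda>i\<in>{1..a}. point_diff 0 i) i (x i)) = 0"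
          using k by (intro prod_zero bexI[of _ k]) (auto simp: point_diff_def)
        then show ?thesis by (simp add: generator_def pure_tensor_def)
      qed
      have 1: "generator a ?e = 1"
      proof -
        have "(\<Prod>i=1..a. (\<lambda>i\<in>{1..a}. point_diff 0 i) i (?e i)) = 1"
          by (intro prod.neutral) (auto simp: point_diff_def)
        then show ?thesis by (simp add: generator_def pure_tensor_def)
      qed
      have "?e \<in> ?S \<longleftrightarrow> p' = p"
      proof
        assume "?e \<in> ?S"
        then have e: "(\<lambda>i\<in>{1..b}. ?e (p' i)) = restrict p {1..b}" by blast
        show "p' = p"
        proof
          fix i
          show "p' i = p i"
          proof (cases "i \<in> {1..b}")
            case True
            then show ?thesis using fun_cong[OF e, of i] cells_zero_values[OF p' True] by simp
          next
            case False
            then show ?thesis using p p' by (simp add: cells_def covering_def pmaps_def)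
          qed
        qed
      next
        assume "p' = p"
        then have "(\<lambda>i\<in>{1..b}. ?e (p' i)) = restrict p {1..b}"
          using cells_zero_values[OF p] by (auto simp: fun_eq_iff simp del: One_nat_def atLeastAtMost_iff)
        then show "?e \<in> ?S" by (auto simp: restrict_PiE_iff)
      qed
      moreover have "sum (generator a) ?S = (if ?e \<in> ?S then 1 else 0)"
      proof -
        have "sum (generator a) ?S = (\<Sum>x\<in>?S. if x = ?e then 1 else 0)"
          by (intro sum.cong refl) (use 0 1 in auto)
        then show ?thesis using fin by (simp only: sum.delta)
      qed
      ultimately show ?thesis unfolding linearize_def by (simp only: of_bool_def)
    qed
    then have "realization a b \<Phi> {0..a} (generator a) (restrict p {1..b}) = (\<Sum>p'\<in>cells b a a 0. \<Phi> p' * of_bool (p' = p))"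
      using generator_marginal_free by (simp add: realization_def sum_scaleQ_apply)
    also have "\<dots> = (\<Sum>p'\<in>cells b a a 0. if p' = p then \<Phi> p' else 0)" by (intro sum.cong) auto
    also have "\<dots> = \<Phi> p" using p finite_cells by simp
    finally show ?thesis using p by (simp add: coefficients_def)
  next
    case False
    then show ?thesis using \<Phi> by (simp add: coefficients_def free_module_def)
  qed
qed

lemma hom_rep_space: "rspace (hom_rep a b) = nat_trans (cube_functor a) (cube_functor b)"
  by (simp add: hom_rep_def)

text \<open>Permuting the factors of the generator amounts to permuting the points \<open>1, \<dots>, a\<close> and fixing the
  base point, so naturality turns the action on the source into an action on values.\<close>

lemma coefficients_equivariant:
  assumes \<eta>: "\<eta> \<in> nat_trans (cube_functor a) (cube_functor b)"
    and s: "\<sigma> permutes {1..a}" and y: "y permutes {1..b}"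
  shows "coefficients a b (ract (hom_rep a b) (\<sigma>, y) \<eta>) = ract (cell_rep a b 0) (\<sigma>, y) (coefficients a b \<eta>)"
proof
  fix p
  let ?w = "\<eta> {0..a} (generator a)" and ?p = "inv' \<sigma> \<circ> p \<circ> inv' y"
  have \<sigma>0: "\<sigma> 0 = 0" by (rule permutes_zero[OF s])
  have \<sigma>: "\<sigma> \<in> {0..a} \<rightarrow> {0..a}" using permutes_le[OF s] by auto
  show "coefficients a b (ract (hom_rep a b) (\<sigma>, y) \<eta>) p = ract (cell_rep a b 0) (\<sigma>, y) (coefficients a b \<eta>) p"
  proof (cases "p \<in> cells b a a 0")
    case True
    have p': "?p \<in> cells b a a 0" using cells_conj_inv(2)[OF s y] True by blast
    have "holes b p = {}" using True by (simp add: cells_def)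
    then have sgn: "ord_sign (holes b p) y = 1" by (simp add: ord_sign_def ord_pairs_def)
    have "place_perm \<sigma> (generator a) = pure_tensor a ((\<lambda>i\<in>{1..a}. point_diff 0 i) \<circ> \<sigma>)"
      unfolding generator_def by (rule place_perm_pure[OF s])
    also have "\<dots> = pure_tensor a (restrict ((\<lambda>i\<in>{1..a}. point_diff 0 i) \<circ> \<sigma>) {1..a})"
      by (rule pure_tensor_restrict[symmetric])
    also have "restrict ((\<lambda>i\<in>{1..a}. point_diff 0 i) \<circ> \<sigma>) {1..a} = (\<lambda>i\<in>{1..a}. point_diff (\<sigma> 0) (\<sigma> i))"
      using permutes_in_image[OF s] \<sigma>0 by (intro restrict_ext) (simp del: One_nat_def atLeastAtMost_iff)
    finally have "place_perm \<sigma> (generator a) = push a {0..a} \<sigma> (generator a)" by (simp only: push_generator)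
    then have "\<eta> {0..a} (place_perm \<sigma> (generator a)) = push b {0..a} \<sigma> ?w"
      using nat_trans_cubeD(2)[OF \<eta> base_fin_ne base_fin_ne \<sigma> generator_marginal_free] by simp
    then have "coefficients a b (ract (hom_rep a b) (\<sigma>, y) \<eta>) p = push b {0..a} \<sigma> ?w (restrict p {1..b} \<circ> inv' y)"
      using True by (simp add: coefficients_def hom_rep_def place_perm_def)
    also have "\<dots> = ?w (restrict ?p {1..b})"
    proof -
      have yin: "inv' y i \<in> {1..b} \<longleftrightarrow> i \<in> {1..b}" for i using permutes_in_image[OF permutes_inv[OF y]] .
      have "{x. x \<in> cube b {0..a} \<and> (\<lambda>i\<in>{1..b}. \<sigma> (x i)) = restrict p {1..b} \<circ> inv' y} = {restrict ?p {1..b}}"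
      proof (intro equalityI subsetI)
        fix x assume "x \<in> {x. x \<in> cube b {0..a} \<and> (\<lambda>i\<in>{1..b}. \<sigma> (x i)) = restrict p {1..b} \<circ> inv' y}"
        then have x: "x \<in> extensional {1..b}" and eq: "(\<lambda>i\<in>{1..b}. \<sigma> (x i)) = restrict p {1..b} \<circ> inv' y"
          by (auto simp: PiE_def)
        have "x i = ?p i" if "i \<in> {1..b}" for i
        proof -
          have "\<sigma> (x i) = p (inv' y i)" using fun_cong[OF eq, of i] that yin[of i] by simp
          then show ?thesis using permutes_inverses(2)[OF s, of "x i"] by simp
        qed
        then have "x = restrict ?p {1..b}"
          using x by (intro extensionalityI[of x "{1..b}"]) auto
        then show "x \<in> {restrict ?p {1..b}}" by simp
      next
        fix x assume "x \<in> {restrict ?p {1..b}}"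
        then have x: "x = restrict ?p {1..b}" by simp
        have "(\<lambda>i\<in>{1..b}. \<sigma> (x i)) = restrict p {1..b} \<circ> inv' y"
        proof
          fix i
          show "(\<lambda>i\<in>{1..b}. \<sigma> (x i)) i = (restrict p {1..b} \<circ> inv' y) i"
            using yin[of i] by (cases "i \<in> {1..b}") (simp_all add: x permutes_inverses[OF s] del: One_nat_def atLeastAtMost_iff)
        qed
        moreover have "x \<in> cube b {0..a}" unfolding x by (rule cells_restrict(1)[OF p'])
        ultimately show "x \<in> {x. x \<in> cube b {0..a} \<and> (\<lambda>i\<in>{1..b}. \<sigma> (x i)) = restrict p {1..b} \<circ> inv' y}" by blast
      qed
      then show ?thesis unfolding push_def linearize_def by simp
    qed
    also have "\<dots> = ract (cell_rep a b 0) (\<sigma>, y) (coefficients a b \<eta>) p"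
      using p' by (simp add: cell_rep_act sgn coefficients_def)
    finally show ?thesis .
  next
    case False
    then show ?thesis using cells_conj_inv(2)[OF s y] by (simp add: cell_rep_act coefficients_def)
  qed
qed

lemma hom_rep_act_closed:
  assumes \<eta>: "\<eta> \<in> nat_trans (cube_functor a) (cube_functor b)"
    and s: "\<sigma> permutes {1..a}" and y: "y permutes {1..b}"
  shows "ract (hom_rep a b) (\<sigma>, y) \<eta> \<in> nat_trans (cube_functor a) (cube_functor b)"
proof -
  have act: "ract (hom_rep a b) (\<sigma>, y) \<eta> = (\<lambda>X t. place_perm y (\<eta> X (place_perm \<sigma> t)))"
    by (simp add: hom_rep_def)
  have pl: "place_perm f (t + t') = place_perm f t + place_perm f t'" "place_perm f (c *Q t) = c *Q place_perm f t"
    "place_perm f 0 = 0" for f c and t t' :: "(nat \<Rightarrow> nat) \<Rightarrow> rat"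
    by (auto simp: place_perm_def)
  show ?thesis
    unfolding act
  proof (rule nat_trans_cubeI)
    fix X assume X: "X \<in> fin_ne"
    note lin = nat_trans_cubeD(1)[OF \<eta> X, unfolded linear_on_def]
    have mem: "place_perm \<sigma> t \<in> marginal_free a X" if "t \<in> marginal_free a X" for t
      by (rule place_perm_marginal_free[OF s that])
    have img: "\<eta> X (place_perm \<sigma> t) \<in> marginal_free b X" if "t \<in> marginal_free a X" for t
      using lin mem[OF that] by blast
    show "linear_on (marginal_free a X) (marginal_free b X) (\<lambda>t. place_perm y (\<eta> X (place_perm \<sigma> t)))"
      unfolding linear_on_def
    proof (intro conjI ballI allI funcsetI)
      fix t assume t: "t \<in> marginal_free a X"
      show "place_perm y (\<eta> X (place_perm \<sigma> t)) \<in> marginal_free b X"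
        by (rule place_perm_marginal_free[OF y img[OF t]])
      show "place_perm y (\<eta> X (place_perm \<sigma> (c *Q t))) = c *Q place_perm y (\<eta> X (place_perm \<sigma> t))" for c
        using lin mem[OF t] by (simp only: pl)
      fix t' assume t': "t' \<in> marginal_free a X"
      show "place_perm y (\<eta> X (place_perm \<sigma> (t + t')))
          = place_perm y (\<eta> X (place_perm \<sigma> t)) + place_perm y (\<eta> X (place_perm \<sigma> t'))"
        using lin mem[OF t] mem[OF t'] by (simp only: pl)
    qed
    fix Y f t assume Y: "Y \<in> fin_ne" and f: "f \<in> X \<rightarrow> Y" and t: "t \<in> marginal_free a X"
    show "place_perm y (\<eta> Y (place_perm \<sigma> (push a X f t))) = push b X f (place_perm y (\<eta> X (place_perm \<sigma> t)))"
      using nat_trans_cubeD(2)[OF \<eta> X Y f mem[OF t]] by (simp only: push_place_perm[OF s] push_place_perm[OF y])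
  next
    fix X t assume 0: "X \<notin> fin_ne \<or> t \<notin> marginal_free a X"
    have "place_perm \<sigma> t \<in> marginal_free a X \<Longrightarrow> t \<in> marginal_free a X"
      using place_perm_marginal_free[OF permutes_inv[OF s], of "place_perm \<sigma> t" X]
      by (simp only: place_perm_inverse[OF s])
    then have "\<eta> X (place_perm \<sigma> t) = 0" using 0 nat_trans_cubeD(3)[OF \<eta>] by blast
    then show "place_perm y (\<eta> X (place_perm \<sigma> t)) = 0" by (simp only: pl)
  qed
qed

lemma coefficients_rep_hom:
  "coefficients a b \<in> rep_hom (sym_bigroup a b) (hom_rep a b) (kernel_rep (cell_rep a b 0) (coboundary b a a))"
proof (rule rep_homI)
  fix \<eta> assume \<eta>: "\<eta> \<in> rspace (hom_rep a b)"
  have "coefficients a b \<eta> \<in> free_module (cells b a a 0)" by (simp add: coefficients_def free_module_def)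
  then show "coefficients a b \<eta> \<in> rspace (kernel_rep (cell_rep a b 0) (coboundary b a a))"
    using coefficients_cocycle \<eta> hom_rep_space by (simp add: kernel_rep_def cell_rep_def)
  show "coefficients a b (\<eta> + \<eta>') = coefficients a b \<eta> + coefficients a b \<eta>'" for \<eta>'
    by (auto simp: coefficients_def fun_eq_iff)
  show "coefficients a b (c *Q \<eta>) = c *Q coefficients a b \<eta>" for c
    by (auto simp: coefficients_def fun_eq_iff)
  fix g assume g: "g \<in> carrier (sym_bigroup a b)"
  obtain \<sigma> y where gd: "g = (\<sigma>, y)" by (cases g)
  have "\<sigma> permutes {1..a}" "y permutes {1..b}" using g unfolding gd sym_bigroup_simps by blast+
  then show "coefficients a b (ract (hom_rep a b) g \<eta>)
      = ract (kernel_rep (cell_rep a b 0) (coboundary b a a)) g (coefficients a b \<eta>)"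
    using coefficients_equivariant[of \<eta>] \<eta> hom_rep_space unfolding gd by (simp only: kernel_rep_def rep.select_convs)
qed

lemma coefficients_bij:
  "bij_betw (coefficients a b) (rspace (hom_rep a b)) (rspace (kernel_rep (cell_rep a b 0) (coboundary b a a)))"
proof -
  have "inj_on (coefficients a b) (rspace (hom_rep a b))"
    unfolding hom_rep_space by (rule inj_onI) (rule coefficients_inj)
  moreover have "rspace (kernel_rep (cell_rep a b 0) (coboundary b a a)) \<subseteq> coefficients a b ` rspace (hom_rep a b)"
  proof
    fix \<Phi> assume "\<Phi> \<in> rspace (kernel_rep (cell_rep a b 0) (coboundary b a a))"
    then have "\<Phi> \<in> free_module (cells b a a 0)" "coboundary b a a \<Phi> = 0"
      by (simp_all add: kernel_rep_def cell_rep_def)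
    then show "\<Phi> \<in> coefficients a b ` rspace (hom_rep a b)"
      using coefficients_realization realization_nat_trans unfolding hom_rep_space by (metis image_eqI)
  qed
  ultimately show ?thesis
    unfolding bij_betw_def using rep_homD(1)[OF coefficients_rep_hom] by blast
qed

lemma place_perm_comp:
  assumes "f permutes {1..n}" "g permutes {1..n}"
  shows "place_perm (f \<circ> g) t = place_perm g (place_perm f t)"
  using o_inv_distrib[OF permutes_bij[OF assms(1)] permutes_bij[OF assms(2)]]
  by (simp add: place_perm_def comp_assoc)

text \<open>Natural transformations are the images of the finite-dimensional space of cocycles under the linear map
  \<open>realization\<close>.\<close>

lemma fd_rep_hom: "fd_rep (sym_bigroup a b) (hom_rep a b)"
  unfolding fd_rep_def
proof (intro conjI ballI)
  let ?K = "kernel_rep (cell_rep a b 0) (coboundary b a a)" and ?L = "realization a b"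
  have act: "ract (hom_rep a b) (\<sigma>, y) \<eta> = (\<lambda>X t. place_perm y (\<eta> X (place_perm \<sigma> t)))" for \<sigma> y \<eta>
    by (simp add: hom_rep_def)
  have "fd_rep (sym_bigroup a b) ?K" by (rule fd_rep_kernel[OF fd_rep_cell fd_rep_cell coboundary_rep_hom])
  then obtain B where B: "finite B" "rspace ?K = Q.span B" unfolding fd_rep_def by blast
  have lin: "Vector_Spaces.linear scaleQ scaleQ ?L"
    unfolding Vector_Spaces.linear_iff
    by (auto simp: realization_def fun_eq_iff sum_scaleQ_apply distrib_right sum.distrib sum_distrib_left mult.assoc
        intro: Q.vector_space_axioms)
  have "?L (coefficients a b \<eta>) = \<eta>" if "\<eta> \<in> rspace (hom_rep a b)" for \<eta>
  proof -
    have K: "coefficients a b \<eta> \<in> rspace ?K" by (rule rep_homD(1)[OF coefficients_rep_hom that])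
    then show ?thesis
      using that coefficients_realization realization_nat_trans
      unfolding hom_rep_space by (intro coefficients_inj) (auto simp: kernel_rep_def cell_rep_def)
  qed
  moreover have "?L ` rspace ?K \<subseteq> rspace (hom_rep a b)"
    using realization_nat_trans unfolding hom_rep_space by (auto simp: kernel_rep_def cell_rep_def)
  ultimately have "rspace (hom_rep a b) = ?L ` rspace ?K"
    using rep_homD(1)[OF coefficients_rep_hom] by (metis image_eqI subsetI subset_antisym)
  also have "\<dots> = Q.span (?L ` B)" unfolding B(2) by (rule QQ.linear_span_image[OF lin, symmetric])
  finally have "rspace (hom_rep a b) = Q.span (?L ` B)" .
  with finite_imageI[OF B(1)] show "\<exists>C. finite C \<and> rspace (hom_rep a b) = Q.span C"
    by (rule exI[where x = "?L ` B", OF conjI])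
  fix g assume g: "g \<in> carrier (sym_bigroup a b)"
  obtain \<sigma> y where gd: "g = (\<sigma>, y)" by (cases g)
  have sy: "\<sigma> permutes {1..a}" "y permutes {1..b}" using g unfolding gd sym_bigroup_simps by blast+
  show "linear_on (rspace (hom_rep a b)) (rspace (hom_rep a b)) (ract (hom_rep a b) g)"
    using hom_rep_act_closed[OF _ sy] unfolding linear_on_def hom_rep_space gd act
    by (auto simp: place_perm_def fun_eq_iff)
  fix h \<eta> assume h: "h \<in> carrier (sym_bigroup a b)"
  obtain \<sigma>' y' where hd: "h = (\<sigma>', y')" by (cases h)
  have sy': "\<sigma>' permutes {1..a}" "y' permutes {1..b}" using h unfolding hd sym_bigroup_simps by blast+
  show "ract (hom_rep a b) (g \<otimes>\<^bsub>sym_bigroup a b\<^esub> h) \<eta> = ract (hom_rep a b) g (ract (hom_rep a b) h \<eta>)"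
    unfolding gd hd sym_bigroup_simps act place_perm_comp[OF sy(1) sy'(1)] place_perm_comp[OF sy'(2) sy(2)] ..
next
  fix \<eta> show "ract (hom_rep a b) \<one>\<^bsub>sym_bigroup a b\<^esub> \<eta> = \<eta>"
    unfolding sym_bigroup_simps by (simp add: hom_rep_def place_perm_def)
qed

section \<open>The alternating sum\<close>

theorem theorem3:
  fixes a b :: nat
  assumes "0 < a" and "a < b"
  shows "fd_rep (sym_bigroup a b) (hom_rep a b) \<and>
    rep_class (sym_bigroup a b) (hom_rep a b) =
      rep_class (sym_bigroup a b) sgn_rep
        [^]\<^bsub>grothendieck_group (sym_bigroup a b)\<^esub> ((-1) ^ (b - a + 1) :: int)
      \<otimes>\<^bsub>grothendieck_group (sym_bigroup a b)\<^esub>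
      (\<Otimes>\<^bsub>grothendieck_group (sym_bigroup a b)\<^esub>t\<in>{0..b - a}.
         rep_class (sym_bigroup a b) (induced_surj_rep a b t)
           [^]\<^bsub>grothendieck_group (sym_bigroup a b)\<^esub> ((-1) ^ t :: int))"
proof
  let ?G = "sym_bigroup a b" and ?C = "cell_rep a b" and ?K = "kernel_rep (cell_rep a b 0) (coboundary b a a)"
  let ?R = "grothendieck_group ?G"
  interpret R: comm_group ?R by (rule comm_group_grothendieck)
  have K: "fd_rep ?G ?K" by (rule fd_rep_kernel[OF fd_rep_cell fd_rep_cell coboundary_rep_hom])
  show fd: "fd_rep ?G (hom_rep a b)" by (rule fd_rep_hom)
  have iso: "rep_iso ?G (hom_rep a b) ?K"
    unfolding rep_iso_def using coefficients_rep_hom coefficients_bij by blast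
  define m where "m = b - a"
  have m: "0 < m" "a + m = b" using assms by (simp_all add: m_def)
  have sp: "rspace (?C t) = free_module (cells b a a t)" for t by (simp add: cell_rep_def)
  have ex: "coboundary b a a ` rspace (?C t) = {v \<in> rspace (?C (Suc t)). coboundary b a a v = 0}" if "Suc t < m" for t
  proof (intro equalityI subsetI)
    fix v assume "v \<in> coboundary b a a ` rspace (?C t)"
    then show "v \<in> {v \<in> rspace (?C (Suc t)). coboundary b a a v = 0}" using coboundary_closed coboundary_coboundary unfolding sp by blast
  next
    fix v assume "v \<in> {v \<in> rspace (?C (Suc t)). coboundary b a a v = 0}"
    moreover have "a + Suc t \<noteq> b" using that m by simp
    ultimately show "v \<in> coboundary b a a ` rspace (?C t)" using exact_positive_degree unfolding sp by blast
  qed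
  have ex_last: "coboundary b a a ` rspace (?C t) = {v \<in> rspace (?C m). top_sign b a v = 0}" if t: "Suc t = m" for t
  proof (intro equalityI subsetI)
    fix v assume "v \<in> coboundary b a a ` rspace (?C t)"
    then show "v \<in> {v \<in> rspace (?C m). top_sign b a v = 0}"
      using coboundary_closed top_sign_coboundary t m(2) unfolding sp by blast
  next
    fix v assume v: "v \<in> {v \<in> rspace (?C m). top_sign b a v = 0}"
    \<comment> \<open>In degree \<open>m\<close> the coboundary is zero: a map defined on fewer than \<open>a\<close> positions is not onto.\<close>
    have "cells b a a (Suc m) = {}"
    proof -
      have "p \<notin> cells b a a (Suc m)" for p
      proof
        assume p: "p \<in> cells b a a (Suc m)"
        have "card ({1..b} - holes b p) = b - Suc m"
          using p by (subst card_Diff_subset) (auto simp: cells_def holes_def)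
        moreover have "card {1..a} \<le> card ({1..b} - holes b p)"
          unfolding cells_image[OF p, symmetric] by (rule card_image_le) simp
        ultimately show False using m assms by simp
      qed
      then show ?thesis by blast
    qed
    then have "coboundary b a a v = 0"
      using coboundary_closed[of v b a a m] v unfolding sp by (auto simp: free_module_def fun_eq_iff)
    then show "v \<in> coboundary b a a ` rspace (?C t)"
      using v t exact_positive_degree[of v b a t] unfolding sp by blast
  qed
  have "rep_class ?G (hom_rep a b) = rep_class ?G ?K" by (rule rep_class_iso[OF iso fd K])
  also have "\<dots> = rep_class ?G sgn_rep [^]\<^bsub>?R\<^esub> ((-1) ^ (m + 1) :: int) \<otimes>\<^bsub>?R\<^esub>
      (\<Otimes>\<^bsub>?R\<^esub>t\<in>{0..m}. rep_class ?G (?C t) [^]\<^bsub>?R\<^esub> ((-1) ^ t :: int))"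
    by (rule rep_class_long_exact[where d = "\<lambda>_. coboundary b a a" and C = ?C and e = "top_sign b a", OF m(1)
          fd_rep_cell fd_rep_sgn coboundary_rep_hom top_sign_rep_hom[OF m(2)] ex ex_last])
      (simp_all add: sp top_sign_surj[OF m(2)] sgn_rep_def)
  also have "(\<Otimes>\<^bsub>?R\<^esub>t\<in>{0..m}. rep_class ?G (?C t) [^]\<^bsub>?R\<^esub> ((-1) ^ t :: int))
      = (\<Otimes>\<^bsub>?R\<^esub>t\<in>{0..m}. rep_class ?G (induced_surj_rep a b t) [^]\<^bsub>?R\<^esub> ((-1) ^ t :: int))"
  proof (rule R.finprod_cong')
    fix t assume "t \<in> {0..m}"
    then have t: "t \<le> b" using m(2) by simp
    show "rep_class ?G (?C t) [^]\<^bsub>?R\<^esub> ((-1) ^ t :: int) = rep_class ?G (induced_surj_rep a b t) [^]\<^bsub>?R\<^esub> ((-1) ^ t :: int)"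
      using rep_class_iso[OF cell_rep_iso_induced[OF t] fd_rep_cell fd_rep_induced_surj[OF t]] by simp
  next
    have "rep_class ?G (induced_surj_rep a b t) \<in> carrier ?R" if "t \<in> {0..m}" for t
      using that m(2) by (intro rep_class_closed fd_rep_induced_surj) simp
    then show "(\<lambda>t. rep_class ?G (induced_surj_rep a b t) [^]\<^bsub>?R\<^esub> ((-1) ^ t :: int)) \<in> {0..m} \<rightarrow> carrier ?R"
      by (auto intro: R.int_pow_closed)
  qed simp
  finally show "rep_class ?G (hom_rep a b) = rep_class ?G sgn_rep [^]\<^bsub>?R\<^esub> ((-1) ^ (b - a + 1) :: int) \<otimes>\<^bsub>?R\<^esub>
      (\<Otimes>\<^bsub>?R\<^esub>t\<in>{0..b - a}. rep_class ?G (induced_surj_rep a b t) [^]\<^bsub>?R\<^esub> ((-1) ^ t :: int))"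
    unfolding m_def .
qed

end
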